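(* Let $\widehat\mu$ be defined with the random Monte Carlo weights $\omega_{ij}=\omega_{ij}^{\mathrm{MC}}$ of the context. Assume: the data generating conditions (i)-(iv) of the context; these weights are admissible (as defined in the context); every $\phi_k$ is Lipschitz continuous; there exist $\alpha\in(0,1]$ and a measurable $L_\mu:\mathcal U\to\mathbb R_+$ with $\int_{\mathcal U}L_\mu^2\,d\nu<\infty$ and $|\mu(u,t)-\mu(u,t')|\le L_\mu(u)|t-t'|^\alpha$ for all $u\in\mathcal U$, $t,t'\in\mathcal T$; there are $s>0$ and a finite $C_s>0$ with $\sum_{k\ge1}k^{2s}\|\beta_k\|^2_{L^2(\mathcal U)}\le C_s$; the polynomial growth condition of the context holds with constants $q\ge0$ and $\bar C_{\mathrm{MC}}>0$; $\Gamma_X$ is continuous; $1\le m_i\le m_{\max}<\infty$ for all $1\le i\le n$, with $m_{\max}$ independent of $n$; and $M\ge4$. Let $C_1^{\mathrm{MC}}=\kappa\bigl(\|\Gamma_X\|_\infty m_{\max}+\|\tau\|_\infty^2\nu(\mathcal U)\bigr)/g_{\min}$, with $\kappa$ the constant of the context, and set $\mathcal C_M=C_1^{\mathrm{MC}}+\bar C_{\mathrm{MC}}M^{-2\alpha}$. Then the sum of the first three terms of the risk bound (valid under these assumptions for every $K\ge1$) $$\mathcal R(\widehat\mu;K)\le C_sK^{-2s}+C_1^{\mathrm{MC}}\frac KM+\bar C_{\mathrm{MC}}\Bigl(\frac K{M^{1+2\alpha}}+\frac{K^{1+2q}}{M^3}\Bigr),$$ that is $C_sK^{-2s}+C_1^{\mathrm{MC}}K/M+\bar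 C_{\mathrm{MC}}K/M^{1+2\alpha}$, is minimized at $$K^*_{\mathrm{MC}}=\bigl\{2sC_sM\,\mathcal C_M^{-1}\bigr\}^{\frac1{2s+1}},$$ and the resulting risk satisfies $$\mathcal R^*(\widehat\mu)=\mathcal R(\widehat\mu;K^*_{\mathrm{MC}})\le\Bigl[\tfrac{2s+1}{2s}\bigl(2sC_s\mathcal C_M^{2s}\bigr)^{\frac1{2s+1}}\Bigr]M^{-\frac{2s}{2s+1}}+\bar C_{\mathrm{MC}}\Bigl(\frac{2sC_s}{\mathcal C_M}\Bigr)^{\frac{1+2q}{2s+1}}M^{\frac{1+2q}{2s+1}-3}.$$ The last term is $o\bigl(M^{-2s/(2s+1)}\bigr)$ if and only if $q<2s+1$, in which case $\mathcal R^*(\widehat\mu)\lesssim M^{-2s/(2s+1)}$.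
   Context: $\mathcal T\subset\mathbb R$ is a compact interval with Lebesgue measure; $(\mathcal U,d_{\mathcal U})$ is a separable metric space with its Borel $\sigma$-field and a finite Borel measure $\nu$. For subjects $i=1,\dots,n$ and visits $j=1,\dots,m_i$, one observes $(T_{ij},Y_{ij}(\cdot))$ with $$Y_{ij}(u)=\mu(u,T_{ij})+X_i(u,T_{ij})+\varepsilon_{ij}(u),\quad u\in\mathcal U,$$ where $\mu\in L^2(\mathcal U\times\mathcal T)$ is the deterministic mean function. $M=m_1+\dots+m_n$. Data generating conditions: (i) the $X_i$ are independent copies of a random field $X$ on $\mathcal U\times\mathcal T$ with $\mathbb E\|X\|^2_{L^2(\mathcal U\times\mathcal T)}<\infty$ and $\mathbb E[X(u,t)]=0$ for all $(u,t)$; (ii) the $T_{ij}$ are i.i.d. copies of $T$ with Lipschitz continuous density $g$, positive on $\mathcal T$; $g_{\min}=\inf_{\mathcal T}g$, $g_{\max}=\sup_{\mathcal T}g$; (iii) $\varepsilon_{ij}(u)=\tau(T_{ij})\eta_{ij}(u)$ with $\tau:\mathcal T\to\mathbb R_+$ bounded deterministic and $\eta_{ij}$ i.i.d. random fields on $\mathcal U$ with $\mathbb E[\eta_{ij}(u)]=0$, $\mathrm{Var}(\eta_{ij}(u))=1$ for all $u$; (iv) the collections $\{T_{ij}\}$, $\{X_i\}$, $\{\eta_{ij}\}$ are mutually independent. $\Gamma_X(t,t')=\mathbb E\langle X(\cdot,t),X(\cdot,t')\rangle_{L^2(\mathcal U)}$; $\|\cdot\|_\infty$ is the sup norm. $\{\phi_k\}_{k\ge1}$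 is an orthonormal basis of $L^2(\mathcal T)$, $\beta_k(u)=\int_{\mathcal T}\mu(u,t)\phi_k(t)\,dt$. Estimator (with $g$ known): $\widehat\beta_k(u)=\sum_{i,j}\omega_{ij}Y_{ij}(u)\phi_k(T_{ij})/g(T_{ij})$, $\widehat\mu(u,t)=\widehat\mu_K(u,t)=\sum_{k=1}^K\widehat\beta_k(u)\phi_k(t)$ for an integer truncation level $K\ge1$, and $\mathcal R(\widehat\mu;K)=\mathbb E\|\widehat\mu_K-\mu\|^2_{L^2(\mathcal U\times\mathcal T)}$. The value $K^*_{\mathrm{MC}}$ is the unrounded minimizer; in practice one takes the ceiling or the nearest integer. $a\lesssim b$ means $a\le Cb$ for a positive constant $C$. Admissible weights: the $\omega_{ij}$ are measurable with respect to $\sigma(\{T_{ij}\})$, $\sum_{i,j}\omega_{ij}=1$; for any integrable $\psi(T)$, $\sum_{i,j}\mathbb E[\omega_{ij}\psi(T_{ij})]=\mathbb E[\psi(T)]$; and there is $C_0\ge0$ with $\sum_{i,j}\omega_{ij}^2\le1+C_0M^{-1}$. Monte Carlo (control-neighbors) weights: let $\mathcal S=\{T_{ij}\}$ be the set of all design points. For $t\in\mathcal T$, $\widehat N(t;\mathcal S\setminus\{T_{i'j'}\})$ is the nearest neighbor of $t$ in $\mathcal S\setminus\{T_{i'j'}\}$ (ties broken by lexicographic order). Let $\mathcal V_{ij}^{(i'j')}=\{t\in\mathcal T:\widehat N(t;\mathcal S\setminus\{T_{i'j'}\})=T_{ij}\}$ and $V_{ij}^{(i'j')}=\int_{\mathcal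 V_{ij}^{(i'j')}}g(v)\,dv$. Put $\widehat d_{ij}=\sum_{(i',j')\ne(i,j)}\mathbf 1\{T_{i'j'}\in\mathcal V_{ij}^{(i'j')}\}$, $\widehat c_{ij}=\sum_{(i',j')\ne(i,j)}V_{ij}^{(i'j')}$ and $\omega_{ij}^{\mathrm{MC}}=(1+\widehat c_{ij}-\widehat d_{ij})/M$. Constant $\kappa$: a constant depending only on $g_{\min},g_{\max}$ (one may take $\kappa=5+6(g_{\max}/g_{\min})^2$) such that $\mathbb E\bigl[\sum_{i,j}(\omega_{ij}^{\mathrm{MC}})^2h(T_{ij})\bigr]\le\frac\kappa M\int_{\mathcal T}h(t)g(t)\,dt$ for every non-negative integrable $h(T)$. Polynomial growth condition: with $B_k(u)=\sum_{i,j}\omega_{ij}^{\mathrm{MC}}\mu(u,T_{ij})\phi_k(T_{ij})/g(T_{ij})$, it is known that under the data generating conditions, the Hölder condition on $\mu$ and the Lipschitz condition on the $\phi_k$, for $M\ge4$ there exist constants $C_{1,\mathrm{MC}}(u)$ and $C_{2,\mathrm{MC}}(u;k)$ with $\mathrm{Var}(B_k(u))\le C_{1,\mathrm{MC}}^2(u)M^{-1-2\alpha}+C_{2,\mathrm{MC}}^2(u;k)M^{-3}$; both depend on $\alpha$, the Lipschitz constant of $g$, $L_\mu(u)$, $g_{\min}$, $g_{\max}$ and $\|\mu(u,\cdot)\|_\infty$, and $C_{2,\mathrm{MC}}(u;k)$ is in addition proportional to $\|\phi_k\|_\infty$ times the Lipschitz constant of $\phi_k$. The condition is: for these constants there exist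 $q\ge0$ and $\bar C_{\mathrm{MC}}>0$ with $\int_{\mathcal U}C_{1,\mathrm{MC}}^2(u)\,d\nu(u)\le\bar C_{\mathrm{MC}}$ and $\int_{\mathcal U}C_{2,\mathrm{MC}}^2(u;k)\,d\nu(u)\le\bar C_{\mathrm{MC}}k^{2q}$ for all $k\ge1$.
   Formalization: The equivalence with q<2s+1 and the final rate are stated for C_1^MC>0; if C_1^MC=0 (no random field, no noise) then C_M is of order M^(-2α) and the equivalence fails, the true condition being (1+2q)(1+2α)<4s+3. *)

theory Defs
  imports "HOL-Probability.Probability" "HOL-Library.Landau_Symbols"
begin

section \<open>Norms and constants of real functions\<close>

definition sup_norm :: "'a set \<Rightarrow> ('a \<Rightarrow> real) \<Rightarrow> real" where
  "sup_norm A f = (SUP x\<in>A. \<bar>f x\<bar>)"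

definition lip_const :: "real set \<Rightarrow> (real \<Rightarrow> real) \<Rightarrow> real" where
  "lip_const A f = Inf {L. L-lipschitz_on A f}"


section \<open>The population model\<close>

text \<open>
  The laws of the generic random field \<open>X\<close> and of the generic noise field \<open>\<eta>\<close> are given as
  probability measures on spaces of sample paths.  Their sigma-algebras are arbitrary, subject to
  joint measurability of the evaluation map (see \<open>population\<close>).  Joint measurability of a
  field in the sample point and its arguments, together with independence of its
  finite-dimensional marginals from a random time, would not do: on the unit interval, the
  field \<open>X(\<omega>, t) = 1{t = \<omega>}\<close> vanishes almost surely at each fixed \<open>t\<close> and is in that sense
  independent of \<open>T(\<omega>) = \<omega>\<close>, but \<open>X(\<omega>, T(\<omega>)) = 1\<close>.
\<close>

record 'u model =
  lower :: real
  upper :: real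
  state_measure :: "'u measure"
  mean_fun :: "'u \<Rightarrow> real \<Rightarrow> real"
  dens :: "real \<Rightarrow> real"
  noise_scale :: "real \<Rightarrow> real"
  field_law :: "('u \<Rightarrow> real \<Rightarrow> real) measure"
  noise_law :: "('u \<Rightarrow> real) measure"

definition time_dom :: "'u model \<Rightarrow> real set" where
  "time_dom S = {lower S..upper S}"

definition time_measure :: "'u model \<Rightarrow> real measure" where
  "time_measure S = restrict_space lborel (time_dom S)"

definition state_time_measure :: "'u model \<Rightarrow> ('u \<times> real) measure" where
  "state_time_measure S = state_measure S \<Otimes>\<^sub>M time_measure S"

definition dens_min :: "'u model \<Rightarrow> real" where
  "dens_min S = (INF t\<in>time_dom S. dens S t)"

definition dens_max :: "'u model \<Rightarrow> real" where
  "dens_max S = (SUP t\<in>time_dom S. dens S t)"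

definition design_density :: "'u model \<Rightarrow> real \<Rightarrow> ennreal" where
  "design_density S t = indicator (time_dom S) t * ennreal (dens S t)"

definition design_law :: "'u model \<Rightarrow> real measure" where
  "design_law S = density lborel (design_density S)"

definition population ::
    "('u::{metric_space, second_countable_topology}) model \<Rightarrow> bool" where
  "population S \<longleftrightarrow>
     lower S < upper S \<and>
     finite_measure (state_measure S) \<and> sets (state_measure S) = sets borel \<and>
     (\<lambda>(u, t). mean_fun S u t) \<in> borel_measurable (state_time_measure S) \<and>
     (\<integral>\<^sup>+(u, t). ennreal ((mean_fun S u t)\<^sup>2) \<partial>state_time_measure S) < \<infinity> \<and>
     \<comment> \<open>law of the random field\<close>
     prob_space (field_law S) \<and>
     (\<lambda>(x, (u, t)). x u t) \<in> borel_measurable (field_law S \<Otimes>\<^sub>M state_time_measure S) \<and>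
     (\<integral>\<^sup>+x. (\<integral>\<^sup>+(u, t). ennreal ((x u t)\<^sup>2) \<partial>state_time_measure S) \<partial>field_law S) < \<infinity> \<and>
     (\<forall>u. \<forall>t\<in>time_dom S. integrable (field_law S) (\<lambda>x. x u t) \<and> (\<integral>x. x u t \<partial>field_law S) = 0) \<and>
     \<comment> \<open>design density\<close>
     prob_space (design_law S) \<and>
     (\<exists>L. L-lipschitz_on (time_dom S) (dens S)) \<and> (\<forall>t\<in>time_dom S. 0 < dens S t) \<and>
     \<comment> \<open>noise\<close>
     noise_scale S \<in> borel_measurable (time_measure S) \<and>
     (\<forall>t\<in>time_dom S. 0 \<le> noise_scale S t) \<and> bdd_above (noise_scale S ` time_dom S) \<and>
     prob_space (noise_law S) \<and>
     (\<lambda>(e, u). e u) \<in> borel_measurable (noise_law S \<Otimes>\<^sub>M state_measure S) \<and>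
     (\<forall>u. integrable (noise_law S) (\<lambda>e. e u) \<and> integrable (noise_law S) (\<lambda>e. (e u)\<^sup>2) \<and>
          (\<integral>e. e u \<partial>noise_law S) = 0 \<and>
          prob_space.variance (noise_law S) (\<lambda>e. e u) = 1)"

definition Gamma_X :: "'u model \<Rightarrow> real \<Rightarrow> real \<Rightarrow> real" where
  "Gamma_X S t t' = (\<integral>x. (\<integral>u. x u t * x u t' \<partial>state_measure S) \<partial>field_law S)"


section \<open>Samples\<close>

record ('w, 'u) trial =
  basic_space :: "'w measure"
  subjects :: nat
  visits :: "nat \<Rightarrow> nat"
  visit_time :: "nat \<times> nat \<Rightarrow> 'w \<Rightarrow> real"
  field_path :: "nat \<Rightarrow> 'w \<Rightarrow> 'u \<Rightarrow> real \<Rightarrow> real"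
  noise_path :: "nat \<times> nat \<Rightarrow> 'w \<Rightarrow> 'u \<Rightarrow> real"

definition index_set :: "('w, 'u) trial \<Rightarrow> (nat \<times> nat) set" where
  "index_set E = Sigma {1..subjects E} (\<lambda>i. {1..visits E i})"

definition sample_size :: "('w, 'u) trial \<Rightarrow> nat" where
  "sample_size E = (\<Sum>i=1..subjects E. visits E i)"

definition generated_algebra ::
    "'w measure \<Rightarrow> 'b measure \<Rightarrow> ('i \<Rightarrow> 'w \<Rightarrow> 'b) \<Rightarrow> 'i set \<Rightarrow> 'w measure" where
  "generated_algebra P N Z I = sigma (space P) (\<Union>i\<in>I. {Z i -` A \<inter> space P |A. A \<in> sets N})"

datatype source = Design | Field | Noise

definition data_generating ::
    "('u::{metric_space, second_countable_topology}) model \<Rightarrow> ('w, 'u) trial \<Rightarrow> bool" where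
  "data_generating S E \<longleftrightarrow>
     (let P = basic_space E; I = index_set E in
       prob_space P \<and>
       prob_space.indep_vars P (\<lambda>_. field_law S) (field_path E) {1..subjects E} \<and>
       (\<forall>i\<in>{1..subjects E}. distr P (field_law S) (field_path E i) = field_law S) \<and>
       prob_space.indep_vars P (\<lambda>_. borel) (visit_time E) I \<and>
       (\<forall>p\<in>I. \<forall>w\<in>space P. visit_time E p w \<in> time_dom S) \<and>
       (\<forall>p\<in>I. distributed P lborel (visit_time E p) (design_density S)) \<and>
       prob_space.indep_vars P (\<lambda>_. noise_law S) (noise_path E) I \<and>
       (\<forall>p\<in>I. distr P (noise_law S) (noise_path E p) = noise_law S) \<and>
       prob_space.indep_sets P
         (\<lambda>c. case c of
            Design \<Rightarrow> sets (generated_algebra P borel (visit_time E) I)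
          | Field \<Rightarrow> sets (generated_algebra P (field_law S) (field_path E) {1..subjects E})
          | Noise \<Rightarrow> sets (generated_algebra P (noise_law S) (noise_path E) I))
         UNIV)"

definition response ::
    "'u model \<Rightarrow> ('w, 'u) trial \<Rightarrow> nat \<times> nat \<Rightarrow> 'w \<Rightarrow> 'u \<Rightarrow> real" where
  "response S E p w u =
     (let t = visit_time E p w in
       mean_fun S u t + field_path E (fst p) w u t + noise_scale S t * noise_path E p w u)"


section \<open>Monte Carlo weights\<close>

definition closest :: "('i \<Rightarrow> real) \<Rightarrow> 'i set \<Rightarrow> real \<Rightarrow> 'i set" where
  "closest x C t = {q \<in> C. \<forall>r\<in>C. \<bar>t - x q\<bar> \<le> \<bar>t - x r\<bar>}"

text \<open>The order that Isabelle's library puts on pairs may be componentwise, hence the explicit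
  lexicographic relation.\<close>

definition nearest_neighbor :: "(nat \<times> nat \<Rightarrow> real) \<Rightarrow> (nat \<times> nat) set \<Rightarrow> real \<Rightarrow> real" where
  "nearest_neighbor x C t =
     x (THE q. q \<in> closest x C t \<and>
               (\<forall>r\<in>closest x C t. r = q \<or> (q, r) \<in> less_than <*lex*> less_than))"

text \<open>In the following definitions \<open>x\<close> is a realization of the design, and
  \<open>{q \<in> I. x q \<noteq> x p'}\<close> indexes the set of design points with the point \<open>x p'\<close> removed.\<close>

definition voronoi_cell ::
    "'u model \<Rightarrow> (nat \<times> nat) set \<Rightarrow> (nat \<times> nat \<Rightarrow> real) \<Rightarrow>
       nat \<times> nat \<Rightarrow> nat \<times> nat \<Rightarrow> real set" where
  "voronoi_cell S I x p p' = {t \<in> time_dom S. nearest_neighbor x {q \<in> I. x q \<noteq> x p'} t = x p}"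

definition voronoi_volume ::
    "'u model \<Rightarrow> (nat \<times> nat) set \<Rightarrow> (nat \<times> nat \<Rightarrow> real) \<Rightarrow>
       nat \<times> nat \<Rightarrow> nat \<times> nat \<Rightarrow> real" where
  "voronoi_volume S I x p p' = (LINT v:voronoi_cell S I x p p'|lborel. dens S v)"

definition neighbor_degree ::
    "'u model \<Rightarrow> (nat \<times> nat) set \<Rightarrow> (nat \<times> nat \<Rightarrow> real) \<Rightarrow> nat \<times> nat \<Rightarrow> real" where
  "neighbor_degree S I x p = (\<Sum>p'\<in>I - {p}. indicator (voronoi_cell S I x p p') (x p'))"

definition neighbor_volume ::
    "'u model \<Rightarrow> (nat \<times> nat) set \<Rightarrow> (nat \<times> nat \<Rightarrow> real) \<Rightarrow> nat \<times> nat \<Rightarrow> real" where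
  "neighbor_volume S I x p = (\<Sum>p'\<in>I - {p}. voronoi_volume S I x p p')"

definition mc_weight ::
    "'u model \<Rightarrow> ('w, 'u) trial \<Rightarrow> nat \<times> nat \<Rightarrow> 'w \<Rightarrow> real" where
  "mc_weight S E p w =
     (let x = (\<lambda>q. visit_time E q w); I = index_set E in
       (1 + neighbor_volume S I x p - neighbor_degree S I x p) / real (sample_size E))"

text \<open>The two pointwise requirements on the weights are imposed almost surely: repeated design
  points, where nearest neighbors degenerate, form a null event.\<close>

definition admissible_weights ::
    "'u model \<Rightarrow> ('w, 'u) trial \<Rightarrow> real \<Rightarrow>
       (nat \<times> nat \<Rightarrow> 'w \<Rightarrow> real) \<Rightarrow> bool" where
  "admissible_weights S E C0 \<omega> \<longleftrightarrow>
     (let P = basic_space E; I = index_set E in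
       (\<forall>p\<in>I. \<omega> p \<in> borel_measurable (generated_algebra P borel (visit_time E) I)) \<and>
       (AE w in P. (\<Sum>p\<in>I. \<omega> p w) = 1) \<and>
       (\<forall>\<psi>. integrable (design_law S) \<psi> \<longrightarrow>
          (\<Sum>p\<in>I. \<integral>w. \<omega> p w * \<psi> (visit_time E p w) \<partial>P) = (\<integral>t. \<psi> t \<partial>design_law S)) \<and>
       (AE w in P. (\<Sum>p\<in>I. (\<omega> p w)\<^sup>2) \<le> 1 + C0 / real (sample_size E)))"

definition second_moment_bound ::
    "'u model \<Rightarrow> ('w, 'u) trial \<Rightarrow> real \<Rightarrow> bool" where
  "second_moment_bound S E \<kappa> \<longleftrightarrow>
     (\<forall>h. integrable (design_law S) h \<and> (\<forall>t. 0 \<le> h t) \<longrightarrow>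
        (\<integral>w. (\<Sum>p\<in>index_set E. (mc_weight S E p w)\<^sup>2 * h (visit_time E p w)) \<partial>basic_space E)
          \<le> \<kappa> / real (sample_size E) * (LINT t:time_dom S|lborel. h t * dens S t))"


section \<open>The estimator and its risk\<close>

text \<open>Basis functions are numbered from 1; the value at index 0 is irrelevant.\<close>

definition orthonormal_basis ::
    "'u model \<Rightarrow> (nat \<Rightarrow> real \<Rightarrow> real) \<Rightarrow> bool" where
  "orthonormal_basis S \<phi> \<longleftrightarrow>
     (\<forall>k\<ge>1. \<phi> k \<in> borel_measurable (time_measure S) \<and>
            integrable (time_measure S) (\<lambda>t. (\<phi> k t)\<^sup>2)) \<and>
     (\<forall>j\<ge>1. \<forall>k\<ge>1. (\<integral>t. \<phi> j t * \<phi> k t \<partial>time_measure S) = (if j = k then 1 else 0)) \<and>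
     (\<forall>f\<in>borel_measurable (time_measure S). integrable (time_measure S) (\<lambda>t. (f t)\<^sup>2) \<longrightarrow>
        (\<lambda>K. \<integral>t. (f t - (\<Sum>k=1..K. (\<integral>r. f r * \<phi> k r \<partial>time_measure S) * \<phi> k t))\<^sup>2
               \<partial>time_measure S) \<longlonglongrightarrow> 0)"

definition coef :: "'u model \<Rightarrow> (nat \<Rightarrow> real \<Rightarrow> real) \<Rightarrow> nat \<Rightarrow> 'u \<Rightarrow> real" where
  "coef S \<phi> k u = (\<integral>t. mean_fun S u t * \<phi> k t \<partial>time_measure S)"

definition coef_hat ::
    "'u model \<Rightarrow> ('w, 'u) trial \<Rightarrow> (nat \<Rightarrow> real \<Rightarrow> real) \<Rightarrow>
       nat \<Rightarrow> 'w \<Rightarrow> 'u \<Rightarrow> real" where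
  "coef_hat S E \<phi> k w u =
     (\<Sum>p\<in>index_set E. mc_weight S E p w * response S E p w u *
        \<phi> k (visit_time E p w) / dens S (visit_time E p w))"

text \<open>The truncation level is real, so that the estimator makes sense at the unrounded minimizer:
  the sum extends over the integers \<open>k\<close> with \<open>1 \<le> k \<le> K\<close>.\<close>

definition mean_hat ::
    "'u model \<Rightarrow> ('w, 'u) trial \<Rightarrow> (nat \<Rightarrow> real \<Rightarrow> real) \<Rightarrow>
       real \<Rightarrow> 'w \<Rightarrow> 'u \<Rightarrow> real \<Rightarrow> real" where
  "mean_hat S E \<phi> K w u t = (\<Sum>k | 1 \<le> k \<and> real k \<le> K. coef_hat S E \<phi> k w u * \<phi> k t)"

definition risk ::
    "'u model \<Rightarrow> ('w, 'u) trial \<Rightarrow> (nat \<Rightarrow> real \<Rightarrow> real) \<Rightarrow>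
       real \<Rightarrow> ennreal" where
  "risk S E \<phi> K =
     (\<integral>\<^sup>+w. (\<integral>\<^sup>+(u, t). ennreal ((mean_hat S E \<phi> K w u t - mean_fun S u t)\<^sup>2)
        \<partial>state_time_measure S) \<partial>basic_space E)"


section \<open>Smoothness and growth conditions\<close>

definition hoelder_mean ::
    "('u::{metric_space, second_countable_topology}) model \<Rightarrow> real \<Rightarrow> ('u \<Rightarrow> real) \<Rightarrow> bool"
  where
  "hoelder_mean S \<alpha> L \<longleftrightarrow>
     0 < \<alpha> \<and> \<alpha> \<le> 1 \<and> L \<in> borel_measurable (state_measure S) \<and> (\<forall>u. 0 \<le> L u) \<and>
     (\<integral>\<^sup>+u. ennreal ((L u)\<^sup>2) \<partial>state_measure S) < \<infinity> \<and>
     (\<forall>u. \<forall>t\<in>time_dom S. \<forall>t'\<in>time_dom S.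
        \<bar>mean_fun S u t - mean_fun S u t'\<bar> \<le> L u * \<bar>t - t'\<bar> powr \<alpha>)"

definition coef_decay ::
    "'u model \<Rightarrow> (nat \<Rightarrow> real \<Rightarrow> real) \<Rightarrow> real \<Rightarrow> real \<Rightarrow> bool" where
  "coef_decay S \<phi> s Cs \<longleftrightarrow>
     0 < s \<and> 0 < Cs \<and>
     (\<Sum>k. ennreal (real (Suc k) powr (2 * s)) *
            (\<integral>\<^sup>+u. ennreal ((coef S \<phi> (Suc k) u)\<^sup>2) \<partial>state_measure S)) \<le> ennreal Cs"

text \<open>The functions \<open>c\<close> below express the dependence of the constants in the variance bound on
  \<open>\<alpha>\<close>, the Lipschitz constant of the density, the Hoelder constant at \<open>u\<close>, the extreme values of
  the density, and the sup norm of the mean at \<open>u\<close>, and on nothing else; in particular these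
  constants are the same for all trials.\<close>

definition var_const1 ::
    "(real \<Rightarrow> real \<Rightarrow> real \<Rightarrow> real \<Rightarrow> real \<Rightarrow> real \<Rightarrow> real) \<Rightarrow> 'u model \<Rightarrow> real \<Rightarrow>
       ('u \<Rightarrow> real) \<Rightarrow> 'u \<Rightarrow> real" where
  "var_const1 c S \<alpha> L u =
     c \<alpha> (lip_const (time_dom S) (dens S)) (L u) (dens_min S) (dens_max S)
       (sup_norm (time_dom S) (mean_fun S u))"

definition var_const2 ::
    "(real \<Rightarrow> real \<Rightarrow> real \<Rightarrow> real \<Rightarrow> real \<Rightarrow> real \<Rightarrow> real) \<Rightarrow> 'u model \<Rightarrow> real \<Rightarrow>
       ('u \<Rightarrow> real) \<Rightarrow> (nat \<Rightarrow> real \<Rightarrow> real) \<Rightarrow> 'u \<Rightarrow> nat \<Rightarrow> real" where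
  "var_const2 c S \<alpha> L \<phi> u k =
     sup_norm (time_dom S) (\<phi> k) * lip_const (time_dom S) (\<phi> k) *
     c \<alpha> (lip_const (time_dom S) (dens S)) (L u) (dens_min S) (dens_max S)
       (sup_norm (time_dom S) (mean_fun S u))"

definition noiseless_coef ::
    "'u model \<Rightarrow> ('w, 'u) trial \<Rightarrow> (nat \<Rightarrow> real \<Rightarrow> real) \<Rightarrow>
       nat \<Rightarrow> 'u \<Rightarrow> 'w \<Rightarrow> real" where
  "noiseless_coef S E \<phi> k u w =
     (\<Sum>p\<in>index_set E. mc_weight S E p w * mean_fun S u (visit_time E p w) *
        \<phi> k (visit_time E p w) / dens S (visit_time E p w))"

definition variance_bound ::
    "'u model \<Rightarrow> ('w, 'u) trial \<Rightarrow> (nat \<Rightarrow> real \<Rightarrow> real) \<Rightarrow>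
       real \<Rightarrow> ('u \<Rightarrow> real) \<Rightarrow> ('u \<Rightarrow> nat \<Rightarrow> real) \<Rightarrow> bool" where
  "variance_bound S E \<phi> \<alpha> C1 C2 \<longleftrightarrow>
     (\<forall>u. \<forall>k\<ge>1. prob_space.variance (basic_space E) (noiseless_coef S E \<phi> k u) \<le>
        (C1 u)\<^sup>2 * real (sample_size E) powr (- 1 - 2 * \<alpha>) +
        (C2 u k)\<^sup>2 * real (sample_size E) powr (- 3))"

definition polynomial_growth ::
    "('u::{metric_space, second_countable_topology}) model \<Rightarrow> ('u \<Rightarrow> real) \<Rightarrow>
       ('u \<Rightarrow> nat \<Rightarrow> real) \<Rightarrow> real \<Rightarrow> real \<Rightarrow> bool" where
  "polynomial_growth S C1 C2 q Cbar \<longleftrightarrow>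
     0 \<le> q \<and> 0 < Cbar \<and>
     C1 \<in> borel_measurable (state_measure S) \<and>
     (\<integral>\<^sup>+u. ennreal ((C1 u)\<^sup>2) \<partial>state_measure S) \<le> ennreal Cbar \<and>
     (\<forall>k\<ge>1. (\<lambda>u. C2 u k) \<in> borel_measurable (state_measure S) \<and>
        (\<integral>\<^sup>+u. ennreal ((C2 u k)\<^sup>2) \<partial>state_measure S) \<le> ennreal (Cbar * real k powr (2 * q)))"


section \<open>Constants of the risk bound\<close>

definition C1_MC :: "'u model \<Rightarrow> real \<Rightarrow> nat \<Rightarrow> real" where
  "C1_MC S \<kappa> m_max =
     \<kappa> * (sup_norm (time_dom S \<times> time_dom S) (\<lambda>(t, t'). Gamma_X S t t') * real m_max +
           (sup_norm (time_dom S) (noise_scale S))\<^sup>2 * measure (state_measure S) (space (state_measure S)))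
       / dens_min S"

text \<open>If \<open>C1 = 0\<close> (no field and no noise), \<open>C_total\<close> tends to 0 at rate \<open>M powr (- 2 * \<alpha>)\<close>, which
  changes the order in \<open>M\<close> of expressions containing its negative powers; asymptotic
  equivalences in \<open>M\<close> therefore require \<open>C1 > 0\<close>.\<close>

definition C_total :: "real \<Rightarrow> real \<Rightarrow> real \<Rightarrow> nat \<Rightarrow> real" where
  "C_total C1 Cbar \<alpha> M = C1 + Cbar * real M powr (- 2 * \<alpha>)"

definition K_star :: "real \<Rightarrow> real \<Rightarrow> real \<Rightarrow> nat \<Rightarrow> real" where
  "K_star s Cs CM M = (2 * s * Cs * real M / CM) powr (1 / (2 * s + 1))"

end

theory Submission
  imports Defs
begin

text \<open>
  By Parseval's identity in time, the risk at level \<open>K\<close> is the sum over \<open>k \<le> K\<close> of the mean squared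
  errors of the estimated coefficients plus the energy of the omitted coefficients.
  The error of the \<open>k\<close>-th coefficient splits into the fluctuation of the noiseless quadrature rule,
  one term for each subject's random field and one for each noise field.  Since the weights are
  functions of the design, these terms are pairwise orthogonal: for any two of them, one is centered
  under the law of its own field and independent of the sigma-algebra that makes the other
      measurable.
  The first term is controlled by the variance bound, the others by the second moment bound on the
  weights applied to \<open>h = (\<phi>\<^sub>k / g)\<^sup>2\<close>, whose integral against \<open>g\<close> is at most \<open>1 / g\<^sub>m\<^sub>i\<^sub>n\<close>.

  For the optimization, write \<open>K = K\<^sub>0 r\<close> with \<open>K\<^sub>0\<close> the claimed minimizer; the bound becomes a
      multiple
  of \<open>r\<^bsup>-2s\<^esup> / (2s) + r\<close>, which is minimal at \<open>r = 1\<close> because \<open>exp x \<ge> 1 + x\<close> and \<open>ln r \<le> r - 1\<close>.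
\<close>

section \<open>Independent draws\<close>

text \<open>The obstacle is that paths are evaluated at random times.
  \<open>independent_draw P H N V\<close> says that \<open>V\<close> has law \<open>N\<close> and is
  independent of the events of \<open>H\<close>. The law of the pair \<open>(w, V w)\<close> on
  \<open>H\<close> times \<open>N\<close> is then a product, so Tonelli's theorem freezes whatever
  \<open>H\<close> determines while the path is averaged under \<open>N\<close>; this takes the
  place of conditional expectations. For a cross term of two draws, one is adjoined to the design
  and the other is drawn afresh.

  At a fixed state the field terms may have infinite second moment, since only their integral over
  states is controlled. Hence the estimates use extended nonnegative integrals, and orthogonality
  enters as an inequality that is trivial when a term is infinite.

  In \<open>C1_MC\<close>, the factor \<open>m_max\<close> comes from Cauchy-Schwarz inside one
  subject, whose visits share a path and are not orthogonal; the mass of the state space comes from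
  a noise bound that is uniform in the state; and \<open>1 / dens_min S\<close> comes from the one
  power of the density that is left in the denominator.\<close>

definition independent_draw :: "'w measure \<Rightarrow> 'w measure \<Rightarrow> 'b measure \<Rightarrow> ('w \<Rightarrow> 'b) \<Rightarrow> bool" where
  "independent_draw P H N V \<longleftrightarrow>
     prob_space P \<and> prob_space N \<and> subalgebra P H \<and> V \<in> measurable P N \<and>
     (\<forall>A\<in>sets H. \<forall>B\<in>sets N.
        measure P (A \<inter> (V -` B \<inter> space P)) = measure P A * measure N B)"

lemma independent_drawD:
  assumes "independent_draw P H N V"
  shows "prob_space P" "prob_space N" "subalgebra P H" "V \<in> measurable P N"
  using assms by (auto simp: independent_draw_def)

text \<open>A rectangle pulls back along \<open>(w, V w)\<close> to an intersection whose
  probability factors by definition, and rectangles determine a product of sigma-finite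
  measures.\<close>

lemma distr_independent_draw:
  assumes "independent_draw P H N V"
  shows "distr P (H \<Otimes>\<^sub>M N) (\<lambda>w. (w, V w)) = restr_to_subalg P H \<Otimes>\<^sub>M N"
proof -
  interpret P: prob_space P using assms by (rule independent_drawD)
  interpret N: prob_space N using assms by (rule independent_drawD)
  have H: "subalgebra P H" and V[measurable]: "V \<in> measurable P N"
    using assms by (auto dest: independent_drawD)
  interpret R: prob_space "restr_to_subalg P H"
    by (rule prob_space_restr_to_subalg[OF H P.prob_space_axioms])
  have idm[measurable]: "(\<lambda>w. w) \<in> measurable P H"
    using H by (auto simp: subalgebra_def measurable_def)
  show ?thesis
  proof (rule pair_measure_eqI[symmetric])
    show "sigma_finite_measure (restr_to_subalg P H)" "sigma_finite_measure N"
      by unfold_locales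
    show "sets (restr_to_subalg P H \<Otimes>\<^sub>M N) = sets (distr P (H \<Otimes>\<^sub>M N) (\<lambda>w. (w, V w)))"
      using sets_pair_measure_cong[OF sets_restr_to_subalg[OF H] refl, of N] by simp
    fix A B assume A: "A \<in> sets (restr_to_subalg P H)" and B: "B \<in> sets N"
    then have A': "A \<in> sets H" "A \<in> sets P" using H
        by (auto simp: sets_restr_to_subalg subalgebra_def)
    have eq: "(\<lambda>w. (w, V w)) -` (A \<times> B) \<inter> space P = A \<inter> (V -` B \<inter> space P)" by auto
    have "emeasure (distr P (H \<Otimes>\<^sub>M N) (\<lambda>w. (w, V w))) (A \<times> B) = emeasure P (A \<inter> (V -` B \<inter> space P))"
      using A' B by (subst emeasure_distr) (auto simp: eq)
    also have "\<dots> = emeasure P A * emeasure N B"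
      using assms A' B unfolding independent_draw_def
      by (simp add: P.emeasure_eq_measure N.emeasure_eq_measure ennreal_mult'')
    finally show "emeasure (restr_to_subalg P H) A * emeasure N B =
        emeasure (distr P (H \<Otimes>\<^sub>M N) (\<lambda>w. (w, V w))) (A \<times> B)"
      using A' by (simp add: emeasure_restr_to_subalg[OF H])
  qed
qed

lemma measurable_graph_independent_draw:
  assumes "independent_draw P H N V"
  shows "(\<lambda>w. (w, V w)) \<in> measurable P (H \<Otimes>\<^sub>M N)"
proof -
  have [measurable]: "(\<lambda>w. w) \<in> measurable P H" "V \<in> measurable P N"
    using independent_drawD[OF assms] by (auto simp: subalgebra_def measurable_def)
  show ?thesis by measurable
qed

text \<open>The freezing rule: Tonelli's theorem on the product law. The inner integral is
  measurable for \<open>H\<close>, so the outer one may be taken under \<open>P\<close>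
  again.\<close>

lemma nn_integral_independent_draw:
  assumes ind: "independent_draw P H N V"
    and f[measurable]: "f \<in> borel_measurable (H \<Otimes>\<^sub>M N)"
  shows "(\<integral>\<^sup>+w. f (w, V w) \<partial>P) = (\<integral>\<^sup>+w. (\<integral>\<^sup>+v. f (w, v) \<partial>N) \<partial>P)"
proof -
  interpret P: prob_space P using ind by (rule independent_drawD)
  interpret N: prob_space N using ind by (rule independent_drawD)
  have H: "subalgebra P H" using ind by (rule independent_drawD)
  note [measurable_cong] = sets_restr_to_subalg[OF H]
  have "(\<integral>\<^sup>+w. f (w, V w) \<partial>P) = (\<integral>\<^sup>+z. f z \<partial>distr P (H \<Otimes>\<^sub>M N) (\<lambda>w. (w, V w)))"
    using measurable_graph_independent_draw[OF ind] by (subst nn_integral_distr) auto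
  also have "\<dots> = (\<integral>\<^sup>+w. (\<integral>\<^sup>+v. f (w, v) \<partial>N) \<partial>restr_to_subalg P H)"
    unfolding distr_independent_draw[OF ind] by (subst N.nn_integral_fst) auto
  also have "\<dots> = (\<integral>\<^sup>+w. (\<integral>\<^sup>+v. f (w, v) \<partial>N) \<partial>P)"
    by (rule nn_integral_subalgebra2[OF H]) measurable
  finally show ?thesis .
qed

text \<open>The source of all orthogonality relations: \<open>g\<close> is frozen, and the fresh
  draw averages to zero. Integrability of the product along the graph is integrability on the
  product space, so Fubini's theorem applies without separate moment conditions on \<open>g\<close>
  and \<open>h\<close>.\<close>

lemma integral_independent_draw_centered:
  fixes g :: "'w \<Rightarrow> real" and h :: "'w \<Rightarrow> 'b \<Rightarrow> real"
  assumes ind: "independent_draw P H N V"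
    and h[measurable]: "(\<lambda>(w, v). h w v) \<in> borel_measurable (H \<Otimes>\<^sub>M N)"
    and g[measurable]: "g \<in> borel_measurable H"
    and centered: "\<And>w. w \<in> space P \<Longrightarrow> (\<integral>v. h w v \<partial>N) = 0"
    and int: "integrable P (\<lambda>w. g w * h w (V w))"
  shows "(\<integral>w. g w * h w (V w) \<partial>P) = 0"
proof -
  interpret P: prob_space P using ind by (rule independent_drawD)
  interpret N: prob_space N using ind by (rule independent_drawD)
  have H: "subalgebra P H" using ind by (rule independent_drawD)
  interpret R: prob_space "restr_to_subalg P H"
    by (rule prob_space_restr_to_subalg[OF H P.prob_space_axioms])
  interpret RN: pair_sigma_finite "restr_to_subalg P H" N ..
  note [measurable_cong] = sets_restr_to_subalg[OF H]
  let ?k = "\<lambda>(w, v). g w * h w v"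
  have km: "?k \<in> borel_measurable (H \<Otimes>\<^sub>M N)" by measurable
  note graph = measurable_graph_independent_draw[OF ind]
  have ik: "integrable (restr_to_subalg P H \<Otimes>\<^sub>M N) ?k"
    unfolding distr_independent_draw[OF ind, symmetric]
    using int by (subst integrable_distr_eq[OF graph km]) simp
  have "(\<integral>w. g w * h w (V w) \<partial>P) = (\<integral>z. ?k z \<partial>distr P (H \<Otimes>\<^sub>M N) (\<lambda>w. (w, V w)))"
    by (subst integral_distr[OF graph km]) simp
  also have "\<dots> = (\<integral>w. (\<integral>v. g w * h w v \<partial>N) \<partial>restr_to_subalg P H)"
    unfolding distr_independent_draw[OF ind] using RN.integral_fst'[OF ik] by simp
  also have "\<dots> = (\<integral>w. 0 \<partial>restr_to_subalg P H)"
    by (rule Bochner_Integration.integral_cong) (auto simp: space_restr_to_subalg centered)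
  finally show ?thesis by simp
qed

text \<open>The sigma-algebra of \<open>G\<close> and \<open>V\<close> together. Intersections are
  taken as generators because they form a pi-system, on which independence has to be
  checked.\<close>

definition adjoin :: "'w measure \<Rightarrow> 'b measure \<Rightarrow> ('w \<Rightarrow> 'b) \<Rightarrow> 'w measure" where
  "adjoin G N V = sigma (space G) {A \<inter> (V -` C \<inter> space G) |A C. A \<in> sets G \<and> C \<in> sets N}"

lemma adjoin_generators: "{A \<inter> (V -` C \<inter> space G) |A C. A \<in> sets G \<and> C \<in> sets N} \<subseteq> Pow (space G)"
  by (auto dest: sets.sets_into_space)

lemma space_adjoin[simp]: "space (adjoin G N V) = space G"
  unfolding adjoin_def by (rule space_measure_of[OF adjoin_generators])

lemma sets_adjoin:
  "sets (adjoin G N V) =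
     sigma_sets (space G) {A \<inter> (V -` C \<inter> space G) |A C. A \<in> sets G \<and> C \<in> sets N}"
  unfolding adjoin_def by (rule sets_measure_of[OF adjoin_generators])

lemma subalgebra_adjoin_left:
  assumes "V \<in> space G \<rightarrow> space N"
  shows "subalgebra (adjoin G N V) G"
proof -
  have "A \<in> sets (adjoin G N V)" if A: "A \<in> sets G" for A
  proof -
    have "A = A \<inter> (V -` space N \<inter> space G)"
      using assms sets.sets_into_space[OF A] by auto
    with A show ?thesis unfolding sets_adjoin by (blast intro: sigma_sets.Basic)
  qed
  then show ?thesis by (auto simp: subalgebra_def)
qed

lemma measurable_adjoin_right:
  assumes "V \<in> space G \<rightarrow> space N"
  shows "V \<in> measurable (adjoin G N V) N"
proof (rule measurableI)
  fix C assume C: "C \<in> sets N"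
  have "V -` C \<inter> space G = space G \<inter> (V -` C \<inter> space G)" by auto
  with C show "V -` C \<inter> space (adjoin G N V) \<in> sets (adjoin G N V)"
    unfolding sets_adjoin space_adjoin by (blast intro: sigma_sets.Basic)
qed (use assms in auto)

text \<open>Independence on two pi-systems, the generators of \<open>adjoin\<close> and the
  preimages under \<open>V\<close>, extends to the sigma-algebras that they generate.\<close>

lemma independent_draw_adjoin:
  assumes G: "subalgebra P G" and P: "prob_space P" and N: "prob_space N"
    and V: "V \<in> measurable P N" and V': "V' \<in> measurable P N'"
    and prod: "\<And>A B C. A \<in> sets G \<Longrightarrow> B \<in> sets N \<Longrightarrow> C \<in> sets N' \<Longrightarrow>
      measure P (A \<inter> (V' -` C \<inter> space P) \<inter> (V -` B \<inter> space P)) =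
      measure P (A \<inter> (V' -` C \<inter> space P)) * measure N B"
  shows "independent_draw P (adjoin G N' V') N V"
proof -
  interpret P: prob_space P by fact
  let ?E = "{A \<inter> (V' -` C \<inter> space G) |A C. A \<in> sets G \<and> C \<in> sets N'}"
  let ?F = "{V -` B \<inter> space P |B. B \<in> sets N}"
  have sp: "space G = space P" using G by (simp add: subalgebra_def)
  \<comment> \<open>Taking the whole space for both other events in \<open>prod\<close> shows that
    \<open>V\<close> has law \<open>N\<close>.\<close>
  have VB: "measure P (V -` B \<inter> space P) = measure N B" if "B \<in> sets N" for B
  proof -
    have "space P \<inter> (V' -` space N' \<inter> space P) = space P"
      using measurable_space[OF V'] by auto
    with prod[of "space G" B "space N'"] sets.top[of G] that sp show ?thesis
      by (simp add: P.prob_space Int_absorb1)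
  qed
  have E: "?E \<subseteq> sets P"
    using G measurable_sets[OF V'] by (auto simp: subalgebra_def)
  have F: "?F \<subseteq> sets P" using measurable_sets[OF V] by auto
  have "P.indep_set ?E ?F"
    using prod VB E F by (intro P.indep_setI) (auto simp: sp)
  moreover have "Int_stable ?E"
  proof (rule Int_stableI)
    fix a b assume "a \<in> ?E" "b \<in> ?E"
    then obtain A C A2 C2 where ab: "a = A \<inter> (V' -` C \<inter> space G)" "b = A2 \<inter> (V' -` C2 \<inter> space G)"
      and AC: "A \<in> sets G" "C \<in> sets N'" "A2 \<in> sets G" "C2 \<in> sets N'" by blast
    have "a \<inter> b = (A \<inter> A2) \<inter> (V' -` (C \<inter> C2) \<inter> space G)" unfolding ab by auto
    then show "a \<inter> b \<in> ?E" using AC by blast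
  qed
  moreover have "Int_stable ?F"
  proof (rule Int_stableI)
    fix a b assume "a \<in> ?F" "b \<in> ?F"
    then obtain B B2 where ab: "a = V -` B \<inter> space P" "b = V -` B2 \<inter> space P"
      and AC: "B \<in> sets N" "B2 \<in> sets N" by blast
    have "a \<inter> b = V -` (B \<inter> B2) \<inter> space P" unfolding ab by auto
    then show "a \<inter> b \<in> ?F" using AC by blast
  qed
  ultimately have ind: "P.indep_set (sigma_sets (space P) ?E) (sigma_sets (space P) ?F)"
    by (rule P.indep_set_sigma_sets)
  have "measure P (A \<inter> (V -` B \<inter> space P)) = measure P A * measure N B"
    if "A \<in> sets (adjoin G N' V')" "B \<in> sets N" for A B
  proof -
    have "V -` B \<inter> space P \<in> sigma_sets (space P) ?F"
      using that by (blast intro: sigma_sets.Basic)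
    moreover have "A \<in> sigma_sets (space P) ?E" using that by (simp add: sets_adjoin sp)
    ultimately show ?thesis using P.indep_setD[OF ind] VB that by simp
  qed
  moreover have "subalgebra P (adjoin G N' V')"
    using sets.sigma_sets_subset[OF E] by (simp add: subalgebra_def sets_adjoin sp)
  ultimately show ?thesis using P N V by (simp add: independent_draw_def)
qed

section \<open>Square-integrable expansions\<close>

lemma integrable_mult_square_integrable:
  fixes f g :: "'a \<Rightarrow> real"
  assumes [measurable]: "f \<in> borel_measurable M" "g \<in> borel_measurable M"
    and "integrable M (\<lambda>x. (f x)\<^sup>2)" "integrable M (\<lambda>x. (g x)\<^sup>2)"
  shows "integrable M (\<lambda>x. f x * g x)"
proof (rule Bochner_Integration.integrable_bound)
  show "integrable M (\<lambda>x. (f x)\<^sup>2 + (g x)\<^sup>2)" using assms by simp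
  have "\<bar>f x * g x\<bar> \<le> (f x)\<^sup>2 + (g x)\<^sup>2" for x
    using sum_squares_bound[of "\<bar>f x\<bar>" "\<bar>g x\<bar>"] zero_le_power2[of "f x"] zero_le_power2[of "g x"]
    unfolding abs_mult power2_abs by linarith
  then show "AE x in M. norm (f x * g x) \<le> norm ((f x)\<^sup>2 + (g x)\<^sup>2)" by simp
qed measurable

lemma integral_square_sum:
  fixes f :: "'j \<Rightarrow> 'a \<Rightarrow> real"
  assumes f[measurable]: "\<And>j. j \<in> J \<Longrightarrow> f j \<in> borel_measurable M"
    and sq: "\<And>j. j \<in> J \<Longrightarrow> integrable M (\<lambda>x. (f j x)\<^sup>2)"
  shows "integrable M (\<lambda>x. (\<Sum>j\<in>J. f j x)\<^sup>2)"
    and "(\<integral>x. (\<Sum>j\<in>J. f j x)\<^sup>2 \<partial>M) = (\<Sum>i\<in>J. \<Sum>j\<in>J. \<integral>x. f i x * f j x \<partial>M)"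
proof -
  have eq: "(\<Sum>j\<in>J. f j x)\<^sup>2 = (\<Sum>i\<in>J. \<Sum>j\<in>J. f i x * f j x)" for x
    by (simp add: power2_eq_square sum_product)
  have int: "integrable M (\<lambda>x. f i x * f j x)" if "i \<in> J" "j \<in> J" for i j
    using that by (intro integrable_mult_square_integrable f sq)
  show "integrable M (\<lambda>x. (\<Sum>j\<in>J. f j x)\<^sup>2)"
    unfolding eq by (intro Bochner_Integration.integrable_sum int)
  show "(\<integral>x. (\<Sum>j\<in>J. f j x)\<^sup>2 \<partial>M) = (\<Sum>i\<in>J. \<Sum>j\<in>J. \<integral>x. f i x * f j x \<partial>M)"
    unfolding eq using int by (simp add: Bochner_Integration.integral_sum
        Bochner_Integration.integrable_sum)
qed

text \<open>If some term has infinite second moment, the right side is infinite. Otherwise all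
  products are integrable and the cross terms vanish. Orthogonality is therefore asked only of
  square-integrable pairs, where the Bochner integral of the product is meaningful.\<close>

lemma nn_integral_square_sum_orthogonal:
  fixes f :: "'j \<Rightarrow> 'a \<Rightarrow> real"
  assumes J: "finite J" and f[measurable]: "\<And>j. j \<in> J \<Longrightarrow> f j \<in> borel_measurable M"
    and orth: "\<And>i j. i \<in> J \<Longrightarrow> j \<in> J \<Longrightarrow> i \<noteq> j \<Longrightarrow>
      integrable M (\<lambda>x. (f i x)\<^sup>2) \<Longrightarrow> integrable M (\<lambda>x. (f j x)\<^sup>2) \<Longrightarrow> (\<integral>x. f i x * f j x \<partial>M) = 0"
  shows "(\<integral>\<^sup>+x. ennreal ((\<Sum>j\<in>J. f j x)\<^sup>2) \<partial>M) \<le> (\<Sum>j\<in>J. \<integral>\<^sup>+x. ennreal ((f j x)\<^sup>2) \<partial>M)"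
proof (cases "\<forall>j\<in>J. (\<integral>\<^sup>+x. ennreal ((f j x)\<^sup>2) \<partial>M) < \<infinity>")
  case True
  then have sq: "integrable M (\<lambda>x. (f j x)\<^sup>2)" if "j \<in> J" for j
    using that by (intro integrableI_nonneg) auto
  have "(\<integral>\<^sup>+x. ennreal ((\<Sum>j\<in>J. f j x)\<^sup>2) \<partial>M) = ennreal (\<integral>x. (\<Sum>j\<in>J. f j x)\<^sup>2 \<partial>M)"
    by (intro nn_integral_eq_integral integral_square_sum f sq) auto
  also have "(\<integral>x. (\<Sum>j\<in>J. f j x)\<^sup>2 \<partial>M) = (\<Sum>i\<in>J. \<Sum>j\<in>J. \<integral>x. f i x * f j x \<partial>M)"
    by (rule integral_square_sum(2)[OF f sq])
  also have "\<dots> = (\<Sum>i\<in>J. \<Sum>j\<in>J. if i = j then \<integral>x. (f j x)\<^sup>2 \<partial>M else 0)"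
  proof (intro sum.cong refl)
    fix i j assume "i \<in> J" "j \<in> J"
    then show "(\<integral>x. f i x * f j x \<partial>M) = (if i = j then \<integral>x. (f j x)\<^sup>2 \<partial>M else 0)"
      using orth[OF _ _ _ sq sq, of i j] by (simp add: power2_eq_square)
  qed
  also have "\<dots> = (\<Sum>j\<in>J. \<integral>x. (f j x)\<^sup>2 \<partial>M)" using J by simp
  also have "ennreal \<dots> = (\<Sum>j\<in>J. ennreal (\<integral>x. (f j x)\<^sup>2 \<partial>M))" by (simp add: sum_ennreal)
  also have "\<dots> = (\<Sum>j\<in>J. \<integral>\<^sup>+x. ennreal ((f j x)\<^sup>2) \<partial>M)"
    by (intro sum.cong refl nn_integral_eq_integral[symmetric] sq) auto
  finally show ?thesis by simp
next
  case False
  then obtain j where "j \<in> J" "(\<integral>\<^sup>+x. ennreal ((f j x)\<^sup>2) \<partial>M) = \<infinity>"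
      by (auto simp: less_top[symmetric])
  then have "(\<Sum>j\<in>J. \<integral>\<^sup>+x. ennreal ((f j x)\<^sup>2) \<partial>M) = \<infinity>" 
    using J member_le_sum[of j J "\<lambda>j. \<integral>\<^sup>+x. ennreal ((f j x)\<^sup>2) \<partial>M"] by (simp add: top_unique)
  then show ?thesis by simp
qed

text \<open>Expanding the square leaves the coefficient errors plus the squared norm of
  \<open>f\<close> minus its first \<open>N\<close> squared coefficients; completeness identifies
  the latter with the tail series.\<close>

lemma Parseval_truncation:
  fixes f :: "real \<Rightarrow> real" and c :: "nat \<Rightarrow> real"
  assumes onb: "orthonormal_basis S \<phi>"
    and f[measurable]: "f \<in> borel_measurable (time_measure S)"
    and sq: "integrable (time_measure S) (\<lambda>t. (f t)\<^sup>2)"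
  defines "b \<equiv> \<lambda>k. \<integral>t. f t * \<phi> k t \<partial>time_measure S"
  shows "(\<integral>\<^sup>+t. ennreal (((\<Sum>k=1..N. c k * \<phi> k t) - f t)\<^sup>2) \<partial>time_measure S) =
    ennreal (\<Sum>k=1..N. (c k - b k)\<^sup>2) + (\<Sum>j. ennreal ((b (Suc (N + j)))\<^sup>2))"
proof -
  let ?M = "time_measure S"
  have \<phi>[measurable]: "\<phi> k \<in> borel_measurable ?M" and \<phi>2: "integrable ?M (\<lambda>t. (\<phi> k t)\<^sup>2)" if "1 \<le>
      k" for k
    using onb that by (auto simp: orthonormal_basis_def)
  have orth: "(\<integral>t. \<phi> j t * \<phi> k t \<partial>?M) = (if j = k then 1 else 0)" if "1 \<le> j" "1 \<le> k" for j k
    using onb that by (auto simp: orthonormal_basis_def)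
  have fint: "integrable ?M (\<lambda>t. f t * \<phi> k t)" if "1 \<le> k" for k
    using that by (intro integrable_mult_square_integrable f \<phi> sq \<phi>2)
  \<comment> \<open>\<open>N\<close> and \<open>c\<close> are generalized here: the identity is
    needed with \<open>c = b\<close> at every level, and then with the given coefficients.\<close>
  have expand: "integrable ?M (\<lambda>t. ((\<Sum>k=1..N. c k * \<phi> k t) - f t)\<^sup>2)"
    "(\<integral>t. ((\<Sum>k=1..N. c k * \<phi> k t) - f t)\<^sup>2 \<partial>?M) =
       (\<Sum>k=1..N. (c k - b k)\<^sup>2) + ((\<integral>t. (f t)\<^sup>2 \<partial>?M) - (\<Sum>k=1..N. (b k)\<^sup>2))"
    for N and c :: "nat \<Rightarrow> real"
  proof -
    have c2: "integrable ?M (\<lambda>t. (c k * \<phi> k t)\<^sup>2)" if "1 \<le> k" for k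
      using \<phi>2[OF that] by (simp add: power_mult_distrib)
    have cm: "(\<lambda>t. c k * \<phi> k t) \<in> borel_measurable ?M" if "k \<in> {1..N}" for k using that by simp
    note g = integral_square_sum[of "{1..N}" "\<lambda>k t. c k * \<phi> k t", OF cm c2]
    have g1: "integrable ?M (\<lambda>t. (\<Sum>k=1..N. c k * \<phi> k t)\<^sup>2)" using g(1) by auto
    have "(\<integral>t. (\<Sum>k=1..N. c k * \<phi> k t)\<^sup>2 \<partial>?M) =
      (\<Sum>i=1..N. \<Sum>j=1..N. \<integral>t. c i * \<phi> i t * (c j * \<phi> j t) \<partial>?M)" using g(2) by auto
    also have "\<dots> = (\<Sum>i=1..N. \<Sum>j=1..N. if i = j then (c j)\<^sup>2 else 0)"
    proof (intro sum.cong refl)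
      fix i j assume "i \<in> {1..N}" "j \<in> {1..N}"
      then have "(\<integral>t. c i * c j * (\<phi> i t * \<phi> j t) \<partial>?M) = (if i = j then (c j)\<^sup>2 else 0)"
        by (simp add: orth power2_eq_square)
      then show "(\<integral>t. c i * \<phi> i t * (c j * \<phi> j t) \<partial>?M) = (if i = j then (c j)\<^sup>2 else 0)"
        by (simp add: mult_ac)
    qed
    also have "\<dots> = (\<Sum>j=1..N. (c j)\<^sup>2)" by simp
    finally have g2: "(\<integral>t. (\<Sum>k=1..N. c k * \<phi> k t)\<^sup>2 \<partial>?M) = (\<Sum>j=1..N. (c j)\<^sup>2)" .
    have fgi: "integrable ?M (\<lambda>t. \<Sum>k=1..N. c k * (f t * \<phi> k t))"
      by (intro Bochner_Integration.integrable_sum integrable_mult_right fint) auto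
    have fg: "(\<integral>t. (\<Sum>k=1..N. c k * (f t * \<phi> k t)) \<partial>?M) = (\<Sum>k=1..N. c k * b k)"
      unfolding b_def by (subst Bochner_Integration.integral_sum) (auto intro!:
          integrable_mult_right fint)
    have eq: "((\<Sum>k=1..N. c k * \<phi> k t) - f t)\<^sup>2 =
      (\<Sum>k=1..N. c k * \<phi> k t)\<^sup>2 - 2 * (\<Sum>k=1..N. c k * (f t * \<phi> k t)) + (f t)\<^sup>2" for t
      by (simp add: power2_diff sum_distrib_left mult_ac)
    show "integrable ?M (\<lambda>t. ((\<Sum>k=1..N. c k * \<phi> k t) - f t)\<^sup>2)"
      unfolding eq using g1 fgi sq by (intro Bochner_Integration.integrable_add
          Bochner_Integration.integrable_diff integrable_mult_right)
    have "(\<integral>t. ((\<Sum>k=1..N. c k * \<phi> k t) - f t)\<^sup>2 \<partial>?M) =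
      (\<Sum>j=1..N. (c j)\<^sup>2) - 2 * (\<Sum>k=1..N. c k * b k) + (\<integral>t. (f t)\<^sup>2 \<partial>?M)"
      unfolding eq using g1 fgi sq by (simp add: g2 fg del: One_nat_def)
    also have "\<dots> = (\<Sum>k=1..N. (c k - b k)\<^sup>2) + ((\<integral>t. (f t)\<^sup>2 \<partial>?M) - (\<Sum>k=1..N. (b k)\<^sup>2))"
      by (simp add: power2_diff sum.distrib sum_subtractf sum_distrib_left mult_ac)
    finally show "(\<integral>t. ((\<Sum>k=1..N. c k * \<phi> k t) - f t)\<^sup>2 \<partial>?M) =
      (\<Sum>k=1..N. (c k - b k)\<^sup>2) + ((\<integral>t. (f t)\<^sup>2 \<partial>?M) - (\<Sum>k=1..N. (b k)\<^sup>2))" .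
  qed
  \<comment> \<open>Completeness enters here; with \<open>c = b\<close> the residual is the squared
    norm minus a partial sum, so the squared coefficients sum to the squared norm.\<close>
  have "(\<lambda>K. \<integral>t. (f t - (\<Sum>k=1..K. b k * \<phi> k t))\<^sup>2 \<partial>?M) \<longlonglongrightarrow> 0"
    using onb f sq by (auto simp: orthonormal_basis_def b_def)
  then have "(\<lambda>K. (\<integral>t. (f t)\<^sup>2 \<partial>?M) - (\<Sum>k=1..K. (b k)\<^sup>2)) \<longlonglongrightarrow> 0"
    using expand(2)[of b] by (simp add: power2_commute)
  then have "(\<lambda>K. (\<integral>t. (f t)\<^sup>2 \<partial>?M) - ((\<integral>t. (f t)\<^sup>2 \<partial>?M) - (\<Sum>k=1..K. (b k)\<^sup>2))) \<longlonglongrightarrow> (\<integral>t. (f t)\<^sup>2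
      \<partial>?M) - 0"
    by (intro tendsto_diff tendsto_const)
  then have "(\<lambda>K. \<Sum>k<K. (b (Suc k))\<^sup>2) \<longlonglongrightarrow> (\<integral>t. (f t)\<^sup>2 \<partial>?M)"
    by (simp add: sum.atLeast1_atMost_eq)
  then have sums: "(\<lambda>k. (b (Suc k))\<^sup>2) sums (\<integral>t. (f t)\<^sup>2 \<partial>?M)" by (simp add: sums_def)
  have tail: "(\<lambda>j. (b (Suc (N + j)))\<^sup>2) sums ((\<integral>t. (f t)\<^sup>2 \<partial>?M) - (\<Sum>k=1..N. (b k)\<^sup>2))"
    using sums_iff_shift[of "\<lambda>k. (b (Suc k))\<^sup>2" N "(\<integral>t. (f t)\<^sup>2 \<partial>?M) - (\<Sum>k=1..N. (b k)\<^sup>2)"] sums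
    by (simp add: sum.atLeast1_atMost_eq add.commute)
  have "(\<Sum>j. ennreal ((b (Suc (N + j)))\<^sup>2)) = ennreal ((\<integral>t. (f t)\<^sup>2 \<partial>?M) - (\<Sum>k=1..N. (b k)\<^sup>2))"
    using tail by (intro suminf_ennreal_eq) auto
  moreover have "0 \<le> (\<integral>t. (f t)\<^sup>2 \<partial>?M) - (\<Sum>k=1..N. (b k)\<^sup>2)"
    using sums_le[OF _ sums_zero tail] by simp
  ultimately show ?thesis
    using expand[where N = N and c = c] by (simp add: nn_integral_eq_integral sum_nonneg)
qed

section \<open>The population model\<close>

text \<open>These hypotheses do not mention a trial, so a constant obtained in this locale can serve
  all trials at once.\<close>

locale smooth_model =
  fixes S :: "('u::{metric_space, second_countable_topology}) model"
    and \<phi> :: "nat \<Rightarrow> real \<Rightarrow> real" and \<alpha> :: real and L :: "'u \<Rightarrow> real"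
  assumes pop: "population S"
    and onb: "orthonormal_basis S \<phi>"
    and lip: "\<And>k. 1 \<le> k \<Longrightarrow> \<exists>L. L-lipschitz_on (time_dom S) (\<phi> k)"
    and hoelder: "hoelder_mean S \<alpha> L"
    and Gamma_cont: "continuous_on (time_dom S \<times> time_dom S) (\<lambda>(t, t'). Gamma_X S t t')"
begin

lemma compact_time_dom: "compact (time_dom S)" and time_dom_nonempty: "time_dom S \<noteq> {}"
  and time_dom_borel[measurable]: "time_dom S \<in> sets borel"
  using pop by (auto simp: time_dom_def population_def)

lemma space_time_measure[simp]: "space (time_measure S) = time_dom S"
  by (simp add: time_measure_def space_restrict_space)

lemma sets_time_measure: "sets (time_measure S) = sets (restrict_space borel (time_dom S))"
  unfolding time_measure_def by (rule sets_restrict_space_cong) simp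

lemma borel_measurable_time_measure:
  "continuous_on (time_dom S) f \<Longrightarrow> f \<in> borel_measurable (time_measure S)"
  using borel_measurable_continuous_on_restrict measurable_cong_sets[OF sets_time_measure refl]
      by blast

sublocale state: finite_measure "state_measure S"
  using pop by (simp add: population_def)

lemma sets_state_measure[measurable_cong]: "sets (state_measure S) = sets borel"
  using pop by (simp add: population_def)

lemma space_state_measure[simp]: "space (state_measure S) = UNIV"
  using sets_eq_imp_space_eq[OF sets_state_measure] by simp

sublocale time: finite_measure "time_measure S"
proof
  have "emeasure (time_measure S) (space (time_measure S)) = emeasure lborel (time_dom S)"
    using time_dom_borel unfolding space_time_measure
    by (simp add: time_measure_def emeasure_restrict_space)
  also have "\<dots> < \<infinity>" using pop by (simp add: time_dom_def population_def)
  finally show "emeasure (time_measure S) (space (time_measure S)) \<noteq> \<infinity>" by simp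
qed

sublocale field: prob_space "field_law S"
  using pop by (simp add: population_def)

sublocale noise: prob_space "noise_law S"
  using pop by (simp add: population_def)

section \<open>Evaluation maps, and regularity of the density, the basis and the mean\<close>

lemma mean_eval_measurable:
  assumes "b \<in> measurable K (state_measure S)" "c \<in> measurable K (time_measure S)"
  shows "(\<lambda>z. mean_fun S (b z) (c z)) \<in> borel_measurable K"
proof -
  have "(\<lambda>(u, t). mean_fun S u t) \<in> borel_measurable (state_measure S \<Otimes>\<^sub>M time_measure S)"
    using pop by (simp add: population_def state_time_measure_def)
  from measurable_compose[OF measurable_Pair[OF assms] this] show ?thesis by simp
qed

lemma field_eval_measurable:
  assumes "a \<in> measurable K (field_law S)" "b \<in> measurable K (state_measure S)"
    "c \<in> measurable K (time_measure S)"
  shows "(\<lambda>z. a z (b z) (c z)) \<in> borel_measurable K"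
proof -
  have "(\<lambda>(x, (u, t)). x u t) \<in>
      borel_measurable (field_law S \<Otimes>\<^sub>M (state_measure S \<Otimes>\<^sub>M time_measure S))"
    using pop by (simp add: population_def state_time_measure_def)
  from measurable_compose[OF measurable_Pair[OF assms(1) measurable_Pair[OF assms(2,3)]] this]
  show ?thesis by simp
qed

lemma noise_eval_measurable:
  assumes "a \<in> measurable K (noise_law S)" "b \<in> measurable K (state_measure S)"
  shows "(\<lambda>z. a z (b z)) \<in> borel_measurable K"
proof -
  have "(\<lambda>(e, u). e u) \<in> borel_measurable (noise_law S \<Otimes>\<^sub>M state_measure S)"
    using pop by (simp add: population_def)
  from measurable_compose[OF measurable_Pair[OF assms] this] show ?thesis by simp
qed

lemma scale_measurable[measurable]: "noise_scale S \<in> borel_measurable (time_measure S)"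
  using pop by (simp add: population_def)

lemma dens_continuous: "continuous_on (time_dom S) (dens S)"
  using pop lipschitz_on_continuous_on by (auto simp: population_def)

lemma dens_measurable[measurable]: "dens S \<in> borel_measurable (time_measure S)"
  by (rule borel_measurable_time_measure[OF dens_continuous])

lemma dens_pos: "t \<in> time_dom S \<Longrightarrow> 0 < dens S t"
  using pop by (simp add: population_def)

lemma dens_min_pos: "0 < dens_min S" and dens_min_le: "t \<in> time_dom S \<Longrightarrow> dens_min S \<le> dens S t"
proof -
  obtain t0 where t0: "t0 \<in> time_dom S" "\<And>t. t \<in> time_dom S \<Longrightarrow> dens S t0 \<le> dens S t"
    using continuous_attains_inf[OF compact_time_dom time_dom_nonempty dens_continuous] by blast
  then have eq: "dens_min S = dens S t0"
    unfolding dens_min_def by (intro cInf_eq_minimum) auto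
  show "0 < dens_min S" using eq dens_pos t0 by simp
  show "t \<in> time_dom S \<Longrightarrow> dens_min S \<le> dens S t" using eq t0 by simp
qed

lemma basis_continuous: "1 \<le> k \<Longrightarrow> continuous_on (time_dom S) (\<phi> k)"
  using lip lipschitz_on_continuous_on by blast

lemma basis_measurable[measurable]: "1 \<le> k \<Longrightarrow> \<phi> k \<in> borel_measurable (time_measure S)"
  by (intro borel_measurable_time_measure basis_continuous)

lemma mean_continuous: "continuous_on (time_dom S) (mean_fun S u)"
proof (rule continuous_on_iff[THEN iffD2], safe)
  fix t and e :: real assume t: "t \<in> time_dom S" and e: "0 < e"
  have \<alpha>: "0 < \<alpha>" and L: "0 \<le> L u"
    and H: "\<And>t t'. t \<in> time_dom S \<Longrightarrow> t' \<in> time_dom S \<Longrightarrow>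
      \<bar>mean_fun S u t - mean_fun S u t'\<bar> \<le> L u * \<bar>t - t'\<bar> powr \<alpha>"
    using hoelder by (auto simp: hoelder_mean_def)
  \<comment> \<open>With this radius the Hoelder bound is at most
    \<open>L u * e / (L u + 1)\<close>, which is below \<open>e\<close>; the added 1 also covers
    \<open>L u = 0\<close>.\<close>
  define d where "d = (e / (L u + 1)) powr (1 / \<alpha>)"
  have "dist (mean_fun S u t') (mean_fun S u t) < e" if t': "t' \<in> time_dom S" "dist t' t < d" for t'
  proof -
    have "\<bar>t' - t\<bar> powr \<alpha> \<le> d powr \<alpha>"
      using that \<alpha> by (intro powr_mono2) (auto simp: dist_real_def)
    also have "\<dots> = e / (L u + 1)" using e L \<alpha> by (simp add: d_def powr_powr)
    finally have "L u * \<bar>t' - t\<bar> powr \<alpha> \<le> L u * (e / (L u + 1))" using L by (rule mult_left_mono)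
    also have "\<dots> < e" using e L by (simp add: field_simps)
    finally show ?thesis using H[OF t'(1) t] by (simp add: dist_real_def)
  qed
  moreover have "0 < d" using e L by (simp add: d_def)
  ultimately show "\<exists>d>0. \<forall>t'\<in>time_dom S. dist t' t < d \<longrightarrow> dist (mean_fun S u t') (mean_fun S u t) <
      e"
    by blast
qed

lemma bounded_on_time_dom:
  fixes f :: "real \<Rightarrow> real"
  assumes "continuous_on (time_dom S) f"
  obtains B where "\<And>t. t \<in> time_dom S \<Longrightarrow> \<bar>f t\<bar> \<le> B"
  using compact_imp_bounded[OF compact_continuous_image[OF assms compact_time_dom]]
  by (auto simp: bounded_iff)

lemma integrable_time_measure:
  fixes f :: "real \<Rightarrow> real"
  assumes "continuous_on (time_dom S) f"
  shows "integrable (time_measure S) f"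
proof -
  obtain B where B: "\<And>t. t \<in> time_dom S \<Longrightarrow> \<bar>f t\<bar> \<le> B" using bounded_on_time_dom[OF assms] by blast
  show ?thesis
    by (rule time.integrable_const_bound[where B = B])
       (auto intro!: AE_I2 B borel_measurable_time_measure assms)
qed

lemma coef_measurable[measurable]: "1 \<le> k \<Longrightarrow> coef S \<phi> k \<in> borel_measurable (state_measure S)"
proof -
  assume k: "1 \<le> k"
  note [measurable] = mean_eval_measurable[OF measurable_fst measurable_snd] basis_measurable[OF k]
  show "coef S \<phi> k \<in> borel_measurable (state_measure S)"
    unfolding coef_def[abs_def] by measurable
qed

text \<open>The conditions on the weights concern functions on the whole line, while the functions
  to be inserted are measurable only on the time interval; the indicator extends them by
  zero.\<close>

lemma integral_design_law:
  fixes f :: "real \<Rightarrow> real"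
  assumes [measurable]: "f \<in> borel_measurable (time_measure S)"
  shows "(\<integral>t. indicator (time_dom S) t * f t \<partial>design_law S) = (\<integral>t. f t * dens S t \<partial>time_measure S)"
    and "integrable (time_measure S) (\<lambda>t. f t * dens S t) \<Longrightarrow>
      integrable (design_law S) (\<lambda>t. indicator (time_dom S) t * f t)"
proof -
  have m: "(\<lambda>t. indicator (time_dom S) t * g t) \<in> borel_measurable borel"
    if "g \<in> borel_measurable (time_measure S)" for g :: "real \<Rightarrow> real"
    using that borel_measurable_restrict_space_iff[of "time_dom S" borel g]
    by (simp add: measurable_cong_sets[OF sets_time_measure refl])
  have fm: "(\<lambda>t. indicator (time_dom S) t * f t) \<in> borel_measurable lborel"
    and gm: "(\<lambda>t. indicator (time_dom S) t * dens S t) \<in> borel_measurable lborel"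
    using m[of f] m[of "dens S"] by auto
  have law: "design_law S = density lborel (\<lambda>t. ennreal (indicator (time_dom S) t * dens S t))"
    unfolding design_law_def design_density_def[abs_def]
    by (rule arg_cong[where f = "density lborel"]) (simp add: fun_eq_iff indicator_def)
  have nn: "AE t in lborel. 0 \<le> indicator (time_dom S) t * dens S t"
    using dens_pos by (auto intro!: AE_I2 simp: indicator_def less_imp_le)
  have eq: "(indicator (time_dom S) t * dens S t) *\<^sub>R (indicator (time_dom S) t * f t) =
    indicator (time_dom S) t *\<^sub>R (f t * dens S t)" for t
    by (auto simp: indicator_def)
  show "(\<integral>t. indicator (time_dom S) t * f t \<partial>design_law S) = (\<integral>t. f t * dens S t \<partial>time_measure S)"
    unfolding law integral_density[OF fm gm nn] eq time_measure_def
    by (subst integral_restrict_space) auto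
  show "integrable (design_law S) (\<lambda>t. indicator (time_dom S) t * f t)"
    if "integrable (time_measure S) (\<lambda>t. f t * dens S t)"
    unfolding law integrable_density[OF fm gm nn] eq using that
    by (simp add: time_measure_def integrable_restrict_space)
qed

text \<open>Every omitted index is at least \<open>x\<close>, so the weight
  \<open>x powr (2 * s)\<close> can be pulled out of the tail of the decay series, as in Markov's
  inequality.\<close>

lemma coef_tail_le:
  assumes decay: "coef_decay S \<phi> s Cs" and x: "0 < x" "x \<le> real (Suc N)"
  shows "(\<integral>\<^sup>+u. (\<Sum>j. ennreal ((coef S \<phi> (Suc (N + j)) u)\<^sup>2)) \<partial>state_measure S)
    \<le> ennreal (Cs * x powr (- 2 * s))"
proof -
  define A where "A k = (\<integral>\<^sup>+u. ennreal ((coef S \<phi> k u)\<^sup>2) \<partial>state_measure S)" for k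
  have s: "0 < s" "0 < Cs" and total: "(\<Sum>k. ennreal (real (Suc k) powr (2 * s)) * A (Suc k)) \<le>
      ennreal Cs"
    using decay by (auto simp: coef_decay_def A_def)
  have "ennreal (x powr (2 * s)) * (\<Sum>j. A (Suc (N + j))) =
      (\<Sum>j. ennreal (x powr (2 * s)) * A (Suc (j + N)))"
    by (simp add: add.commute)
  also have "\<dots> \<le> (\<Sum>j. ennreal (real (Suc (j + N)) powr (2 * s)) * A (Suc (j + N)))"
    using x s by (intro suminf_le mult_right_mono ennreal_leI powr_mono2) auto
  also have "\<dots> \<le> (\<Sum>k. ennreal (real (Suc k) powr (2 * s)) * A (Suc k))"
    using suminf_offset[of "\<lambda>k. ennreal (real (Suc k) powr (2 * s)) * A (Suc k)" N] by simp
  also note total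
  finally have tail: "ennreal (x powr (2 * s)) * (\<Sum>j. A (Suc (N + j))) \<le> ennreal Cs" .
  have "(\<integral>\<^sup>+u. (\<Sum>j. ennreal ((coef S \<phi> (Suc (N + j)) u)\<^sup>2)) \<partial>state_measure S) = (\<Sum>j. A (Suc (N +
      j)))"
    unfolding A_def by (rule nn_integral_suminf) simp
  also have "\<dots> = ennreal (x powr (- 2 * s)) * (ennreal (x powr (2 * s)) * (\<Sum>j. A (Suc (N + j))))"
    using x by (simp add: mult.assoc[symmetric] ennreal_mult[symmetric] powr_add[symmetric])
  also have "\<dots> \<le> ennreal (x powr (- 2 * s)) * ennreal Cs"
    by (rule mult_left_mono[OF tail]) simp
  also have "\<dots> = ennreal (Cs * x powr (- 2 * s))"
    using s by (simp add: ennreal_mult[symmetric] mult.commute)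
  finally show ?thesis .
qed

text \<open>\<open>Gamma_X\<close> is a Bochner integral, with value 0 where integrability fails, so
  it represents the second moment only where that is finite. The finite total energy and Tonelli's
  theorem give this for almost every time, and there Fubini's theorem identifies the moment with the
  diagonal value of \<open>Gamma_X\<close>. Continuity on a compact square makes the supremum a
  genuine upper bound.\<close>

lemma field_second_moment_le:
  "AE t in time_measure S. (\<integral>\<^sup>+x. (\<integral>\<^sup>+u. ennreal ((x u t)\<^sup>2) \<partial>state_measure S) \<partial>field_law S)
    \<le> ennreal (sup_norm (time_dom S \<times> time_dom S) (\<lambda>(t, t'). Gamma_X S t t'))"
proof -
  define \<gamma> where "\<gamma> t = (\<integral>\<^sup>+x. (\<integral>\<^sup>+u. ennreal ((x u t)\<^sup>2) \<partial>state_measure S) \<partial>field_law S)" for t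
  interpret FU: pair_sigma_finite "field_law S" "state_measure S" ..
  interpret UT: pair_sigma_finite "state_measure S" "time_measure S" ..
  interpret TF: pair_sigma_finite "time_measure S" "field_law S" ..
  have sq[measurable]: "(\<lambda>z. (snd (fst z) (snd z) (fst (fst z)))\<^sup>2) \<in>
      borel_measurable ((time_measure S \<Otimes>\<^sub>M field_law S) \<Otimes>\<^sub>M state_measure S)"
    by (intro borel_measurable_power field_eval_measurable) measurable
  have inner: "(\<lambda>(t, x). \<integral>\<^sup>+u. ennreal ((x u t)\<^sup>2) \<partial>state_measure S) \<in>
      borel_measurable (time_measure S \<Otimes>\<^sub>M field_law S)"
    unfolding split_beta by measurable
  have [measurable]: "\<gamma> \<in> borel_measurable (time_measure S)"
    unfolding \<gamma>_def[abs_def] using inner by measurable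
  have "(\<integral>\<^sup>+t. \<gamma> t \<partial>time_measure S) =
    (\<integral>\<^sup>+x. (\<integral>\<^sup>+t. (\<integral>\<^sup>+u. ennreal ((x u t)\<^sup>2) \<partial>state_measure S) \<partial>time_measure S) \<partial>field_law S)"
    unfolding \<gamma>_def by (rule TF.Fubini'[OF inner, symmetric])
  also have "\<dots> = (\<integral>\<^sup>+x. (\<integral>\<^sup>+(u, t). ennreal ((x u t)\<^sup>2) \<partial>state_time_measure S) \<partial>field_law S)"
  proof (rule nn_integral_cong)
    fix x assume "x \<in> space (field_law S)"
    then have "(\<lambda>z. x (fst z) (snd z)) \<in> borel_measurable (state_measure S \<Otimes>\<^sub>M time_measure S)"
      by (intro field_eval_measurable measurable_const measurable_fst measurable_snd)
    then have m: "(\<lambda>z. ennreal ((x (fst z) (snd z))\<^sup>2)) \<in>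
        borel_measurable (state_measure S \<Otimes>\<^sub>M time_measure S)"
      by measurable
    show "(\<integral>\<^sup>+t. (\<integral>\<^sup>+u. ennreal ((x u t)\<^sup>2) \<partial>state_measure S) \<partial>time_measure S) =
      (\<integral>\<^sup>+(u, t). ennreal ((x u t)\<^sup>2) \<partial>state_time_measure S)"
      unfolding state_time_measure_def split_beta
      using UT.nn_integral_snd[OF m] by simp
  qed
  also have "\<dots> < \<infinity>" using pop by (simp add: population_def)
  finally have "AE t in time_measure S. \<gamma> t \<noteq> \<infinity>" by (intro nn_integral_PInf_AE) auto
  moreover have "\<gamma> t \<le> ennreal (sup_norm (time_dom S \<times> time_dom S) (\<lambda>(t, t'). Gamma_X S t t'))"
    if t: "t \<in> space (time_measure S)" and fin: "\<gamma> t \<noteq> \<infinity>" for t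
  proof -
    have m[measurable]: "(\<lambda>(x, u). (x u t)\<^sup>2) \<in> borel_measurable (field_law S \<Otimes>\<^sub>M state_measure S)"
      unfolding split_beta using t
      by (intro borel_measurable_power field_eval_measurable measurable_fst measurable_snd
          measurable_const)
    have nn: "(\<integral>\<^sup>+z. ennreal (case z of (x, u) \<Rightarrow> (x u t)\<^sup>2) \<partial>(field_law S \<Otimes>\<^sub>M state_measure S)) =
        \<gamma> t"
      unfolding \<gamma>_def
      using state.nn_integral_fst[of "\<lambda>z. ennreal (case z of (x, u) \<Rightarrow> (x u t)\<^sup>2)" "field_law S"]
          by simp
    have int: "integrable (field_law S \<Otimes>\<^sub>M state_measure S) (\<lambda>(x, u). (x u t)\<^sup>2)"
      using nn fin by (intro integrableI_nonneg) (auto simp: less_top)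
    have "Gamma_X S t t = (\<integral>z. (case z of (x, u) \<Rightarrow> (x u t)\<^sup>2) \<partial>(field_law S \<Otimes>\<^sub>M state_measure S))"
      using FU.integral_fst'[OF int] by (simp add: Gamma_X_def power2_eq_square)
    then have \<gamma>: "\<gamma> t = ennreal (Gamma_X S t t)"
      using nn_integral_eq_integral[OF int] nn by (simp add: split_beta')
    have "compact ((\<lambda>(t, t'). Gamma_X S t t') ` (time_dom S \<times> time_dom S))"
      by (intro compact_continuous_image Gamma_cont compact_Times compact_time_dom)
    then obtain B where "\<And>z. z \<in> time_dom S \<times> time_dom S \<Longrightarrow> \<bar>case z of (t, t') \<Rightarrow> Gamma_X S t t'\<bar> \<le> B"
      by (fastforce dest!: compact_imp_bounded simp: bounded_iff)
    then have "bdd_above ((\<lambda>z. \<bar>case z of (t, t') \<Rightarrow> Gamma_X S t t'\<bar>) ` (time_dom S \<times> time_dom S))"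
      by (intro bdd_aboveI2)
    then have "\<bar>Gamma_X S t t\<bar> \<le> sup_norm (time_dom S \<times> time_dom S) (\<lambda>(t, t'). Gamma_X S t t')"
      unfolding sup_norm_def
      using t cSUP_upper[of "(t, t)" "time_dom S \<times> time_dom S" "\<lambda>z. \<bar>case z of (t, t') \<Rightarrow> Gamma_X S
          t t'\<bar>"] by simp
    then show ?thesis unfolding \<gamma> by (intro ennreal_leI) simp
  qed
  ultimately show ?thesis unfolding \<gamma>_def[symmetric] by (elim AE_mp) (auto intro!: AE_I2)
qed

lemma sup_norm_Gamma_nonneg: "0 \<le> sup_norm (time_dom S \<times> time_dom S) (\<lambda>(t, t'). Gamma_X S t t')"
proof -
  obtain t where t: "t \<in> time_dom S" using time_dom_nonempty by auto
  have "compact ((\<lambda>z. \<bar>case z of (t, t') \<Rightarrow> Gamma_X S t t'\<bar>) ` (time_dom S \<times> time_dom S))"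
    by (intro compact_continuous_image continuous_on_rabs Gamma_cont compact_Times compact_time_dom)
  then have "bdd_above ((\<lambda>z. \<bar>case z of (t, t') \<Rightarrow> Gamma_X S t t'\<bar>) ` (time_dom S \<times> time_dom S))"
    by (intro bounded_imp_bdd_above compact_imp_bounded)
  from cSUP_upper2[OF this, of "(t, t)" 0] show ?thesis using t by (simp add: sup_norm_def)
qed

lemma C1_MC_nonneg: "0 < \<kappa> \<Longrightarrow> 0 \<le> C1_MC S \<kappa> m"
  using sup_norm_Gamma_nonneg dens_min_pos by (simp add: C1_MC_def)

lemma scale_le_sup_norm:
  assumes "t \<in> time_dom S" shows "(noise_scale S t)\<^sup>2 \<le> (sup_norm (time_dom S) (noise_scale S))\<^sup>2"
proof -
  have nn: "0 \<le> noise_scale S r" if "r \<in> time_dom S" for r using that pop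
      by (simp add: population_def)
  have "bdd_above ((\<lambda>t. \<bar>noise_scale S t\<bar>) ` time_dom S)"
    using pop nn by (simp add: population_def cong: image_cong)
  then have "\<bar>noise_scale S t\<bar> \<le> sup_norm (time_dom S) (noise_scale S)"
    unfolding sup_norm_def using assms by (intro cSUP_upper)
  then show ?thesis using nn[OF assms] by (intro power_mono) auto
qed

end

section \<open>The sampling scheme\<close>

lemma generated_algebra_generators:
  "(\<Union>i\<in>I. {Z i -` A \<inter> space P |A. A \<in> sets N}) \<subseteq> Pow (space P)"
  by auto

lemma space_generated_algebra[simp]: "space (generated_algebra P N Z I) = space P"
  unfolding generated_algebra_def by (rule space_measure_of[OF generated_algebra_generators])

lemma sets_generated_algebra:
  "sets (generated_algebra P N Z I) =
     sigma_sets (space P) (\<Union>i\<in>I. {Z i -` A \<inter> space P |A. A \<in> sets N})"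
  unfolding generated_algebra_def by (rule sets_measure_of[OF generated_algebra_generators])

lemma vimage_in_generated_algebra:
  "i \<in> I \<Longrightarrow> A \<in> sets N \<Longrightarrow> Z i -` A \<inter> space P \<in> sets (generated_algebra P N Z I)"
  unfolding sets_generated_algebra by (rule sigma_sets.Basic) blast

lemma subalgebra_generated_algebra:
  assumes "\<And>i. i \<in> I \<Longrightarrow> Z i \<in> measurable P N"
  shows "subalgebra P (generated_algebra P N Z I)"
  unfolding subalgebra_def sets_generated_algebra space_generated_algebra
  using assms by (auto intro!: sets.sigma_sets_subset measurable_sets)

lemma (in prob_space) indep_vars_pair:
  assumes "indep_vars (\<lambda>_. N) Z J" "i \<in> J" "j \<in> J" "i \<noteq> j" "B \<in> sets N" "C \<in> sets N"
  shows "prob ((Z i -` B \<inter> space M) \<inter> (Z j -` C \<inter> space M)) =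
    prob (Z i -` B \<inter> space M) * prob (Z j -` C \<inter> space M)"
proof -
  have "indep_sets (\<lambda>i. {Z i -` A \<inter> space M |A. A \<in> sets N}) J"
    using assms by (simp add: indep_vars_def2)
  moreover have "\<forall>l\<in>{i, j}. (if l = i then Z i -` B \<inter> space M else Z j -` C \<inter> space M)
      \<in> {Z l -` A \<inter> space M |A. A \<in> sets N}"
    using assms by (simp split: if_split) blast
  ultimately have "prob (\<Inter>l\<in>{i, j}. if l = i then Z i -` B \<inter> space M else Z j -` C \<inter> space M) =
      (\<Prod>l\<in>{i, j}. prob (if l = i then Z i -` B \<inter> space M else Z j -` C \<inter> space M))"
    using assms by (intro indep_setsD) auto
  then show ?thesis using \<open>i \<noteq> j\<close> by (simp add: Int_commute)
qed

lemma UNIV_source: "(UNIV :: source set) = {Design, Field, Noise}"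
  by (auto intro: source.exhaust)

locale regular_trial = smooth_model S \<phi> \<alpha> L
  for S :: "('u::{metric_space, second_countable_topology}) model" and \<phi> \<alpha> L +
  fixes E :: "('w, 'u) trial" and C0 \<kappa> :: real and m_max :: nat
  assumes data: "data_generating S E"
    and adm: "admissible_weights S E C0 (mc_weight S E)"
    and smb: "second_moment_bound S E \<kappa>"
    and visits_le: "\<And>i. i \<in> {1..subjects E} \<Longrightarrow> visits E i \<le> m_max"
    and size: "4 \<le> sample_size E" and \<kappa>_pos: "0 < \<kappa>"
begin

abbreviation "P \<equiv> basic_space E"
abbreviation "I \<equiv> index_set E"
abbreviation "n \<equiv> subjects E"
abbreviation "M \<equiv> sample_size E"
abbreviation "T \<equiv> visit_time E"
abbreviation "X \<equiv> field_path E"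
abbreviation "\<eta> \<equiv> noise_path E"
abbreviation "G \<equiv> generated_algebra P borel T I"

sublocale P: prob_space P
  using data by (simp add: data_generating_def Let_def)

lemma finite_index_set[simp]: "finite I"
  by (simp add: index_set_def)

lemma fst_index: "p \<in> I \<Longrightarrow> fst p \<in> {1..n}"
  by (auto simp: index_set_def)

lemma indep_field: "P.indep_vars (\<lambda>_. field_law S) X {1..n}"
  and indep_noise: "P.indep_vars (\<lambda>_. noise_law S) \<eta> I"
  using data by (simp_all add: data_generating_def Let_def)

lemma field_path_measurable[measurable]: "i \<in> {1..n} \<Longrightarrow> X i \<in> measurable P (field_law S)"
  using indep_field by (simp add: P.indep_vars_def)

lemma noise_path_measurable[measurable]: "p \<in> I \<Longrightarrow> \<eta> p \<in> measurable P (noise_law S)"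
  using indep_noise by (simp add: P.indep_vars_def)

lemma visit_time_measurable[measurable]: "p \<in> I \<Longrightarrow> T p \<in> borel_measurable P"
  using data by (simp add: data_generating_def Let_def P.indep_vars_def)

lemma visit_time_in: "p \<in> I \<Longrightarrow> w \<in> space P \<Longrightarrow> T p w \<in> time_dom S"
  using data by (simp add: data_generating_def Let_def)

lemma prob_field: "i \<in> {1..n} \<Longrightarrow> B \<in> sets (field_law S) \<Longrightarrow>
    P.prob (X i -` B \<inter> space P) = measure (field_law S) B"
  using data measure_distr[OF field_path_measurable, of i B]
  by (simp add: data_generating_def Let_def)

lemma prob_noise: "p \<in> I \<Longrightarrow> B \<in> sets (noise_law S) \<Longrightarrow>
    P.prob (\<eta> p -` B \<inter> space P) = measure (noise_law S) B"
  using data measure_distr[OF noise_path_measurable, of p B]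
  by (simp add: data_generating_def Let_def)

lemma subalgebra_design: "subalgebra P G"
  by (intro subalgebra_generated_algebra) simp

section \<open>Factorization of probabilities across design, fields and noise\<close>

lemma prob_three_sources:
  assumes "A \<in> sets G" "B \<in> sets (generated_algebra P (field_law S) X {1..n})"
    "C \<in> sets (generated_algebra P (noise_law S) \<eta> I)"
  shows "P.prob (A \<inter> B \<inter> C) = P.prob A * P.prob B * P.prob C"
proof -
  have "P.indep_sets (\<lambda>c. case c of
            Design \<Rightarrow> sets G
          | Field \<Rightarrow> sets (generated_algebra P (field_law S) X {1..n})
          | Noise \<Rightarrow> sets (generated_algebra P (noise_law S) \<eta> I)) UNIV"
    using data by (simp add: data_generating_def Let_def del: One_nat_def)
  from P.indep_setsD[OF this, of UNIV "\<lambda>c. case c of Design \<Rightarrow> A | Field \<Rightarrow> B | Noise \<Rightarrow> C"]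
  show ?thesis using assms by (simp add: UNIV_source Int_assoc mult.assoc)
qed

lemma prob_design_field:
  assumes "A \<in> sets G" "B \<in> sets (generated_algebra P (field_law S) X {1..n})"
  shows "P.prob (A \<inter> B) = P.prob A * P.prob B"
proof -
  have "B \<subseteq> space P" using sets.sets_into_space[OF assms(2)] by simp
  then have "A \<inter> B \<inter> space P = A \<inter> B" by auto
  moreover have "space P \<in> sets (generated_algebra P (noise_law S) \<eta> I)"
    using sets.top[of "generated_algebra P (noise_law S) \<eta> I"] by simp
  ultimately show ?thesis using prob_three_sources[OF assms, of "space P"]
      by (simp add: P.prob_space)
qed

lemma prob_design_noise:
  assumes "A \<in> sets G" "C \<in> sets (generated_algebra P (noise_law S) \<eta> I)"
  shows "P.prob (A \<inter> C) = P.prob A * P.prob C"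
proof -
  have "C \<subseteq> space P" using sets.sets_into_space[OF assms(2)] by simp
  then have "A \<inter> space P \<inter> C = A \<inter> C" by auto
  moreover have "space P \<in> sets (generated_algebra P (field_law S) X {1..n})"
    using sets.top[of "generated_algebra P (field_law S) X {1..n}"] by simp
  ultimately show ?thesis using prob_three_sources[OF assms(1) _ assms(2), of "space P"]
    by (simp add: P.prob_space)
qed

text \<open>For cross terms with the quadrature error, which depends on the design alone.\<close>

lemma draw_field:
  assumes "i \<in> {1..n}" shows "independent_draw P G (field_law S) (X i)"
  using assms prob_design_field[OF _ vimage_in_generated_algebra] prob_field
    P.prob_space_axioms field.prob_space_axioms subalgebra_design
  by (auto simp: independent_draw_def)

lemma draw_noise:
  assumes "p \<in> I" shows "independent_draw P G (noise_law S) (\<eta> p)"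
  using assms prob_design_noise[OF _ vimage_in_generated_algebra] prob_noise
    P.prob_space_axioms noise.prob_space_axioms subalgebra_design
  by (auto simp: independent_draw_def)

text \<open>For cross terms of two subjects: independence of the design from the field source splits
  off the design event, and independence of the two subjects then splits the rest.\<close>

lemma draw_field_adjoin_field:
  assumes "i \<in> {1..n}" "i' \<in> {1..n}" "i \<noteq> i'"
  shows "independent_draw P (adjoin G (field_law S) (X i')) (field_law S) (X i)"
proof (intro independent_draw_adjoin subalgebra_design P.prob_space_axioms field.prob_space_axioms
    field_path_measurable assms)
  fix A B C assume ABC: "A \<in> sets G" "B \<in> sets (field_law S)" "C \<in> sets (field_law S)"
  let ?B = "X i -` B \<inter> space P" and ?C = "X i' -` C \<inter> space P"
  have B: "?B \<in> sets (generated_algebra P (field_law S) X {1..n})"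
    and C: "?C \<in> sets (generated_algebra P (field_law S) X {1..n})"
    using assms ABC by (auto intro: vimage_in_generated_algebra)
  show "P.prob (A \<inter> ?C \<inter> ?B) = P.prob (A \<inter> ?C) * measure (field_law S) B"
    using prob_design_field[OF ABC(1) sets.Int[OF C B]] prob_design_field[OF ABC(1) C]
      P.indep_vars_pair[OF indep_field, of i' i C B] assms ABC prob_field
    by (simp add: Int_assoc)
qed

lemma draw_noise_adjoin_noise:
  assumes "p \<in> I" "p' \<in> I" "p \<noteq> p'"
  shows "independent_draw P (adjoin G (noise_law S) (\<eta> p')) (noise_law S) (\<eta> p)"
proof (intro independent_draw_adjoin subalgebra_design P.prob_space_axioms noise.prob_space_axioms
    noise_path_measurable assms)
  fix A B C assume ABC: "A \<in> sets G" "B \<in> sets (noise_law S)" "C \<in> sets (noise_law S)"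
  let ?B = "\<eta> p -` B \<inter> space P" and ?C = "\<eta> p' -` C \<inter> space P"
  have B: "?B \<in> sets (generated_algebra P (noise_law S) \<eta> I)"
    and C: "?C \<in> sets (generated_algebra P (noise_law S) \<eta> I)"
    using assms ABC by (auto intro: vimage_in_generated_algebra)
  show "P.prob (A \<inter> ?C \<inter> ?B) = P.prob (A \<inter> ?C) * measure (noise_law S) B"
    using prob_design_noise[OF ABC(1) sets.Int[OF C B]] prob_design_noise[OF ABC(1) C]
      P.indep_vars_pair[OF indep_noise, of p' p C B] assms ABC prob_noise
    by (simp add: Int_assoc)
qed

text \<open>For cross terms of a field and a noise term. One orientation suffices: the field is
  adjoined to the design, and the noise is the centered draw.\<close>

lemma draw_noise_adjoin_field:
  assumes "p \<in> I" "i \<in> {1..n}"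
  shows "independent_draw P (adjoin G (field_law S) (X i)) (noise_law S) (\<eta> p)"
proof (intro independent_draw_adjoin subalgebra_design P.prob_space_axioms noise.prob_space_axioms
    noise_path_measurable field_path_measurable assms)
  fix A B C assume ABC: "A \<in> sets G" "B \<in> sets (noise_law S)" "C \<in> sets (field_law S)"
  let ?B = "\<eta> p -` B \<inter> space P" and ?C = "X i -` C \<inter> space P"
  have B: "?B \<in> sets (generated_algebra P (noise_law S) \<eta> I)"
    and C: "?C \<in> sets (generated_algebra P (field_law S) X {1..n})"
    using assms ABC by (auto intro: vimage_in_generated_algebra)
  show "P.prob (A \<inter> ?C \<inter> ?B) = P.prob (A \<inter> ?C) * measure (noise_law S) B"
    using prob_three_sources[OF ABC(1) C B] prob_design_field[OF ABC(1) C] assms ABC prob_noise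
    by simp
qed

section \<open>Splitting an estimated coefficient into quadrature, field and noise terms\<close>

definition loading :: "nat \<Rightarrow> nat \<times> nat \<Rightarrow> 'w \<Rightarrow> real" where
  "loading k p w = mc_weight S E p w * \<phi> k (T p w) / dens S (T p w)"

text \<open>The path \<open>x\<close> is a separate argument, so that it can be integrated under
  \<open>field_law S\<close> with the design frozen. All visits of a subject are kept in one term
  because they share a path.\<close>

definition field_part :: "nat \<Rightarrow> 'u \<Rightarrow> nat \<Rightarrow> 'w \<Rightarrow> ('u \<Rightarrow> real \<Rightarrow> real) \<Rightarrow> real" where
  "field_part k u i w x = (\<Sum>j=1..visits E i. loading k (i, j) w * x u (T (i, j) w))"

definition noise_part :: "nat \<Rightarrow> 'u \<Rightarrow> nat \<times> nat \<Rightarrow> 'w \<Rightarrow> ('u \<Rightarrow> real) \<Rightarrow> real" where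
  "noise_part k u p w e = loading k p w * noise_scale S (T p w) * e u"

lemma coef_hat_decomposition:
  "coef_hat S E \<phi> k w u = noiseless_coef S E \<phi> k u w +
     (\<Sum>i=1..n. field_part k u i w (X i w)) + (\<Sum>p\<in>I. noise_part k u p w (\<eta> p w))"
proof -
  have "(\<Sum>i=1..n. field_part k u i w (X i w)) = (\<Sum>p\<in>I. loading k p w * X (fst p) w u (T p w))"
    unfolding field_part_def index_set_def by (subst sum.Sigma) (auto intro!: sum.cong)
  then show ?thesis
    unfolding coef_hat_def noiseless_coef_def noise_part_def response_def Let_def loading_def
    by (simp add: sum.distrib[symmetric] algebra_simps add_divide_distrib)
qed

lemma visit_time_measurable_design: "p \<in> I \<Longrightarrow> T p \<in> measurable G (time_measure S)"
proof -
  assume p: "p \<in> I"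
  have "T p \<in> borel_measurable G"
    using p vimage_in_generated_algebra[of p I _ borel T P] by (intro measurableI) auto
  then have "T p \<in> measurable G (restrict_space borel (time_dom S))"
    using p visit_time_in by (intro measurable_restrict_space2) auto
  then show "T p \<in> measurable G (time_measure S)"
    using measurable_cong_sets[OF refl sets_time_measure] by blast
qed

text \<open>\<open>H\<close> ranges over sigma-algebras that contain the design: the design itself,
  an adjoined one, or the whole basic space. One measurability proof then serves every role a term
  plays in the orthogonality argument.\<close>

context
  fixes H assumes sub: "subalgebra H G"
begin

lemma visit_time_measurable_sub: "p \<in> I \<Longrightarrow> T p \<in> measurable H (time_measure S)"
  by (rule measurable_from_subalg[OF sub visit_time_measurable_design])

lemma loading_measurable: "1 \<le> k \<Longrightarrow> p \<in> I \<Longrightarrow> loading k p \<in> borel_measurable H"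
proof -
  assume k: "1 \<le> k" and p: "p \<in> I"
  have "mc_weight S E p \<in> borel_measurable G"
    using adm p by (simp add: admissible_weights_def Let_def)
  note [measurable] = measurable_from_subalg[OF sub this] visit_time_measurable_sub[OF p]
      basis_measurable[OF k]
  show "loading k p \<in> borel_measurable H" unfolding loading_def[abs_def] by measurable
qed

lemma noiseless_coef_measurable: "1 \<le> k \<Longrightarrow> noiseless_coef S E \<phi> k u \<in> borel_measurable H"
proof -
  assume k: "1 \<le> k"
  have m: "(\<lambda>w. mean_fun S u (T p w)) \<in> borel_measurable H" if "p \<in> I" for p
    using visit_time_measurable_sub[OF that] by (intro mean_eval_measurable) auto
  have "noiseless_coef S E \<phi> k u = (\<lambda>w. \<Sum>p\<in>I. mean_fun S u (T p w) * loading k p w)"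
    by (auto simp: noiseless_coef_def loading_def fun_eq_iff intro!: sum.cong)
  then show ?thesis using m loading_measurable[OF k] by simp
qed

lemma field_part_measurable:
  assumes "1 \<le> k" "i \<in> {1..n}"
  shows "(\<lambda>(w, x). field_part k u i w x) \<in> borel_measurable (H \<Otimes>\<^sub>M field_law S)"
proof -
  have p: "(i, j) \<in> I" if "j \<in> {1..visits E i}" for j using that assms by (auto simp: index_set_def)
  have "(\<lambda>z. snd z u (T (i, j) (fst z))) \<in> borel_measurable (H \<Otimes>\<^sub>M field_law S)"
    if "j \<in> {1..visits E i}" for j
    by (rule field_eval_measurable[OF measurable_snd _
          measurable_compose[OF measurable_fst visit_time_measurable_sub[OF p[OF that]]]]) simp
  then show ?thesis unfolding field_part_def split_beta
    using measurable_compose[OF measurable_fst loading_measurable[OF assms(1) p]]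
    by (intro borel_measurable_sum borel_measurable_times)
qed

lemma noise_part_measurable:
  assumes "1 \<le> k" "p \<in> I"
  shows "(\<lambda>(w, e). noise_part k u p w e) \<in> borel_measurable (H \<Otimes>\<^sub>M noise_law S)"
proof -
  have "(\<lambda>z. snd z u) \<in> borel_measurable (H \<Otimes>\<^sub>M noise_law S)"
    by (intro noise_eval_measurable) auto
  then show ?thesis unfolding noise_part_def split_beta
    using measurable_compose[OF measurable_fst loading_measurable[OF assms]]
      measurable_compose[OF measurable_compose[OF measurable_fst visit_time_measurable_sub[OF
          assms(2)]] scale_measurable]
    by (intro borel_measurable_times)
qed

end

lemma field_part_adjoin:
  assumes "1 \<le> k" "i \<in> {1..n}"
  shows "(\<lambda>w. field_part k u i w (X i w)) \<in> borel_measurable (adjoin G (field_law S) (X i))"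
proof -
  have X: "X i \<in> space G \<rightarrow> space (field_law S)"
    using measurable_space[OF field_path_measurable[OF assms(2)]] by simp
  from measurable_compose[OF measurable_Pair[OF measurable_ident_sets[OF refl]
      measurable_adjoin_right[OF X]]
    field_part_measurable[OF subalgebra_adjoin_left[OF X] assms]]
  show ?thesis by simp
qed

lemma noise_part_adjoin:
  assumes "1 \<le> k" "p \<in> I"
  shows "(\<lambda>w. noise_part k u p w (\<eta> p w)) \<in> borel_measurable (adjoin G (noise_law S) (\<eta> p))"
proof -
  have X: "\<eta> p \<in> space G \<rightarrow> space (noise_law S)"
    using measurable_space[OF noise_path_measurable[OF assms(2)]] by simp
  from measurable_compose[OF measurable_Pair[OF measurable_ident_sets[OF refl]
      measurable_adjoin_right[OF X]]
    noise_part_measurable[OF subalgebra_adjoin_left[OF X] assms]]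
  show ?thesis by simp
qed

text \<open>The outcome is restricted to the basic space because paths are centered only at times in
  the interval, where the visit times then lie.\<close>

lemma field_part_centered:
  assumes "i \<in> {1..n}" "w \<in> space P"
  shows "(\<integral>x. field_part k u i w x \<partial>field_law S) = 0"
proof -
  have c: "integrable (field_law S) (\<lambda>x. x u t)" "(\<integral>x. x u t \<partial>field_law S) = 0" if "t \<in>
      time_dom S" for t
    using that pop by (auto simp: population_def)
  have t: "T (i, j) w \<in> time_dom S" if "j \<in> {1..visits E i}" for j
    using that assms visit_time_in[of "(i, j)" w] by (auto simp: index_set_def)
  show ?thesis unfolding field_part_def
    by (subst Bochner_Integration.integral_sum) (auto intro!: sum.neutral simp: c t)
qed

lemma noise_part_centered: "(\<integral>e. noise_part k u p w e \<partial>noise_law S) = 0"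
  using pop by (simp add: noise_part_def population_def)

text \<open>In each cross term one factor is a fresh centered draw relative to a sigma-algebra that
  contains the design and makes the other factor measurable.\<close>

lemma coef_hat_second_moment:
  assumes k: "1 \<le> k"
  shows "(\<integral>\<^sup>+w. ennreal ((coef_hat S E \<phi> k w u - coef S \<phi> k u)\<^sup>2) \<partial>P) \<le>
    (\<integral>\<^sup>+w. ennreal ((noiseless_coef S E \<phi> k u w - coef S \<phi> k u)\<^sup>2) \<partial>P) +
    (\<Sum>i=1..n. \<integral>\<^sup>+w. ennreal ((field_part k u i w (X i w))\<^sup>2) \<partial>P) +
    (\<Sum>p\<in>I. \<integral>\<^sup>+w. ennreal ((noise_part k u p w (\<eta> p w))\<^sup>2) \<partial>P)"
proof -
  \<comment> \<open>All terms are put into one family: \<open>None\<close> is the quadrature error,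
    \<open>Inl\<close> indexes subjects and \<open>Inr\<close> indexes visits.\<close>
  define f where "f j = (case j of
      None \<Rightarrow> (\<lambda>w. noiseless_coef S E \<phi> k u w - coef S \<phi> k u)
    | Some (Inl i) \<Rightarrow> (\<lambda>w. field_part k u i w (X i w))
    | Some (Inr p) \<Rightarrow> (\<lambda>w. noise_part k u p w (\<eta> p w)))" for j :: "(nat + nat \<times> nat) option"
  let ?J = "insert None (Some ` ({1..n} <+> I))"
  have GG: "subalgebra G G" by (simp add: subalgebra_def)
  have adjG: "subalgebra (adjoin G N V) G" if "V \<in> measurable P N" for N :: "'c measure" and V
    using measurable_space[OF that] by (intro subalgebra_adjoin_left) auto
  have B: "f None \<in> borel_measurable H" if "subalgebra H G" for H
    unfolding f_def using noiseless_coef_measurable[OF that k] by simp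
  have F: "f (Some (Inl i)) \<in> borel_measurable (adjoin G (field_law S) (X i))" if "i \<in> {1..n}" for i
    unfolding f_def using field_part_adjoin[OF k that] by simp
  have N: "f (Some (Inr p)) \<in> borel_measurable (adjoin G (noise_law S) (\<eta> p))" if "p \<in> I" for p
    unfolding f_def using noise_part_adjoin[OF k that] by simp
  have memJ: "j = None \<or> (\<exists>i\<in>{1..n}. j = Some (Inl i)) \<or> (\<exists>p\<in>I. j = Some (Inr p))" if "j \<in> ?J" for j
    using that by (elim insertE imageE PlusE; blast)
  have meas: "f j \<in> borel_measurable P" if jJ: "j \<in> ?J" for j
  proof -
    consider "j = None" | i where "j = Some (Inl i)" "i \<in> {1..n}" | p where "j = Some (Inr p)" "p
        \<in> I"
      using memJ[OF jJ] by blast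
    then show ?thesis
    proof cases
      case 1 then show ?thesis using measurable_from_subalg[OF subalgebra_design B[OF GG]] by simp
    next
      case 2 show ?thesis
        using measurable_compose[OF measurable_graph_independent_draw[OF draw_field[OF 2(2)]]
            field_part_measurable[OF GG k 2(2)]]
        by (simp add: f_def 2)
    next
      case 3 show ?thesis
        using measurable_compose[OF measurable_graph_independent_draw[OF draw_noise[OF 3(2)]]
            noise_part_measurable[OF GG k 3(2)]]
        by (simp add: f_def 3)
    qed
  qed
  have field_orth: "(\<integral>w. g w * f (Some (Inl i)) w \<partial>P) = 0"
    if "independent_draw P H (field_law S) (X i)" "subalgebra H G" "i \<in> {1..n}" "g \<in>
        borel_measurable H"
      "integrable P (\<lambda>w. g w * f (Some (Inl i)) w)" for g H i
    using integral_independent_draw_centered[OF that(1) field_part_measurable[OF that(2) k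
        that(3)] that(4) field_part_centered[OF that(3)]] that(5)
    by (simp add: f_def)
  have noise_orth: "(\<integral>w. g w * f (Some (Inr p)) w \<partial>P) = 0"
    if "independent_draw P H (noise_law S) (\<eta> p)" "subalgebra H G" "p \<in> I" "g \<in> borel_measurable H"
      "integrable P (\<lambda>w. g w * f (Some (Inr p)) w)" for g H p
    using integral_independent_draw_centered[OF that(1) noise_part_measurable[OF that(2) k
        that(3)] that(4) noise_part_centered] that(5)
    by (simp add: f_def)
  have orth: "(\<integral>w. f i w * f j w \<partial>P) = 0"
    if "i \<in> ?J" "j \<in> ?J" "i \<noteq> j" and int: "integrable P (\<lambda>w. f i w * f j w)" for i j
  proof -
    have int': "integrable P (\<lambda>w. f j w * f i w)" using int by (simp add: mult.commute)
    have None_l: "(\<integral>w. f None w * f j w \<partial>P) = 0"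
      if "j \<in> ?J" "j \<noteq> None" "integrable P (\<lambda>w. f None w * f j w)" for j
      using that field_orth[OF draw_field GG _ B[OF GG]] noise_orth[OF draw_noise GG _ B[OF GG]]
          by auto
    have FN: "(\<integral>w. f (Some (Inl i)) w * f (Some (Inr p)) w \<partial>P) = 0"
      if "i \<in> {1..n}" "p \<in> I" "integrable P (\<lambda>w. f (Some (Inl i)) w * f (Some (Inr p)) w)" for i p
      using that by (intro noise_orth[OF draw_noise_adjoin_field adjG[OF field_path_measurable] _
          F])
    \<comment> \<open>Up to the order of the factors there are three kinds: the quadrature error
      against a draw (drawn over the design), two draws from one source (one adjoined), and a field
      against a noise term (field adjoined).\<close>
    consider "i = None" | "j = None"
      | l l' where "i = Some (Inl l)" "j = Some (Inl l')" "l \<in> {1..n}" "l' \<in> {1..n}" "l' \<noteq> l"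
      | l p where "i = Some (Inl l)" "j = Some (Inr p)" "l \<in> {1..n}" "p \<in> I"
      | l p where "j = Some (Inl l)" "i = Some (Inr p)" "l \<in> {1..n}" "p \<in> I"
      | p p' where "i = Some (Inr p)" "j = Some (Inr p')" "p \<in> I" "p' \<in> I" "p' \<noteq> p"
      using memJ[OF \<open>i \<in> ?J\<close>] memJ[OF \<open>j \<in> ?J\<close>] \<open>i \<noteq> j\<close> by (elim disjE bexE; blast)
    then show ?thesis
    proof cases
      case 1 then show ?thesis using None_l[OF that(2)] not_sym[OF that(3)] int by simp
    next
      case 2 then show ?thesis using None_l[OF that(1)] that(3) int' by (simp add: mult.commute)
    next
      case 3 then show ?thesis
        using field_orth[OF draw_field_adjoin_field[OF 3(4,3,5)] adjG[OF field_path_measurable]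
            3(4) F] int by simp
    next
      case 4 then show ?thesis using FN int by simp
    next
      case 5 then show ?thesis using FN int' by (simp add: mult.commute)
    next
      case 6 then show ?thesis
        using noise_orth[OF draw_noise_adjoin_noise[OF 6(4,3,5)] adjG[OF noise_path_measurable]
            6(4) N] int by simp
    qed
  qed
  have J: "(\<Sum>j\<in>?J. h j) = h None + (\<Sum>i=1..n. h (Some (Inl i))) + (\<Sum>p\<in>I. h (Some (Inr p)))"
    for h :: "(nat + nat \<times> nat) option \<Rightarrow> 'c::comm_monoid_add"
    by (subst sum.insert) (auto simp: sum.reindex sum.Plus add.assoc)
  have "(\<integral>\<^sup>+w. ennreal ((coef_hat S E \<phi> k w u - coef S \<phi> k u)\<^sup>2) \<partial>P) =
    (\<integral>\<^sup>+w. ennreal ((\<Sum>j\<in>?J. f j w)\<^sup>2) \<partial>P)"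
    unfolding J by (simp add: f_def coef_hat_decomposition algebra_simps)
  \<comment> \<open>\<open>orth\<close> assumes an integrable product; square integrability of both
    factors supplies it.\<close>
  also have "\<dots> \<le> (\<Sum>j\<in>?J. \<integral>\<^sup>+w. ennreal ((f j w)\<^sup>2) \<partial>P)"
    by (rule nn_integral_square_sum_orthogonal)
       (auto intro!: meas orth integrable_mult_square_integrable simp del: One_nat_def)
  also have "\<dots> = (\<integral>\<^sup>+w. ennreal ((noiseless_coef S E \<phi> k u w - coef S \<phi> k u)\<^sup>2) \<partial>P) +
    (\<Sum>i=1..n. \<integral>\<^sup>+w. ennreal ((field_part k u i w (X i w))\<^sup>2) \<partial>P) +
    (\<Sum>p\<in>I. \<integral>\<^sup>+w. ennreal ((noise_part k u p w (\<eta> p w))\<^sup>2) \<partial>P)"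
    unfolding J by (simp add: f_def)
  finally show ?thesis .
qed

section \<open>Second moments of the coefficient estimators\<close>

text \<open>A visit time has a Lebesgue density supported on the interval, so exceptional times form
  a null event. This carries the almost-everywhere field bound over to random times.\<close>

lemma AE_visit_time:
  assumes p: "p \<in> I" and ae: "AE t in time_measure S. Q t"
  shows "AE w in P. Q (T p w)"
proof -
  have "distributed P lborel (T p) (design_density S)"
    using data p by (simp add: data_generating_def Let_def)
  then have law: "distr P lborel (T p) = density lborel (design_density S)"
    and m: "T p \<in> measurable P lborel" "design_density S \<in> borel_measurable lborel"
    by (auto simp: distributed_def)
  have "AE t in lborel. t \<in> time_dom S \<longrightarrow> Q t"
    using ae unfolding time_measure_def by (subst (asm) AE_restrict_space_iff) auto
  then have "AE t in density lborel (design_density S). Q t"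
    unfolding AE_density[OF m(2)] by (elim AE_mp) (auto simp: design_density_def indicator_def)
  then show ?thesis unfolding law[symmetric] by (rule AE_distrD[OF m(1)])
qed

text \<open>A single squared weight is at most the sum of all of them. The bound supplies the
  integrability without which Bochner integrals of weighted quantities would take their default
  value 0.\<close>

lemma weight_bounded:
  obtains c where "0 \<le> c" "\<And>p. p \<in> I \<Longrightarrow> AE w in P. \<bar>mc_weight S E p w\<bar> \<le> c"
proof
  let ?c = "sqrt (\<bar>1 + C0 / real M\<bar>)"
  show "0 \<le> ?c" by simp
  fix p assume p: "p \<in> I"
  have "AE w in P. (\<Sum>p\<in>I. (mc_weight S E p w)\<^sup>2) \<le> 1 + C0 / real M"
    using adm by (simp add: admissible_weights_def Let_def)
  then show "AE w in P. \<bar>mc_weight S E p w\<bar> \<le> ?c"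
  proof (rule AE_mp, intro AE_I2 impI)
    fix w assume "(\<Sum>p\<in>I. (mc_weight S E p w)\<^sup>2) \<le> 1 + C0 / real M"
    moreover have "(mc_weight S E p w)\<^sup>2 \<le> (\<Sum>p\<in>I. (mc_weight S E p w)\<^sup>2)"
      using p by (intro member_le_sum) auto
    ultimately show "\<bar>mc_weight S E p w\<bar> \<le> ?c"
      by (intro real_le_rsqrt) auto
  qed
qed

lemma weight_measurable[measurable]: "p \<in> I \<Longrightarrow> mc_weight S E p \<in> borel_measurable P"
  using adm by (auto simp: admissible_weights_def Let_def intro: measurable_from_subalg[OF
      subalgebra_design])

lemma loading_measurable_P: "1 \<le> k \<Longrightarrow> p \<in> I \<Longrightarrow> loading k p \<in> borel_measurable P"
  by (rule loading_measurable[OF subalgebra_design])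

lemma weighted_bounded:
  assumes p: "p \<in> I" and f: "continuous_on (time_dom S) f"
  obtains B where "AE w in P. \<bar>mc_weight S E p w * f (T p w)\<bar> \<le> B"
proof -
  obtain c where c: "0 \<le> c" "AE w in P. \<bar>mc_weight S E p w\<bar> \<le> c" using weight_bounded p by metis
  obtain B where B: "\<And>t. t \<in> time_dom S \<Longrightarrow> \<bar>f t\<bar> \<le> B" using bounded_on_time_dom[OF f] by blast
  have "AE w in P. \<bar>mc_weight S E p w * f (T p w)\<bar> \<le> c * B"
    using c(2)
  proof (rule AE_mp, intro AE_I2 impI)
    fix w assume "w \<in> space P" "\<bar>mc_weight S E p w\<bar> \<le> c"
    then show "\<bar>mc_weight S E p w * f (T p w)\<bar> \<le> c * B"
      unfolding abs_mult using B[OF visit_time_in[OF p]] c by (intro mult_mono) auto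
  qed
  then show ?thesis by (rule that)
qed

text \<open>The quadrature rule is unbiased: admissibility applied to
  \<open>mean_fun S u t * \<phi> k t / dens S t\<close> gives the expectation of this function under
  the design law, where the density cancels and the Fourier coefficient remains.\<close>

lemma bias_variance_noiseless:
  assumes k: "1 \<le> k"
  shows "(\<integral>\<^sup>+w. ennreal ((noiseless_coef S E \<phi> k u w - coef S \<phi> k u)\<^sup>2) \<partial>P) =
    ennreal (P.variance (noiseless_coef S E \<phi> k u))"
proof -
  define \<psi> where "\<psi> t = mean_fun S u t * \<phi> k t / dens S t" for t
  have \<psi>: "continuous_on (time_dom S) \<psi>"
    unfolding \<psi>_def using dens_pos
    by (intro continuous_intros mean_continuous basis_continuous[OF k] dens_continuous) fastforce
  have \<psi>m: "(\<lambda>w. \<psi> (T p w)) \<in> borel_measurable P" if "p \<in> I" for p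
    by (rule measurable_compose[OF visit_time_measurable_sub[OF subalgebra_design that]
        borel_measurable_time_measure[OF \<psi>]])
  have rep: "noiseless_coef S E \<phi> k u w = (\<Sum>p\<in>I. mc_weight S E p w * \<psi> (T p w))" for w
    by (simp add: noiseless_coef_def \<psi>_def mult.assoc)
  have sq: "integrable P (\<lambda>w. (mc_weight S E p w * \<psi> (T p w))\<^sup>2)"
    and int: "integrable P (\<lambda>w. mc_weight S E p w * \<psi> (T p w))" if p: "p \<in> I" for p
  proof -
    obtain B where B: "AE w in P. \<bar>mc_weight S E p w * \<psi> (T p w)\<bar> \<le> B"
        using weighted_bounded[OF p \<psi>] .
    note [measurable] = \<psi>m[OF p] weight_measurable[OF p]
    show "integrable P (\<lambda>w. mc_weight S E p w * \<psi> (T p w))"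
      using B by (intro P.integrable_const_bound[where B = B]) auto
    have "AE w in P. norm ((mc_weight S E p w * \<psi> (T p w))\<^sup>2) \<le> B\<^sup>2"
      using B by (elim AE_mp) (auto intro!: AE_I2 abs_le_square_iff[THEN iffD1] simp del: abs_mult)
    then show "integrable P (\<lambda>w. (mc_weight S E p w * \<psi> (T p w))\<^sup>2)"
      by (intro P.integrable_const_bound[where B = "B\<^sup>2"]) auto
  qed
  have "P.expectation (noiseless_coef S E \<phi> k u) = (\<Sum>p\<in>I. \<integral>w. mc_weight S E p w * \<psi> (T p w) \<partial>P)"
    unfolding rep by (rule Bochner_Integration.integral_sum) (rule int)
  \<comment> \<open>Inserting the indicator changes nothing at visit times, and puts the integrand
    in the form to which admissibility applies.\<close>
  also have "\<dots> = (\<Sum>p\<in>I. \<integral>w. mc_weight S E p w * (indicator (time_dom S) (T p w) * \<psi> (T p w)) \<partial>P)"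
    by (intro sum.cong refl Bochner_Integration.integral_cong) (auto simp: visit_time_in)
  also have "\<dots> = (\<integral>t. indicator (time_dom S) t * \<psi> t \<partial>design_law S)"
  proof -
    have "integrable (design_law S) (\<lambda>t. indicator (time_dom S) t * \<psi> t)"
      by (intro integral_design_law borel_measurable_time_measure \<psi> integrable_time_measure
          continuous_on_mult dens_continuous)
    then show ?thesis using adm by (auto simp: admissible_weights_def Let_def)
  qed
  also have "\<dots> = (\<integral>t. \<psi> t * dens S t \<partial>time_measure S)"
    by (intro integral_design_law borel_measurable_time_measure \<psi>)
  also have "\<dots> = coef S \<phi> k u"
    unfolding coef_def using dens_pos
    by (intro Bochner_Integration.integral_cong) (auto simp: \<psi>_def dest!: dens_pos)
  finally have E: "P.expectation (noiseless_coef S E \<phi> k u) = coef S \<phi> k u" .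
  \<comment> \<open>Square integrability makes the Bochner variance agree with the extended second
    moment instead of defaulting to 0.\<close>
  have "integrable P (\<lambda>w. (noiseless_coef S E \<phi> k u w)\<^sup>2)"
    unfolding rep using \<psi>m by (intro integral_square_sum sq borel_measurable_times
        weight_measurable)
  moreover have "integrable P (noiseless_coef S E \<phi> k u)"
    unfolding rep[abs_def] by (intro Bochner_Integration.integrable_sum int)
  ultimately have "integrable P (\<lambda>w. (noiseless_coef S E \<phi> k u w - coef S \<phi> k u)\<^sup>2)"
    by (simp add: power2_diff)
  then show ?thesis unfolding E by (intro nn_integral_eq_integral) auto
qed

lemma loading_second_moment:
  assumes k: "1 \<le> k"
  shows "(\<Sum>p\<in>I. \<integral>\<^sup>+w. ennreal ((loading k p w)\<^sup>2) \<partial>P) \<le> ennreal (\<kappa> / (real M * dens_min S))"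
proof -
  define f where "f t = \<phi> k t / dens S t" for t
  have f: "continuous_on (time_dom S) f"
    unfolding f_def using dens_pos
    by (intro continuous_intros basis_continuous[OF k] dens_continuous) fastforce
  let ?h = "\<lambda>t. indicator (time_dom S) t * (f t)\<^sup>2"
  \<comment> \<open>The second moment bound is stated for Bochner integrals, so this integrability
    is needed to convert it into a bound on extended integrals.\<close>
  have sq: "integrable P (\<lambda>w. (loading k p w)\<^sup>2)" if p: "p \<in> I" for p
  proof -
    obtain B where B: "AE w in P. \<bar>mc_weight S E p w * f (T p w)\<bar> \<le> B"
        using weighted_bounded[OF p f] .
    note [measurable] = loading_measurable_P[OF k p]
    have "AE w in P. norm ((loading k p w)\<^sup>2) \<le> B\<^sup>2"
      using B by (elim AE_mp) (auto intro!: AE_I2 abs_le_square_iff[THEN iffD1] simp: loading_def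
          f_def simp del: abs_mult abs_divide)
    then show "integrable P (\<lambda>w. (loading k p w)\<^sup>2)"
      by (intro P.integrable_const_bound[where B = "B\<^sup>2"]) auto
  qed
  have fc: "continuous_on (time_dom S) (\<lambda>t. (f t)\<^sup>2)" "continuous_on (time_dom S) (\<lambda>t. (f t)\<^sup>2 *
      dens S t)"
    by (intro continuous_intros f dens_continuous)+
  have "integrable (design_law S) ?h"
    by (intro integral_design_law borel_measurable_time_measure fc integrable_time_measure)
  then have "(\<integral>w. (\<Sum>p\<in>I. (mc_weight S E p w)\<^sup>2 * ?h (T p w)) \<partial>P)
    \<le> \<kappa> / real M * (LINT t:time_dom S|lborel. ?h t * dens S t)"
    using smb unfolding second_moment_bound_def by auto
  also have "(LINT t:time_dom S|lborel. ?h t * dens S t) = (\<integral>t. (f t)\<^sup>2 * dens S t \<partial>time_measure S)"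
    unfolding time_measure_def set_lebesgue_integral_def
    by (subst integral_restrict_space) (auto intro!: Bochner_Integration.integral_cong simp:
        indicator_def)
  also have "\<dots> \<le> (\<integral>t. (\<phi> k t * \<phi> k t) / dens_min S \<partial>time_measure S)"
  proof (rule integral_mono)
    show "integrable (time_measure S) (\<lambda>t. (f t)\<^sup>2 * dens S t)"
      by (intro integrable_time_measure fc)
    show "integrable (time_measure S) (\<lambda>t. (\<phi> k t * \<phi> k t) / dens_min S)"
      using dens_min_pos by (intro integrable_time_measure continuous_intros basis_continuous[OF
          k]) auto
    fix t assume "t \<in> space (time_measure S)"
    then have t: "0 < dens S t" "dens_min S \<le> dens S t" using dens_pos dens_min_le by auto
    \<comment> \<open>The squared quotient has two powers of the density below and the design law
      contributes one above. The remaining one is bounded by its minimum, and orthonormality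
      finishes.\<close>
    have "(f t)\<^sup>2 * dens S t = (\<phi> k t * \<phi> k t) / dens S t" using t
        by (simp add: f_def power2_eq_square)
    also have "\<dots> \<le> (\<phi> k t * \<phi> k t) / dens_min S" using t dens_min_pos
        by (intro divide_left_mono) auto
    finally show "(f t)\<^sup>2 * dens S t \<le> (\<phi> k t * \<phi> k t) / dens_min S" .
  qed
  also have "\<dots> = 1 / dens_min S" using onb k by (simp add: orthonormal_basis_def)
  finally have le: "(\<integral>w. (\<Sum>p\<in>I. (mc_weight S E p w)\<^sup>2 * ?h (T p w)) \<partial>P) \<le>
      \<kappa> / real M * (1 / dens_min S)"
    using \<kappa>_pos by (simp add: mult_left_mono divide_right_mono)
  have "(\<Sum>p\<in>I. \<integral>\<^sup>+w. ennreal ((loading k p w)\<^sup>2) \<partial>P) = (\<Sum>p\<in>I. ennreal (\<integral>w. (loading k p w)\<^sup>2 \<partial>P))"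
    by (intro sum.cong refl nn_integral_eq_integral sq) auto
  also have "\<dots> = ennreal (\<integral>w. (\<Sum>p\<in>I. (loading k p w)\<^sup>2) \<partial>P)"
    using sq by (simp add: Bochner_Integration.integral_sum sum_ennreal)
  also have "(\<integral>w. (\<Sum>p\<in>I. (loading k p w)\<^sup>2) \<partial>P) =
      (\<integral>w. (\<Sum>p\<in>I. (mc_weight S E p w)\<^sup>2 * ?h (T p w)) \<partial>P)"
    by (intro Bochner_Integration.integral_cong sum.cong refl)
       (auto simp: visit_time_in loading_def f_def power_mult_distrib power_divide)
  also have "ennreal \<dots> \<le> ennreal (\<kappa> / (real M * dens_min S))" using le by (intro ennreal_leI) simp
  finally show ?thesis .
qed

section \<open>Field and noise energies integrated over the state space\<close>

lemma state_time_measurable: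
  assumes p: "p \<in> I"
  shows "(\<lambda>(w, u). X (fst p) w u (T p w)) \<in> borel_measurable (P \<Otimes>\<^sub>M state_measure S)"
    and "(\<lambda>(w, u). \<eta> p w u) \<in> borel_measurable (P \<Otimes>\<^sub>M state_measure S)"
    and "(\<lambda>(w, u). mean_fun S u (T p w)) \<in> borel_measurable (P \<Otimes>\<^sub>M state_measure S)"
proof -
  note T = measurable_compose[OF measurable_fst visit_time_measurable_sub[OF subalgebra_design p]]
  show "(\<lambda>(w, u). X (fst p) w u (T p w)) \<in> borel_measurable (P \<Otimes>\<^sub>M state_measure S)"
    unfolding split_beta
    by (rule field_eval_measurable[OF measurable_compose[OF measurable_fst
        field_path_measurable[OF fst_index[OF p]]] measurable_snd T])
  show "(\<lambda>(w, u). \<eta> p w u) \<in> borel_measurable (P \<Otimes>\<^sub>M state_measure S)"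
    unfolding split_beta
    by (rule noise_eval_measurable[OF measurable_compose[OF measurable_fst
        noise_path_measurable[OF p]] measurable_snd])
  show "(\<lambda>(w, u). mean_fun S u (T p w)) \<in> borel_measurable (P \<Otimes>\<^sub>M state_measure S)"
    unfolding split_beta by (rule mean_eval_measurable[OF measurable_snd T])
qed

lemma coef_hat_measurable:
  assumes k: "1 \<le> k"
  shows "(\<lambda>(w, u). coef_hat S E \<phi> k w u) \<in> borel_measurable (P \<Otimes>\<^sub>M state_measure S)"
proof -
  have "(\<lambda>z. loading k p (fst z) * (mean_fun S (snd z) (T p (fst z)) +
      X (fst p) (fst z) (snd z) (T p (fst z))
      + noise_scale S (T p (fst z)) * \<eta> p (fst z) (snd z)))
    \<in> borel_measurable (P \<Otimes>\<^sub>M state_measure S)" if p: "p \<in> I" for p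
    using state_time_measurable[OF p, unfolded split_beta]
      measurable_compose[OF measurable_fst loading_measurable_P[OF k p]]
      measurable_compose[OF measurable_compose[OF measurable_fst visit_time_measurable_sub[OF
          subalgebra_design p]] scale_measurable]
    by (intro borel_measurable_times borel_measurable_add)
  moreover have "(\<lambda>(w, u). coef_hat S E \<phi> k w u) = (\<lambda>z. \<Sum>p\<in>I. loading k p (fst z) *
      (mean_fun S (snd z) (T p (fst z)) + X (fst p) (fst z) (snd z) (T p (fst z))
      + noise_scale S (T p (fst z)) * \<eta> p (fst z) (snd z)))"
    by (auto simp: coef_hat_def response_def loading_def Let_def fun_eq_iff split_beta intro!:
        sum.cong)
  ultimately show ?thesis by simp
qed

sublocale PU: pair_sigma_finite P "state_measure S" ..

text \<open>Cauchy-Schwarz over the visits of one subject; the number of visits is bounded by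
  \<open>m_max\<close>.\<close>

lemma field_part_pointwise:
  assumes k: "1 \<le> k" and i: "i \<in> {1..n}"
  shows "(\<integral>\<^sup>+w. ennreal ((field_part k u i w (X i w))\<^sup>2) \<partial>P) \<le>
    ennreal (real m_max) * (\<Sum>j=1..visits E i. \<integral>\<^sup>+w. ennreal ((loading k (i, j) w * X i w u (T (i,
        j) w))\<^sup>2) \<partial>P)"
proof -
  have p: "(i, j) \<in> I" if "j \<in> {1..visits E i}" for j using that i by (auto simp: index_set_def)
  have m: "(\<lambda>w. loading k (i, j) w * X i w u (T (i, j) w)) \<in> borel_measurable P" if "j \<in>
      {1..visits E i}" for j
    by (intro borel_measurable_times loading_measurable_P k p that
        field_eval_measurable[OF field_path_measurable[OF i] measurable_const
            visit_time_measurable_sub[OF subalgebra_design p[OF that]]]) simp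
  have "(field_part k u i w (X i w))\<^sup>2 \<le> real m_max * (\<Sum>j=1..visits E i. (loading k (i, j) w * X i
      w u (T (i, j) w))\<^sup>2)" for w
  proof -
    have "(field_part k u i w (X i w))\<^sup>2 \<le> (\<Sum>j=1..visits E i. (loading k (i, j) w * X i w u (T (i,
        j) w))\<^sup>2) * real (visits E i)"
      unfolding field_part_def
      using sum_squared_le_sum_of_squares[of "\<lambda>j. loading k (i, j) w * X i w u (T (i, j) w)"
          "{1..visits E i}"] by simp
    also have "\<dots> \<le> (\<Sum>j=1..visits E i. (loading k (i, j) w * X i w u (T (i, j) w))\<^sup>2) * real m_max"
      using visits_le[OF i] by (intro mult_left_mono sum_nonneg) auto
    finally show ?thesis by (simp add: mult.commute)
  qed
  then have "(\<integral>\<^sup>+w. ennreal ((field_part k u i w (X i w))\<^sup>2) \<partial>P) \<le>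
    (\<integral>\<^sup>+w. ennreal (real m_max) * (\<Sum>j=1..visits E i. ennreal ((loading k (i, j) w * X i w u (T (i,
        j) w))\<^sup>2)) \<partial>P)"
    by (intro nn_integral_mono) (simp add: ennreal_mult[symmetric] sum_nonneg ennreal_leI)
  also have "\<dots> = ennreal (real m_max) * (\<Sum>j=1..visits E i. \<integral>\<^sup>+w. ennreal ((loading k (i, j) w * X
      i w u (T (i, j) w))\<^sup>2) \<partial>P)"
  proof -
    have m': "(\<lambda>w. ennreal ((loading k (i, j) w * X i w u (T (i, j) w))\<^sup>2)) \<in> borel_measurable P"
      if "j \<in> {1..visits E i}" for j using m[OF that] by measurable
    have s: "(\<lambda>w. \<Sum>j=1..visits E i. ennreal ((loading k (i, j) w * X i w u (T (i, j) w))\<^sup>2)) \<in>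
        borel_measurable P"
      by (intro borel_measurable_sum m')
    show ?thesis by (simp only: nn_integral_cmult[OF s] nn_integral_sum[OF m'])
  qed
  finally show ?thesis .
qed

text \<open>The state integral is moved inside first, because only the energy integrated over states
  is bounded. Freezing the design then leaves the mean energy of a fresh path at the visit
  time.\<close>

lemma field_loading_second_moment:
  assumes k: "1 \<le> k" and p: "p \<in> I"
  shows "(\<integral>\<^sup>+u. (\<integral>\<^sup>+w. ennreal ((loading k p w * X (fst p) w u (T p w))\<^sup>2) \<partial>P) \<partial>state_measure S)
    \<le> ennreal (sup_norm (time_dom S \<times> time_dom S) (\<lambda>(t, t'). Gamma_X S t t')) *
      (\<integral>\<^sup>+w. ennreal ((loading k p w)\<^sup>2) \<partial>P)"
proof -
  let ?c = "ennreal (sup_norm (time_dom S \<times> time_dom S) (\<lambda>(t, t'). Gamma_X S t t'))"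
  note TG = visit_time_measurable_design[OF p]
  have GG: "subalgebra G G" by (simp add: subalgebra_def)
  note LG = loading_measurable[OF GG k p]
  note ind = draw_field[OF fst_index[OF p]]
  have m1: "(\<lambda>z. (loading k p (fst z) * X (fst p) (fst z) (snd z) (T p (fst z)))\<^sup>2) \<in>
      borel_measurable (P \<Otimes>\<^sub>M state_measure S)"
    using state_time_measurable(1)[OF p] measurable_compose[OF measurable_fst
        loading_measurable_P[OF k p]]
    unfolding split_beta by (intro borel_measurable_power borel_measurable_times)
  have m2: "(\<lambda>z. (snd (fst z) (snd z) (T p (fst (fst z))))\<^sup>2) \<in>
      borel_measurable ((G \<Otimes>\<^sub>M field_law S) \<Otimes>\<^sub>M state_measure S)"
    by (intro borel_measurable_power field_eval_measurable[OF measurable_compose[OF measurable_fst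
        measurable_snd] measurable_snd
        measurable_compose[OF measurable_compose[OF measurable_fst measurable_fst] TG]])
  have m3: "(\<lambda>z. \<integral>\<^sup>+u. ennreal ((snd z u (T p (fst z)))\<^sup>2) \<partial>state_measure S) \<in>
      borel_measurable (G \<Otimes>\<^sub>M field_law S)"
    by (rule state.borel_measurable_nn_integral) (use m2 in \<open>simp add: split_beta\<close>)
  have m4: "(\<lambda>z. ennreal ((loading k p (fst z))\<^sup>2) * (\<integral>\<^sup>+u. ennreal ((snd z u (T p (fst z)))\<^sup>2)
      \<partial>state_measure S))
      \<in> borel_measurable (G \<Otimes>\<^sub>M field_law S)"
    using m3 measurable_compose[OF measurable_fst LG]
    by (intro borel_measurable_times_ennreal measurable_compose[OF _ measurable_ennreal]
        borel_measurable_power)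
  have m5: "(\<lambda>u. ennreal ((X (fst p) w u (T p w))\<^sup>2)) \<in> borel_measurable (state_measure S)" if "w
      \<in> space P" for w
    using measurable_compose[OF measurable_Pair1'[OF that] state_time_measurable(1)[OF p]] by simp
  have m6: "(\<lambda>x. \<integral>\<^sup>+u. ennreal ((x u (T p w))\<^sup>2) \<partial>state_measure S) \<in>
      borel_measurable (field_law S)" if "w \<in> space P" for w
    using measurable_compose[OF measurable_Pair1' m3, of w] that by simp
  have "(\<integral>\<^sup>+u. (\<integral>\<^sup>+w. ennreal ((loading k p w * X (fst p) w u (T p w))\<^sup>2) \<partial>P) \<partial>state_measure S) =
    (\<integral>\<^sup>+w. (\<integral>\<^sup>+u. ennreal ((loading k p w * X (fst p) w u (T p w))\<^sup>2) \<partial>state_measure S) \<partial>P)"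
    using m1 by (intro PU.Fubini'[of "\<lambda>w u. ennreal ((loading k p w * X (fst p) w u (T p w))\<^sup>2)"])
        (simp add: split_beta)
  also have "\<dots> = (\<integral>\<^sup>+w. ennreal ((loading k p w)\<^sup>2) * (\<integral>\<^sup>+u. ennreal ((X (fst p) w u (T p w))\<^sup>2)
      \<partial>state_measure S) \<partial>P)"
    using m5 by (intro nn_integral_cong) (simp add: power_mult_distrib ennreal_mult
        nn_integral_cmult)
  also have "\<dots> = (\<integral>\<^sup>+w. (\<integral>\<^sup>+x. ennreal ((loading k p w)\<^sup>2) * (\<integral>\<^sup>+u. ennreal ((x u (T p w))\<^sup>2)
      \<partial>state_measure S) \<partial>field_law S) \<partial>P)"
    using nn_integral_independent_draw[OF ind m4] by simp
  also have "\<dots> = (\<integral>\<^sup>+w. ennreal ((loading k p w)\<^sup>2) * (\<integral>\<^sup>+x. (\<integral>\<^sup>+u. ennreal ((x u (T p w))\<^sup>2)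
      \<partial>state_measure S) \<partial>field_law S) \<partial>P)"
    using m6 by (intro nn_integral_cong nn_integral_cmult)
  also have "\<dots> \<le> (\<integral>\<^sup>+w. ?c * ennreal ((loading k p w)\<^sup>2) \<partial>P)"
    using AE_visit_time[OF p field_second_moment_le]
    by (intro nn_integral_mono_AE) (elim AE_mp, auto intro!: AE_I2 mult_right_mono simp:
        mult.commute[of "ennreal ((loading _ _ _)\<^sup>2)"])
  also have "\<dots> = ?c * (\<integral>\<^sup>+w. ennreal ((loading k p w)\<^sup>2) \<partial>P)"
    using loading_measurable_P[OF k p] by (intro nn_integral_cmult) simp
  finally show ?thesis .
qed

text \<open>The noise has unit variance at every state, so this bound holds for each
  \<open>u\<close>; integrating it later produces the total mass of the state space.\<close>

lemma noise_part_second_moment: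
  assumes k: "1 \<le> k" and p: "p \<in> I"
  shows "(\<integral>\<^sup>+w. ennreal ((noise_part k u p w (\<eta> p w))\<^sup>2) \<partial>P)
    \<le> ennreal ((sup_norm (time_dom S) (noise_scale S))\<^sup>2) * (\<integral>\<^sup>+w. ennreal ((loading k p w)\<^sup>2) \<partial>P)"
proof -
  let ?c = "ennreal ((sup_norm (time_dom S) (noise_scale S))\<^sup>2)"
  have GG: "subalgebra G G" by (simp add: subalgebra_def)
  have e: "integrable (noise_law S) (\<lambda>e. (e u)\<^sup>2)" "(\<integral>e. (e u)\<^sup>2 \<partial>noise_law S) = 1"
  proof -
    have "integrable (noise_law S) (\<lambda>e. (e u)\<^sup>2)" "(\<integral>e. e u \<partial>noise_law S) = 0"
      "noise.variance (\<lambda>e. e u) = 1"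
      using pop unfolding population_def by blast+
    then show "integrable (noise_law S) (\<lambda>e. (e u)\<^sup>2)" "(\<integral>e. (e u)\<^sup>2 \<partial>noise_law S) = 1"
      by simp_all
  qed
  have "(\<integral>\<^sup>+w. ennreal ((noise_part k u p w (\<eta> p w))\<^sup>2) \<partial>P) =
    (\<integral>\<^sup>+w. (\<integral>\<^sup>+e. ennreal ((noise_part k u p w e)\<^sup>2) \<partial>noise_law S) \<partial>P)"
    using nn_integral_independent_draw[OF draw_noise[OF p], of "\<lambda>z. ennreal ((noise_part k u p
        (fst z) (snd z))\<^sup>2)"]
      noise_part_measurable[OF GG k p] by (simp add: split_beta)
  also have "\<dots> = (\<integral>\<^sup>+w. ennreal ((loading k p w * noise_scale S (T p w))\<^sup>2) \<partial>P)"
  proof (rule nn_integral_cong)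
    fix w
    have "(\<integral>\<^sup>+e. ennreal ((noise_part k u p w e)\<^sup>2) \<partial>noise_law S) =
      (\<integral>\<^sup>+e. ennreal ((loading k p w * noise_scale S (T p w))\<^sup>2) * ennreal ((e u)\<^sup>2) \<partial>noise_law S)"
      by (simp add: noise_part_def power_mult_distrib ennreal_mult)
    also have "\<dots> = ennreal ((loading k p w * noise_scale S (T p w))\<^sup>2) * ennreal (\<integral>e. (e u)\<^sup>2
        \<partial>noise_law S)"
      using e(1) by (subst nn_integral_cmult) (auto simp: nn_integral_eq_integral)
    finally show "(\<integral>\<^sup>+e. ennreal ((noise_part k u p w e)\<^sup>2) \<partial>noise_law S) =
      ennreal ((loading k p w * noise_scale S (T p w))\<^sup>2)" unfolding e(2) by simp
  qed
  also have "\<dots> \<le> (\<integral>\<^sup>+w. ?c * ennreal ((loading k p w)\<^sup>2) \<partial>P)"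
    using scale_le_sup_norm[OF visit_time_in[OF p]]
    by (intro nn_integral_mono) (auto simp: ennreal_mult[symmetric] power_mult_distrib
        mult.commute[of "(loading _ _ _)\<^sup>2"] intro!: ennreal_leI mult_right_mono)
  also have "\<dots> = ?c * (\<integral>\<^sup>+w. ennreal ((loading k p w)\<^sup>2) \<partial>P)"
    using loading_measurable_P[OF k p] by (intro nn_integral_cmult) simp
  finally show ?thesis .
qed

section \<open>The risk bound\<close>

text \<open>The three contributions are bounded at each state and then integrated. The field
  contribution stays as a sum of \<open>A p u\<close>, because it has a usable bound only after
  integration over \<open>u\<close>.\<close>

lemma coef_risk_le:
  assumes k: "1 \<le> k"
    and var: "variance_bound S E \<phi> \<alpha> V1 V2" and growth: "polynomial_growth S V1 V2 q Cbar"
  shows "(\<integral>\<^sup>+u. (\<integral>\<^sup>+w. ennreal ((coef_hat S E \<phi> k w u - coef S \<phi> k u)\<^sup>2) \<partial>P) \<partial>state_measure S)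
    \<le> ennreal (Cbar * real M powr (- 1 - 2 * \<alpha>) + Cbar * real k powr (2 * q) * real M powr (- 3) +
        C1_MC S \<kappa> m_max / real M)"
proof -
  let ?a = "real M powr (- 1 - 2 * \<alpha>)" and ?b = "real M powr (- 3)"
  define \<Gamma> where "\<Gamma> = sup_norm (time_dom S \<times> time_dom S) (\<lambda>(t, t'). Gamma_X S t t')"
  define \<tau>2 where "\<tau>2 = (sup_norm (time_dom S) (noise_scale S))\<^sup>2"
  define A where "A p u = (\<integral>\<^sup>+w. ennreal ((loading k p w * X (fst p) w u (T p w))\<^sup>2) \<partial>P)" for p u
  define l where "l p = (\<integral>\<^sup>+w. ennreal ((loading k p w)\<^sup>2) \<partial>P)" for p
  \<comment> \<open>The total second moment of the loadings. Multiplied by \<open>m_max\<close>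
    times the covariance bound plus the noise bound times the state mass, it equals
    \<open>C1_MC S \<kappa> m_max / real M\<close>.\<close>
  define \<rho> where "\<rho> = \<kappa> / (real M * dens_min S)"
  have l: "(\<Sum>p\<in>I. l p) \<le> ennreal \<rho>"
    using loading_second_moment[OF k] by (simp add: l_def \<rho>_def)
  have nonneg: "0 \<le> \<Gamma>" "0 \<le> \<tau>2" "0 \<le> \<rho>"
    using sup_norm_Gamma_nonneg \<kappa>_pos dens_min_pos by (auto simp: \<Gamma>_def \<tau>2_def \<rho>_def)
  have C: "0 \<le> Cbar" and [measurable]: "V1 \<in> borel_measurable (state_measure S)"
    and [measurable]: "(\<lambda>u. V2 u k) \<in> borel_measurable (state_measure S)"
    and V1: "(\<integral>\<^sup>+u. ennreal ((V1 u)\<^sup>2) \<partial>state_measure S) \<le> ennreal Cbar"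
    and V2: "(\<integral>\<^sup>+u. ennreal ((V2 u k)\<^sup>2) \<partial>state_measure S) \<le> ennreal (Cbar * real k powr (2 * q))"
    using growth k by (auto simp: polynomial_growth_def)
  have Am[measurable]: "A p \<in> borel_measurable (state_measure S)" if p: "p \<in> I" for p
  proof -
    have "(\<lambda>z. (loading k p (snd z) * X (fst p) (snd z) (fst z) (T p (snd z)))\<^sup>2) \<in>
        borel_measurable (state_measure S \<Otimes>\<^sub>M P)"
      using measurable_compose[OF measurable_pair_swap' state_time_measurable(1)[OF p]]
        measurable_compose[OF measurable_snd loading_measurable_P[OF k p]]
      by (intro borel_measurable_power borel_measurable_times) (auto simp: split_beta)
    then show ?thesis unfolding A_def[abs_def]
      by (intro P.borel_measurable_nn_integral) (simp add: split_beta)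
  qed
  have bound: "(\<integral>\<^sup>+w. ennreal ((coef_hat S E \<phi> k w u - coef S \<phi> k u)\<^sup>2) \<partial>P) \<le>
    ennreal ?a * ennreal ((V1 u)\<^sup>2) + ennreal ?b * ennreal ((V2 u k)\<^sup>2) +
      ennreal (real m_max) * (\<Sum>p\<in>I. A p u) + ennreal \<tau>2 * (\<Sum>p\<in>I. l p)" for u
  proof -
    have "P.variance (noiseless_coef S E \<phi> k u) \<le> ?a * (V1 u)\<^sup>2 + ?b * (V2 u k)\<^sup>2"
      using var k by (simp add: variance_bound_def mult.commute)
    then have 1: "(\<integral>\<^sup>+w. ennreal ((noiseless_coef S E \<phi> k u w - coef S \<phi> k u)\<^sup>2) \<partial>P) \<le>
        ennreal ?a * ennreal ((V1 u)\<^sup>2) + ennreal ?b * ennreal ((V2 u k)\<^sup>2)"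
      unfolding bias_variance_noiseless[OF k] by (simp add: ennreal_mult[symmetric]
          ennreal_plus[symmetric] del: ennreal_plus)
    have "(\<Sum>i=1..n. \<integral>\<^sup>+w. ennreal ((field_part k u i w (X i w))\<^sup>2) \<partial>P) \<le>
        (\<Sum>i=1..n. ennreal (real m_max) * (\<Sum>j=1..visits E i. A (i, j) u))"
      unfolding A_def fst_conv by (intro sum_mono field_part_pointwise[OF k])
    also have "\<dots> = ennreal (real m_max) * (\<Sum>p\<in>I. A p u)"
      unfolding index_set_def sum_distrib_left[symmetric] by (subst sum.Sigma) auto
    finally have 2: "(\<Sum>i=1..n. \<integral>\<^sup>+w. ennreal ((field_part k u i w (X i w))\<^sup>2) \<partial>P) \<le>
        ennreal (real m_max) * (\<Sum>p\<in>I. A p u)" .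
    have 3: "(\<Sum>p\<in>I. \<integral>\<^sup>+w. ennreal ((noise_part k u p w (\<eta> p w))\<^sup>2) \<partial>P) \<le> ennreal \<tau>2 * (\<Sum>p\<in>I. l p)"
      unfolding sum_distrib_left l_def \<tau>2_def by (intro sum_mono noise_part_second_moment[OF k])
    show ?thesis
      by (rule order_trans[OF coef_hat_second_moment[OF k]]) (intro add_mono 1 2 3)
  qed
  have "(\<integral>\<^sup>+u. (\<integral>\<^sup>+w. ennreal ((coef_hat S E \<phi> k w u - coef S \<phi> k u)\<^sup>2) \<partial>P) \<partial>state_measure S) \<le>
    (\<integral>\<^sup>+u. ennreal ?a * ennreal ((V1 u)\<^sup>2) + ennreal ?b * ennreal ((V2 u k)\<^sup>2) +
      ennreal (real m_max) * (\<Sum>p\<in>I. A p u) + ennreal \<tau>2 * (\<Sum>p\<in>I. l p) \<partial>state_measure S)"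
    by (intro nn_integral_mono bound)
  also have "\<dots> = ennreal ?a * (\<integral>\<^sup>+u. ennreal ((V1 u)\<^sup>2) \<partial>state_measure S) +
      ennreal ?b * (\<integral>\<^sup>+u. ennreal ((V2 u k)\<^sup>2) \<partial>state_measure S) +
      ennreal (real m_max) * (\<Sum>p\<in>I. \<integral>\<^sup>+u. A p u \<partial>state_measure S) +
      ennreal \<tau>2 * (\<Sum>p\<in>I. l p) * ennreal (measure (state_measure S) (space (state_measure S)))"
    using Am by (simp add: nn_integral_add nn_integral_cmult nn_integral_sum
        state.emeasure_eq_measure)
  also have "\<dots> \<le> ennreal ?a * ennreal Cbar + ennreal ?b * ennreal (Cbar * real k powr (2 * q)) +
      ennreal (real m_max) * (ennreal \<Gamma> * ennreal \<rho>) +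
      ennreal \<tau>2 * ennreal \<rho> * ennreal (measure (state_measure S) (space (state_measure S)))"
  proof (intro add_mono mult_left_mono mult_right_mono V1 V2 l)
    have "(\<Sum>p\<in>I. \<integral>\<^sup>+u. A p u \<partial>state_measure S) \<le> (\<Sum>p\<in>I. ennreal \<Gamma> * l p)"
      unfolding A_def l_def \<Gamma>_def by (intro sum_mono field_loading_second_moment[OF k])
    also have "\<dots> \<le> ennreal \<Gamma> * ennreal \<rho>"
      unfolding sum_distrib_left[symmetric] by (intro mult_left_mono l) simp
    finally show "(\<Sum>p\<in>I. \<integral>\<^sup>+u. A p u \<partial>state_measure S) \<le> ennreal \<Gamma> * ennreal \<rho>" .
  qed simp_all
  also have "\<dots> = ennreal (?a * Cbar + ?b * (Cbar * real k powr (2 * q)) + real m_max * (\<Gamma> * \<rho>) +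
      \<tau>2 * \<rho> * measure (state_measure S) (space (state_measure S)))"
    using nonneg C by (simp add: ennreal_mult[symmetric] ennreal_plus[symmetric] del: ennreal_plus)
  also have "?a * Cbar + ?b * (Cbar * real k powr (2 * q)) + real m_max * (\<Gamma> * \<rho>) +
      \<tau>2 * \<rho> * measure (state_measure S) (space (state_measure S)) =
    Cbar * ?a + Cbar * real k powr (2 * q) * ?b + C1_MC S \<kappa> m_max / real M"
    unfolding C1_MC_def \<Gamma>_def[symmetric] \<tau>2_def[symmetric] \<rho>_def using dens_min_pos size
    by (simp add: field_simps)
  finally show ?thesis .
qed

text \<open>Parseval's identity is applied in time for each outcome and state. The omitted energy
  does not depend on the outcome and integrates to itself under a probability measure. For real
  \<open>K\<close> the retained indices are those up to the floor.\<close>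

lemma risk_decomposition:
  assumes K: "0 \<le> K"
  shows "risk S E \<phi> K =
    (\<Sum>k=1..nat \<lfloor>K\<rfloor>. \<integral>\<^sup>+u. (\<integral>\<^sup>+w. ennreal ((coef_hat S E \<phi> k w u - coef S \<phi> k u)\<^sup>2) \<partial>P)
        \<partial>state_measure S) +
    (\<integral>\<^sup>+u. (\<Sum>j. ennreal ((coef S \<phi> (Suc (nat \<lfloor>K\<rfloor> + j)) u)\<^sup>2)) \<partial>state_measure S)"
proof -
  define N where "N = nat \<lfloor>K\<rfloor>"
  define tl where "tl u = (\<Sum>j. ennreal ((coef S \<phi> (Suc (N + j)) u)\<^sup>2))" for u
  have [measurable]: "tl \<in> borel_measurable (state_measure S)"
    unfolding tl_def by measurable
  have set: "{k. 1 \<le> k \<and> real k \<le> K} = {1..N}"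
    using K by (auto simp: N_def le_nat_iff le_floor_iff)
  have mh: "mean_hat S E \<phi> K w u t = (\<Sum>k=1..N. coef_hat S E \<phi> k w u * \<phi> k t)" for w u t
    unfolding mean_hat_def set ..
  have cm: "(\<lambda>u. coef_hat S E \<phi> k w u) \<in> borel_measurable (state_measure S)" if "w \<in> space P" "k \<in>
      {1..N}" for w k
    using measurable_compose[OF measurable_Pair1'[OF that(1)] coef_hat_measurable[of k]] that(2)
        by simp
  have dm: "(\<lambda>z. ennreal ((coef_hat S E \<phi> k (fst z) (snd z) - coef S \<phi> k (snd z))\<^sup>2)) \<in>
      borel_measurable (P \<Otimes>\<^sub>M state_measure S)"
    if "k \<in> {1..N}" for k
  proof -
    have k: "1 \<le> k" using that by simp
    note [measurable] = coef_hat_measurable[OF k, unfolded split_beta] coef_measurable[OF k]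
    show ?thesis by measurable
  qed
  have dmw: "(\<lambda>u. ennreal ((coef_hat S E \<phi> k w u - coef S \<phi> k u)\<^sup>2)) \<in>
      borel_measurable (state_measure S)"
    if "w \<in> space P" "k \<in> {1..N}" for w k
    using measurable_compose[OF measurable_Pair1'[OF that(1)] dm[OF that(2)]] by simp
  have inner: "(\<integral>\<^sup>+(u, t). ennreal ((mean_hat S E \<phi> K w u t - mean_fun S u t)\<^sup>2)
      \<partial>state_time_measure S) =
    (\<Sum>k=1..N. \<integral>\<^sup>+u. ennreal ((coef_hat S E \<phi> k w u - coef S \<phi> k u)\<^sup>2) \<partial>state_measure S) +
        (\<integral>\<^sup>+u. tl u \<partial>state_measure S)"
    if w: "w \<in> space P" for w
  proof -
    have "(\<lambda>z. (\<Sum>k=1..N. coef_hat S E \<phi> k w (fst z) * \<phi> k (snd z)) - mean_fun S (fst z) (snd z)) \<in>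
      borel_measurable (state_measure S \<Otimes>\<^sub>M time_measure S)"
      by (intro borel_measurable_diff borel_measurable_sum borel_measurable_times
          mean_eval_measurable[OF measurable_fst measurable_snd]
          measurable_compose[OF measurable_fst cm[OF w]] measurable_compose[OF measurable_snd
              basis_measurable]) auto
    then have m: "(\<lambda>z. ennreal (((\<Sum>k=1..N. coef_hat S E \<phi> k w (fst z) * \<phi> k (snd z)) - mean_fun S
        (fst z) (snd z))\<^sup>2)) \<in>
      borel_measurable (state_measure S \<Otimes>\<^sub>M time_measure S)" by measurable
    have "(\<integral>\<^sup>+(u, t). ennreal ((mean_hat S E \<phi> K w u t - mean_fun S u t)\<^sup>2) \<partial>state_time_measure S) =
      (\<integral>\<^sup>+u. (\<integral>\<^sup>+t. ennreal (((\<Sum>k=1..N. coef_hat S E \<phi> k w u * \<phi> k t) - mean_fun S u t)\<^sup>2)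
          \<partial>time_measure S) \<partial>state_measure S)"
      unfolding mh state_time_measure_def using time.nn_integral_fst[OF m]
          by (simp add: split_beta')
    also have "\<dots> = (\<integral>\<^sup>+u. ((\<Sum>k=1..N. ennreal ((coef_hat S E \<phi> k w u - coef S \<phi> k u)\<^sup>2)) +
        tl u) \<partial>state_measure S)"
    proof (rule nn_integral_cong)
      fix u
      have sq: "integrable (time_measure S) (\<lambda>t. (mean_fun S u t)\<^sup>2)"
        by (intro integrable_time_measure continuous_intros mean_continuous)
      show "(\<integral>\<^sup>+t. ennreal (((\<Sum>k=1..N. coef_hat S E \<phi> k w u * \<phi> k t) - mean_fun S u t)\<^sup>2)
          \<partial>time_measure S) =
        (\<Sum>k=1..N. ennreal ((coef_hat S E \<phi> k w u - coef S \<phi> k u)\<^sup>2)) + tl u"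
        using Parseval_truncation[OF onb borel_measurable_time_measure[OF mean_continuous] sq,
            where N = N and c = "\<lambda>k. coef_hat S E \<phi> k w u"]
        unfolding tl_def coef_def by (simp add: sum_ennreal)
    qed
    also have "\<dots> = (\<Sum>k=1..N. \<integral>\<^sup>+u. ennreal ((coef_hat S E \<phi> k w u - coef S \<phi> k u)\<^sup>2)
        \<partial>state_measure S) + (\<integral>\<^sup>+u. tl u \<partial>state_measure S)"
      by (subst nn_integral_add[OF borel_measurable_sum[OF dmw[OF w]]], assumption, measurable)
         (subst nn_integral_sum[OF dmw[OF w]], auto)
    finally show ?thesis .
  qed
  have "risk S E \<phi> K = (\<integral>\<^sup>+w. ((\<Sum>k=1..N. \<integral>\<^sup>+u. ennreal ((coef_hat S E \<phi> k w u - coef S \<phi> k u)\<^sup>2)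
      \<partial>state_measure S) + (\<integral>\<^sup>+u. tl u \<partial>state_measure S)) \<partial>P)"
    unfolding risk_def by (intro nn_integral_cong inner)
  also have "\<dots> = (\<Sum>k=1..N. \<integral>\<^sup>+w. (\<integral>\<^sup>+u. ennreal ((coef_hat S E \<phi> k w u - coef S \<phi> k u)\<^sup>2)
      \<partial>state_measure S) \<partial>P) + (\<integral>\<^sup>+u. tl u \<partial>state_measure S)"
  proof -
    have im: "(\<lambda>w. \<integral>\<^sup>+u. ennreal ((coef_hat S E \<phi> k w u - coef S \<phi> k u)\<^sup>2) \<partial>state_measure S) \<in>
        borel_measurable P"
      if "k \<in> {1..N}" for k
      using dm[OF that] by (intro state.borel_measurable_nn_integral) (simp add: split_beta')
    show ?thesis
      by (subst nn_integral_add[OF borel_measurable_sum[OF im]], assumption, simp)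
         (subst nn_integral_sum[OF im], auto simp: P.emeasure_space_1)
  qed
  \<comment> \<open>Tonelli's theorem puts the expectation inside, where the orthogonality bound at
    a fixed state applies.\<close>
  also have "(\<Sum>k=1..N. \<integral>\<^sup>+w. (\<integral>\<^sup>+u. ennreal ((coef_hat S E \<phi> k w u - coef S \<phi> k u)\<^sup>2)
      \<partial>state_measure S) \<partial>P) =
    (\<Sum>k=1..N. \<integral>\<^sup>+u. (\<integral>\<^sup>+w. ennreal ((coef_hat S E \<phi> k w u - coef S \<phi> k u)\<^sup>2) \<partial>P) \<partial>state_measure S)"
    using PU.Fubini[OF dm] by (intro sum.cong refl) simp
  finally show ?thesis unfolding tl_def N_def .
qed

text \<open>The free parameter \<open>x\<close> lets the bias be evaluated at a level above the truncation level: the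
  first omitted coefficient has index \<open>\<lfloor>K\<rfloor> + 1\<close>, and this exceeds \<open>K\<close>.\<close>

lemma risk_le:
  assumes K: "0 \<le> K" and x: "0 < x" "x \<le> of_int \<lfloor>K\<rfloor> + 1"
    and decay: "coef_decay S \<phi> s Cs"
    and var: "variance_bound S E \<phi> \<alpha> V1 V2" and growth: "polynomial_growth S V1 V2 q Cbar"
  shows "risk S E \<phi> K \<le> ennreal (Cs * x powr (- 2 * s) + C1_MC S \<kappa> m_max * (K / real M) +
    Cbar * (K / real M powr (1 + 2 * \<alpha>) + K powr (1 + 2 * q) / real M ^ 3))"
proof -
  define N where "N = nat \<lfloor>K\<rfloor>"
  define C1 where "C1 = C1_MC S \<kappa> m_max"
  have N: "real N \<le> K" "x \<le> real (Suc N)" using K x by (auto simp: N_def)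
  have C: "0 \<le> Cbar" "0 \<le> q" using growth by (auto simp: polynomial_growth_def)
  have Cs: "0 < Cs" using decay by (simp add: coef_decay_def)
  have C1: "0 \<le> C1" using C1_MC_nonneg[OF \<kappa>_pos] by (simp add: C1_def)
  have M: "0 < real M" using size by simp
  let ?a = "real M powr (- 1 - 2 * \<alpha>)" and ?b = "real M powr (- 3)"
  have a: "?a = 1 / real M powr (1 + 2 * \<alpha>)"
    using powr_minus_divide[of "real M" "1 + 2 * \<alpha>"] by (simp add: algebra_simps)
  have b: "?b = 1 / real M ^ 3"
    using powr_minus_divide[of "real M" 3] M by (simp add: powr_numeral)
  have "risk S E \<phi> K \<le> (\<Sum>k=1..N. ennreal (Cbar * ?a + Cbar * real k powr (2 * q) * ?b +
      C1 / real M)) +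
      ennreal (Cs * x powr (- 2 * s))"
    unfolding risk_decomposition[OF K] N_def[symmetric] C1_def
    by (intro add_mono sum_mono coef_risk_le[OF _ var growth] coef_tail_le[OF decay] x N) auto
  \<comment> \<open>As \<open>q\<close> is nonnegative and \<open>k\<close> is at most
    \<open>K\<close>, every growth factor is replaced by its value at \<open>K\<close>; the sum
    becomes \<open>N\<close> equal terms, with \<open>N\<close> at most \<open>K\<close>.\<close>
  also have "(\<Sum>k=1..N. ennreal (Cbar * ?a + Cbar * real k powr (2 * q) * ?b + C1 / real M)) \<le>
      (\<Sum>k=1..N. ennreal (Cbar * ?a + Cbar * K powr (2 * q) * ?b + C1 / real M))"
    using C N by (intro sum_mono ennreal_leI add_mono mult_right_mono mult_left_mono powr_mono2)
        auto
  also have "\<dots> = ennreal (real N * (Cbar * ?a + Cbar * K powr (2 * q) * ?b + C1 / real M))"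
    using C C1 by (subst sum_ennreal) auto
  also have "\<dots> \<le> ennreal (K * (Cbar * ?a + Cbar * K powr (2 * q) * ?b + C1 / real M))"
    using N C C1 by (intro ennreal_leI mult_right_mono) auto
  also have "K * (Cbar * ?a + Cbar * K powr (2 * q) * ?b + C1 / real M) =
      C1 * (K / real M) + Cbar * (K / real M powr (1 + 2 * \<alpha>) + K powr (1 + 2 * q) / real M ^ 3)"
  proof -
    \<comment> \<open>The level 0 is allowed because rounding can produce it; both sides then
      vanish.\<close>
    have "K * K powr (2 * q) = K powr (1 + 2 * q)" using K by (cases "K = 0") (auto simp: powr_add)
    then show ?thesis unfolding a b by (simp add: algebra_simps)
  qed
  finally have "risk S E \<phi> K \<le> ennreal (C1 * (K / real M) + Cbar * (K / real M powr (1 + 2 * \<alpha>) +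
      K powr (1 + 2 * q) / real M ^ 3)) +
      ennreal (Cs * x powr (- 2 * s))" by (simp add: add_right_mono)
  then show ?thesis
    using C1 C K Cs unfolding C1_def[symmetric]
    by (simp add: ennreal_plus[symmetric] add_ac del: ennreal_plus)
qed

end

section \<open>The optimal truncation level\<close>

text \<open>The level \<open>K0\<close> solves the first-order condition. There the decreasing term
  is \<open>1 / (2 * s)\<close> times the linear one, hence the factor
  \<open>(2 * s + 1) / (2 * s)\<close> in the minimum.\<close>

lemma power_tradeoff:
  fixes s A D :: real
  assumes s: "0 < s" and A: "0 < A" and D: "0 < D"
  defines "K0 \<equiv> (2 * s * A / D) powr (1 / (2 * s + 1))"
  shows "0 < K \<Longrightarrow> A * K0 powr (- 2 * s) + D * K0 \<le> A * K powr (- 2 * s) + D * K"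
    and "A * K0 powr (- 2 * s) + D * K0 = (2 * s +
        1) / (2 * s) * (2 * s * A * D powr (2 * s)) powr (1 / (2 * s + 1))"
proof -
  have K0: "0 < K0" unfolding K0_def using assms by simp
  have "K0 powr (2 * s + 1) = 2 * s * A / D" using s A D by (simp add: K0_def powr_powr)
  then have "K0 powr (2 * s) * K0 = 2 * s * A / D" using K0 by (simp add: powr_add)
  then have AK0: "A * K0 powr (- 2 * s) = D * K0 / (2 * s)"
    using s D K0 by (simp add: powr_minus field_simps)
  show "A * K0 powr (- 2 * s) + D * K0 \<le> A * K powr (- 2 * s) + D * K" if K: "0 < K"
  proof -
    define r where "r = K / K0"
    have r: "0 < r" "K = K0 * r" using K K0 by (auto simp: r_def)
    have "- (2 * s * ln r) \<ge> - (2 * s * (r - 1))"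
      using ln_le_minus_one[OF r(1)] s by simp
    then have "1 - 2 * s * (r - 1) \<le> 1 + (- 2 * s) * ln r" by simp
    also have "\<dots> \<le> r powr (- 2 * s)" using r exp_ge_add_one_self[of "(- 2 * s) * ln r"]
        by (simp add: powr_def)
    finally have le: "1 - 2 * s * (r - 1) \<le> r powr (- 2 * s)" .
    \<comment> \<open>\<open>W\<close> is the decreasing term at \<open>K0\<close>. In units of
      \<open>W\<close> the claim says that a power lies above its tangent at 1.\<close>
    define W where "W = D * K0 / (2 * s)"
    have W: "0 \<le> W" "D * K0 = 2 * s * W" using s D K0 by (simp_all add: W_def)
    have "A * K powr (- 2 * s) = W * r powr (- 2 * s)"
      unfolding r(2) W_def AK0[symmetric] using r K0 by (simp add: powr_mult)
    moreover have "D * K = 2 * s * W * r" unfolding r(2) W(2)[symmetric] by simp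
    moreover have "W * (1 - 2 * s * (r - 1)) \<le> W * r powr (- 2 * s)"
        by (rule mult_left_mono[OF le W(1)])
    ultimately show ?thesis unfolding AK0 W_def[symmetric] W(2) using W(1)
        by (simp add: algebra_simps)
  qed
  \<comment> \<open>Writing \<open>D\<close> as a root of its own power lets both factors merge
    under one root.\<close>
  have "D * K0 = (D powr (2 * s + 1)) powr (1 / (2 * s + 1)) * K0" using s D
      by (simp add: powr_powr)
  also have "\<dots> = (D powr (2 * s + 1) * (2 * s * A / D)) powr (1 / (2 * s + 1))"
    unfolding K0_def using s A D by (subst powr_mult) auto
  also have "D powr (2 * s + 1) * (2 * s * A / D) = 2 * s * A * D powr (2 * s)"
    using D by (simp add: powr_add field_simps)
  finally have DK0: "D * K0 = (2 * s * A * D powr (2 * s)) powr (1 / (2 * s + 1))" .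
  show "A * K0 powr (- 2 * s) + D * K0 = (2 * s +
      1) / (2 * s) * (2 * s * A * D powr (2 * s)) powr (1 / (2 * s + 1))"
    unfolding AK0 DK0[symmetric] using s by (simp add: field_simps)
qed

lemma C_total_bounds:
  assumes "0 \<le> C1" "0 < Cbar" "0 < \<alpha>" "1 \<le> M"
  shows "0 < C_total C1 Cbar \<alpha> M" "C1 \<le> C_total C1 Cbar \<alpha> M" "C_total C1 Cbar \<alpha> M \<le> C1 + Cbar"
proof -
  have "real M powr (- 2 * \<alpha>) \<le> real M powr 0" using assms by (intro powr_mono) auto
  then have "real M powr (- 2 * \<alpha>) \<le> 1" "0 < real M powr (- 2 * \<alpha>)" using assms by auto
  then show "0 < C_total C1 Cbar \<alpha> M" "C1 \<le> C_total C1 Cbar \<alpha> M" "C_total C1 Cbar \<alpha> M \<le> C1 + Cbar"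
    using assms by (auto simp: C_total_def add_nonneg_pos mult_left_le)
qed

text \<open>The two terms linear in \<open>K\<close> merge into one with coefficient
  \<open>C_total C1 Cbar \<alpha> M / real M\<close>, which reduces the three-term sum to
  \<open>power_tradeoff\<close>.\<close>

lemma C_total_divide:
  assumes "1 \<le> M"
  shows "C_total C1 Cbar \<alpha> M / real M * K = C1 * K / real M + Cbar * K / real M powr (1 + 2 * \<alpha>)"
proof -
  have "real M powr (1 + 2 * \<alpha>) = real M * real M powr (2 * \<alpha>)" using assms by (simp add: powr_add)
  then show ?thesis using assms by (simp add: C_total_def powr_minus field_simps)
qed

lemma K_star_tradeoff:
  fixes s Cs C :: real
  assumes s: "0 < s" and Cs: "0 < Cs" and C: "0 < C" and M: "1 \<le> M"
  defines "K0 \<equiv> K_star s Cs C M"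
  shows "0 < K0"
    and "0 < K \<Longrightarrow> Cs * K0 powr (- 2 * s) + C / real M * K0 \<le> Cs * K powr (- 2 * s) + C / real M * K"
    and "Cs * K0 powr (- 2 * s) + C / real M * K0 =
      (2 * s + 1) / (2 * s) * (2 * s * Cs * C powr (2 * s)) powr (1 / (2 * s + 1)) *
        real M powr (- (2 * s / (2 * s + 1)))"
    and "K0 powr (1 + 2 * q) / real M ^ 3 =
      (2 * s * Cs / C) powr ((1 + 2 * q) / (2 * s + 1)) * real M powr ((1 + 2 * q) / (2 * s +
          1) - 3)"
proof -
  have D: "0 < C / real M" using C M by simp
  have K0: "K0 = (2 * s * Cs / (C / real M)) powr (1 / (2 * s + 1))"
    by (simp add: K0_def K_star_def)
  show "0 < K0" using s Cs C M unfolding K0 by simp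
  show "0 < K \<Longrightarrow> Cs * K0 powr (- 2 * s) + C / real M * K0 \<le> Cs * K powr (- 2 * s) + C / real M * K"
    unfolding K0 by (rule power_tradeoff[OF s Cs D])
  have "(2 * s * Cs * (C / real M) powr (2 * s)) powr (1 / (2 * s + 1)) =
      (2 * s * Cs * C powr (2 * s) * real M powr (- (2 * s))) powr (1 / (2 * s + 1))"
    using C M by (simp add: powr_divide powr_minus_divide)
  also have "\<dots> = (2 * s * Cs * C powr (2 * s)) powr (1 / (2 * s +
      1)) * real M powr (- (2 * s / (2 * s + 1)))"
    using s Cs C M by (subst powr_mult) (auto simp: powr_powr)
  finally show "Cs * K0 powr (- 2 * s) + C / real M * K0 =
      (2 * s + 1) / (2 * s) * (2 * s * Cs * C powr (2 * s)) powr (1 / (2 * s + 1)) *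
        real M powr (- (2 * s / (2 * s + 1)))"
    unfolding K0 power_tradeoff(2)[OF s Cs D] by simp
  have "K0 powr (1 + 2 * q) = (2 * s * Cs / C * real M) powr ((1 + 2 * q) / (2 * s + 1))"
    unfolding K0 by (simp add: powr_powr)
  also have "\<dots> = (2 * s * Cs / C) powr ((1 + 2 * q) / (2 * s + 1)) * real M powr ((1 +
      2 * q) / (2 * s + 1))"
    using s Cs C M by (subst powr_mult) auto
  finally show "K0 powr (1 + 2 * q) / real M ^ 3 =
      (2 * s * Cs / C) powr ((1 + 2 * q) / (2 * s + 1)) * real M powr ((1 + 2 * q) / (2 * s +
          1) - 3)"
    using M by (simp add: powr_diff powr_numeral)
qed

text \<open>The power of \<open>M\<close> in the remainder divided by the main rate. Its sign is
  that of \<open>q - (2 * s + 1)\<close>, which is the origin of the threshold.\<close>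

lemma remainder_exponent:
  fixes s q :: real
  assumes "0 < s"
  shows "(1 + 2 * q) / (2 * s + 1) - 3 + 2 * s / (2 * s + 1) = 2 * (q - (2 * s + 1)) / (2 * s + 1)"
proof -
  have three: "3 * (2 * s + 1) / (2 * s + 1) = 3"
    using assms by (intro nonzero_mult_div_cancel_right) simp
  have "(1 + 2 * q) / (2 * s + 1) - 3 + 2 * s / (2 * s + 1) = (1 + 2 * q - 3 * (2 * s + 1) +
      2 * s) / (2 * s + 1)"
    unfolding add_divide_distrib diff_divide_distrib three by simp
  then show ?thesis by (simp add: algebra_simps)
qed

text \<open>As \<open>C1\<close> is positive, \<open>C_total\<close> tends to a positive limit and
  so does the prefactor; the ratio to the rate then behaves like the pure power in
  \<open>remainder_exponent\<close>.\<close>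

lemma remainder_smallo_iff:
  fixes s Cs q C1 Cbar \<alpha> :: real
  assumes s: "0 < s" and Cs: "0 < Cs" and C1: "0 < C1" and Cbar: "0 < Cbar" and \<alpha>: "0 < \<alpha>"
  shows "(\<lambda>M. Cbar * (2 * s * Cs / C_total C1 Cbar \<alpha> M) powr ((1 + 2 * q) / (2 * s + 1)) *
           real M powr ((1 + 2 * q) / (2 * s + 1) - 3)) \<in> o(\<lambda>M. real M powr (- (2 * s / (2 * s +
               1))))
    \<longleftrightarrow> q < 2 * s + 1"
proof -
  define e where "e = (1 + 2 * q) / (2 * s + 1)"
  define r where "r = 2 * s / (2 * s + 1)"
  define g where "g M = Cbar * (2 * s * Cs / C_total C1 Cbar \<alpha> M) powr e" for M
  have "(\<lambda>M. real M powr (- 2 * \<alpha>)) \<longlonglongrightarrow> 0"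
    using \<alpha> by (intro tendsto_neg_powr filterlim_real_sequentially) simp
  then have "C_total C1 Cbar \<alpha> \<longlonglongrightarrow> C1 + Cbar * 0"
    unfolding C_total_def[abs_def] by (intro tendsto_intros)
  then have g: "g \<longlonglongrightarrow> Cbar * (2 * s * Cs / C1) powr e"
    unfolding g_def using C1 s Cs by (intro tendsto_intros) auto
  have d: "e - 3 + r = 2 * (q - (2 * s + 1)) / (2 * s + 1)"
    unfolding e_def r_def by (rule remainder_exponent[OF s])
  have ratio: "\<forall>\<^sub>F M in sequentially. g M * real M powr (e - 3) / real M powr (- r) =
      g M * real M powr (e - 3 + r)"
    by (intro eventually_sequentiallyI[of 1]) (simp add: powr_add powr_diff powr_minus field_simps)
  have nz: "\<forall>\<^sub>F M in sequentially. real M powr (- r) \<noteq> 0"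
    by (intro eventually_sequentiallyI[of 1]) simp
  have "(\<lambda>M. g M * real M powr (e - 3)) \<in> o(\<lambda>M. real M powr (- r)) \<longleftrightarrow> q < 2 * s + 1"
  proof
    assume q: "q < 2 * s + 1"
    then have "e - 3 + r < 0" unfolding d using s by (simp add: divide_neg_pos)
    then have "(\<lambda>M. real M powr (e - 3 + r)) \<longlonglongrightarrow> 0"
      by (intro tendsto_neg_powr filterlim_real_sequentially)
    from tendsto_mult[OF g this] have "(\<lambda>M. g M * real M powr (e - 3) / real M powr (- r)) \<longlonglongrightarrow> 0"
      unfolding tendsto_cong[OF ratio] by simp
    then show "(\<lambda>M. g M * real M powr (e - 3)) \<in> o(\<lambda>M. real M powr (- r))"
      using nz by (intro smalloI_tendsto)
  next
    assume "(\<lambda>M. g M * real M powr (e - 3)) \<in> o(\<lambda>M. real M powr (- r))"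
    then have lim: "(\<lambda>M. g M * real M powr (e - 3 + r)) \<longlonglongrightarrow> 0"
      using smalloD_tendsto tendsto_cong[OF ratio] by blast
    show "q < 2 * s + 1"
    proof (rule ccontr)
      assume "\<not> q < 2 * s + 1"
      \<comment> \<open>With a nonnegative exponent the ratio dominates its prefactor, whose limit
        is positive, so it cannot tend to 0.\<close>
      then have "0 \<le> e - 3 + r" unfolding d using s by simp
      then have "\<forall>\<^sub>F M in sequentially. g M \<le> g M * real M powr (e - 3 + r)"
      proof (intro eventually_sequentiallyI[of 1])
        fix M :: nat assume "1 \<le> M"
        then have "1 \<le> real M powr (e - 3 + r)" using \<open>0 \<le> e - 3 + r\<close>
            by (intro ge_one_powr_ge_zero) auto
        moreover have "0 \<le> g M" using Cbar by (simp add: g_def)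
        ultimately show "g M \<le> g M * real M powr (e - 3 + r)" using mult_left_mono[of 1]
            by fastforce
      qed
      from tendsto_le[OF sequentially_bot lim g this] have "Cbar * (2 * s * Cs / C1) powr e \<le> 0" .
      then show False using Cbar s Cs C1 by (simp add: mult_le_0_iff)
    qed
  qed
  then show ?thesis unfolding g_def e_def r_def .
qed

context smooth_model
begin

text \<open>Each of the three levels lies within a constant factor above the minimizer, while its
  first omitted index is no smaller than the minimizer. So rounding costs a constant factor, and
  bounds on \<open>C_total\<close> uniform in \<open>M\<close> make that constant common to all
  trials.\<close>

lemma risk_rate:
  assumes decay: "coef_decay S \<phi> s Cs" and growth: "polynomial_growth S V1 V2 q Cbar"
    and q: "q < 2 * s + 1" and \<kappa>: "0 < \<kappa>" and C1_pos: "0 < C1_MC S \<kappa> m_max"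
  obtains C where "0 < C"
    "\<And>(E :: ('w, 'u) trial) K. regular_trial S \<phi> \<alpha> L E C0 \<kappa> m_max \<Longrightarrow> variance_bound S E \<phi> \<alpha> V1 V2 \<Longrightarrow>
      K \<in> {K_star s Cs (C_total (C1_MC S \<kappa> m_max) Cbar \<alpha> (sample_size E)) (sample_size E),
        of_int \<lceil>K_star s Cs (C_total (C1_MC S \<kappa> m_max) Cbar \<alpha> (sample_size E)) (sample_size E)\<rceil>,
        of_int (round (K_star s Cs (C_total (C1_MC S \<kappa> m_max) Cbar \<alpha> (sample_size E)) (sample_size
            E)))} \<Longrightarrow>
      risk S E \<phi> K \<le> ennreal (C * real (sample_size E) powr (- (2 * s / (2 * s + 1))))"
proof -
  define C1 where "C1 = C1_MC S \<kappa> m_max"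
  have s: "0 < s" "0 < Cs" using decay by (auto simp: coef_decay_def)
  have C: "0 < Cbar" "0 \<le> q" using growth by (auto simp: polynomial_growth_def)
  have C1: "0 < C1" using C1_pos by (simp add: C1_def)
  have \<alpha>: "0 < \<alpha>" using hoelder by (simp add: hoelder_mean_def)
  define e where "e = (1 + 2 * q) / (2 * s + 1)"
  define r where "r = 2 * s / (2 * s + 1)"
  \<comment> \<open>A lower bound for the minimizer that is uniform in \<open>M\<close>, from
    \<open>C_total\<close> at most \<open>C1 + Cbar\<close> and \<open>M\<close> at least 1.\<close>
  define k0 where "k0 = (2 * s * Cs / (C1 + Cbar)) powr (1 / (2 * s + 1))"
  \<comment> \<open>Since the minimizer is at least \<open>k0\<close>, an additive rounding error of
    1 is at most \<open>1 / k0\<close> times the minimizer.\<close>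
  define c where "c = 1 + 1 / k0"
  define A where "A = (2 * s + 1) / (2 * s) * (2 * s * Cs * (C1 +
      Cbar) powr (2 * s)) powr (1 / (2 * s + 1))"
  \<comment> \<open>In the remainder \<open>C_total\<close> stands in a denominator and is bounded
    below by \<open>C1\<close>; here positivity of \<open>C1\<close> matters.\<close>
  define B where "B = Cbar * (2 * s * Cs / C1) powr e"
  have k0: "0 < k0" using s C C1 by (simp add: k0_def)
  have c: "1 \<le> c" using k0 by (simp add: c_def)
  have AB: "0 < A" "0 < B" using s C C1 by (simp_all add: A_def B_def)
  have pos: "0 < c * A + c powr (1 + 2 * q) * B" using c AB by (intro add_pos_pos) auto
  have main: "risk S E \<phi> K \<le> ennreal ((c * A + c powr (1 +
      2 * q) * B) * real (sample_size E) powr (- r))"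
    if trial: "regular_trial S \<phi> \<alpha> L E C0 \<kappa> m_max" and var: "variance_bound S E \<phi> \<alpha> V1 V2"
      and Kmem: "K \<in> {K_star s Cs (C_total C1 Cbar \<alpha> (sample_size E)) (sample_size E),
        of_int \<lceil>K_star s Cs (C_total C1 Cbar \<alpha> (sample_size E)) (sample_size E)\<rceil>,
        of_int (round (K_star s Cs (C_total C1 Cbar \<alpha> (sample_size E)) (sample_size E)))}"
    for E :: "('w, 'u) trial" and K
  proof -
    interpret regular_trial S \<phi> \<alpha> L E C0 \<kappa> m_max by fact
    define D where "D = C_total C1 Cbar \<alpha> M"
    define Z where "Z = K_star s Cs D M"
    have M: "1 \<le> M" using size by simp
    have D: "0 < D" "C1 \<le> D" "D \<le> C1 + Cbar"
      using C_total_bounds[OF _ C(1) \<alpha> M, of C1] C1 by (auto simp: D_def)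
    note Z = K_star_tradeoff[OF s D(1) M, folded Z_def]
    have "k0 \<le> Z" unfolding k0_def Z_def K_star_def
    proof (intro powr_mono2)
      have "2 * s * Cs / (C1 + Cbar) \<le> 2 * s * Cs / D" using s D C C1
          by (intro divide_left_mono) auto
      also have "\<dots> \<le> 2 * s * Cs * real M / D" using s D M by (intro divide_right_mono) auto
      finally show "2 * s * Cs / (C1 + Cbar) \<le> 2 * s * Cs * real M / D" .
    qed (use s C C1 in auto)
    \<comment> \<open>The second inequality allows the bias to be evaluated at \<open>Z\<close>,
      even when rounding goes down.\<close>
    have K: "0 \<le> K" "Z \<le> of_int \<lfloor>K\<rfloor> + 1" "K \<le> Z + 1"
      using Kmem Z(1) unfolding D_def[symmetric] Z_def[symmetric] round_def
      by (auto; linarith)+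
    have "1 \<le> Z / k0" using \<open>k0 \<le> Z\<close> k0 by simp
    then have "K \<le> Z + Z / k0" using K(3) by linarith
    then have Kc: "K \<le> c * Z" by (simp add: c_def algebra_simps)
    have "Cs * Z powr (- 2 * s) + C1 * (K / real M) + Cbar * (K / real M powr (1 + 2 * \<alpha>) +
        K powr (1 + 2 * q) / real M ^ 3) =
      Cs * Z powr (- 2 * s) + D / real M * K + Cbar * (K powr (1 + 2 * q) / real M ^ 3)"
      unfolding D_def C_total_divide[OF M] by (simp add: algebra_simps)
    \<comment> \<open>The bias is also enlarged by \<open>c\<close>, so that the minimal value at
      \<open>Z\<close> can be factored out.\<close>
    also have "\<dots> \<le> c * (Cs * Z powr (- 2 * s)) + D / real M * (c * Z) + Cbar * ((c * Z) powr (1 +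
        2 * q) / real M ^ 3)"
      using c Kc K D C s mult_right_mono[OF c, of "Cs * Z powr (- 2 * s)"]
      by (intro add_mono mult_left_mono divide_right_mono powr_mono2) auto
    also have "\<dots> = c * (Cs * Z powr (- 2 * s) + D / real M * Z) + c powr (1 +
        2 * q) * (Cbar * (Z powr (1 + 2 * q) / real M ^ 3))"
      using c Z(1) by (simp add: powr_mult algebra_simps)
    also have "\<dots> \<le> c * (A * real M powr (- r)) + c powr (1 + 2 * q) * (B * real M powr (- r))"
    proof (intro add_mono mult_left_mono)
      have "(2 * s * Cs * D powr (2 * s)) powr (1 / (2 * s + 1)) \<le> (2 * s * Cs * (C1 +
          Cbar) powr (2 * s)) powr (1 / (2 * s + 1))"
        using s D by (intro powr_mono2 mult_left_mono) auto
      then show "Cs * Z powr (- 2 * s) + D / real M * Z \<le> A * real M powr (- r)"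
        unfolding Z(3) A_def r_def using s by (intro mult_right_mono mult_left_mono) auto
      \<comment> \<open>The condition on \<open>q\<close> puts the remainder below the main
        rate.\<close>
      have "e - 3 \<le> - r"
        using remainder_exponent[OF s(1), of q] q s divide_neg_pos[of "2 * (q - (2 * s +
            1))" "2 * s + 1"]
        by (simp add: e_def r_def)
      then have "real M powr (e - 3) \<le> real M powr (- r)" using M by (intro powr_mono) auto
      moreover have "(2 * s * Cs / D) powr e \<le> (2 * s * Cs / C1) powr e"
        using s D C1 C unfolding e_def by (intro powr_mono2 divide_left_mono) auto
      ultimately show "Cbar * (Z powr (1 + 2 * q) / real M ^ 3) \<le> B * real M powr (- r)"
        unfolding Z(4) B_def e_def[symmetric] mult.assoc using C
            by (intro mult_left_mono mult_mono) auto
    qed (use c in auto)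
    finally have "Cs * Z powr (- 2 * s) + C1 * (K / real M) + Cbar * (K / real M powr (1 +
        2 * \<alpha>) + K powr (1 + 2 * q) / real M ^ 3)
      \<le> (c * A + c powr (1 + 2 * q) * B) * real M powr (- r)" by (simp add: algebra_simps)
    with risk_le[OF K(1) Z(1) K(2) decay var growth, folded C1_def] show ?thesis
      by (meson ennreal_leI order_trans)
  qed
  show ?thesis by (rule that[OF pos main[unfolded C1_def r_def]])
qed

end

theorem theorem3:
  fixes S :: "('u::{metric_space, second_countable_topology}) model"
    and \<phi> :: "nat \<Rightarrow> real \<Rightarrow> real"
    and L\<^sub>\<mu> :: "'u \<Rightarrow> real"
    and \<alpha> s Cs q Cbar C0 :: real
    and kappa :: "real \<Rightarrow> real \<Rightarrow> real"
    and c1 c2 :: "real \<Rightarrow> real \<Rightarrow> real \<Rightarrow> real \<Rightarrow> real \<Rightarrow> real \<Rightarrow> real"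
    and m_max :: nat
    and sample :: "('w, 'u) trial \<Rightarrow> bool"
    and \<kappa> C1 :: real
    and CM Kst last_term :: "nat \<Rightarrow> real"
  assumes "population S"
    and "orthonormal_basis S \<phi>"
    and "\<forall>k\<ge>1. \<exists>L. L-lipschitz_on (time_dom S) (\<phi> k)"
    and "hoelder_mean S \<alpha> L\<^sub>\<mu>"
    and "coef_decay S \<phi> s Cs"
    and "polynomial_growth S (var_const1 c1 S \<alpha> L\<^sub>\<mu>) (var_const2 c2 S \<alpha> L\<^sub>\<mu> \<phi>) q Cbar"
    and "continuous_on (time_dom S \<times> time_dom S) (\<lambda>(t, t'). Gamma_X S t t')"
    and "0 \<le> C0"
    and "\<kappa> = kappa (dens_min S) (dens_max S)" and "0 < \<kappa>"
    and "C1 = C1_MC S \<kappa> m_max"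
    and "\<And>M. CM M = C_total C1 Cbar \<alpha> M"
    and "\<And>M. Kst M = K_star s Cs (CM M) M"
    and "\<And>M. last_term M =
           Cbar * (2 * s * Cs / CM M) powr ((1 + 2 * q) / (2 * s + 1)) *
           real M powr ((1 + 2 * q) / (2 * s + 1) - 3)"
    and "\<And>E. sample E \<longleftrightarrow>
           data_generating S E \<and>
           admissible_weights S E C0 (mc_weight S E) \<and>
           second_moment_bound S E \<kappa> \<and>
           variance_bound S E \<phi> \<alpha> (var_const1 c1 S \<alpha> L\<^sub>\<mu>) (var_const2 c2 S \<alpha> L\<^sub>\<mu> \<phi>) \<and>
           (\<forall>i\<in>{1..subjects E}. 1 \<le> visits E i \<and> visits E i \<le> m_max) \<and>
           4 \<le> sample_size E"
  shows
    "(\<forall>E M. sample E \<and> M = sample_size E \<longrightarrow>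
        (\<forall>K::nat. 1 \<le> K \<longrightarrow>
           risk S E \<phi> (real K) \<le>
             ennreal (Cs * real K powr (- 2 * s) + C1 * (real K / real M) +
               Cbar * (real K / real M powr (1 + 2 * \<alpha>) + real K powr (1 + 2 * q) / real M ^ 3))) \<and>
        is_arg_min
          (\<lambda>K::real. Cs * K powr (- 2 * s) + C1 * K / real M + Cbar * K / real M powr (1 + 2 * \<alpha>))
          (\<lambda>K. 0 < K) (Kst M) \<and>
        risk S E \<phi> (Kst M) \<le>
          ennreal ((2 * s + 1) / (2 * s) * (2 * s * Cs * CM M powr (2 * s)) powr (1 / (2 * s + 1)) *
                   real M powr (- (2 * s / (2 * s + 1))) + last_term M)) \<and>
     (0 < C1 \<longrightarrow>
        (last_term \<in> o(\<lambda>M. real M powr (- (2 * s / (2 * s + 1)))) \<longleftrightarrow> q < 2 * s + 1) \<and>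
        (q < 2 * s + 1 \<longrightarrow>
           (\<exists>C>0. \<forall>E. sample E \<longrightarrow>
              (\<forall>K \<in> {Kst (sample_size E), of_int \<lceil>Kst (sample_size E)\<rceil>,
                      of_int (round (Kst (sample_size E)))}.
                 risk S E \<phi> K \<le>
                   ennreal (C * real (sample_size E) powr (- (2 * s / (2 * s + 1))))))))"
proof (intro conjI allI impI)
  have s: "0 < s" "0 < Cs" and Cbar: "0 < Cbar" and \<alpha>: "0 < \<alpha>"
    using assms by (auto simp: coef_decay_def polynomial_growth_def hoelder_mean_def)
  interpret smooth_model S \<phi> \<alpha> L\<^sub>\<mu>
    using assms by unfold_locales auto
  note sample = assms(15)
  have trial: "regular_trial S \<phi> \<alpha> L\<^sub>\<mu> E C0 \<kappa> m_max" if "sample E" for E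
    using that assms(10) unfolding sample by unfold_locales auto
  have C1: "0 \<le> C1" unfolding assms(11) by (rule C1_MC_nonneg[OF assms(10)])
  {
    fix E M assume EM: "sample E \<and> M = sample_size E"
    interpret regular_trial S \<phi> \<alpha> L\<^sub>\<mu> E C0 \<kappa> m_max using trial EM by blast
    have var: "variance_bound S E \<phi> \<alpha> (var_const1 c1 S \<alpha> L\<^sub>\<mu>) (var_const2 c2 S \<alpha> L\<^sub>\<mu> \<phi>)"
      using EM sample by blast
    have M: "1 \<le> M" "M = sample_size E" using EM size by auto
    have CM: "0 < CM M" using C_total_bounds[OF C1 Cbar \<alpha> M(1)] by (simp add: assms(12))
    note tradeoff = K_star_tradeoff[OF s CM M(1), folded assms(13)]
    note split = C_total_divide[OF M(1), of C1 Cbar \<alpha>, folded assms(12)]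
    \<comment> \<open>Used with \<open>x\<close> equal to the truncation level itself, which never
      exceeds its floor plus 1; this covers integer levels and the unrounded minimizer
      alike.\<close>
    note bound = risk_le[OF _ _ _ assms(5) var assms(6), folded assms(11) M(2)]
    show "risk S E \<phi> (real K) \<le>
        ennreal (Cs * real K powr (- 2 * s) + C1 * (real K / real M) +
          Cbar * (real K / real M powr (1 + 2 * \<alpha>) + real K powr (1 + 2 * q) / real M ^ 3))"
      if "1 \<le> K" for K :: nat
      using that by (intro bound) auto
    show "is_arg_min
        (\<lambda>K::real. Cs * K powr (- 2 * s) + C1 * K / real M + Cbar * K / real M powr (1 + 2 * \<alpha>))
        (\<lambda>K. 0 < K) (Kst M)"
      using tradeoff(1,2) unfolding is_arg_min_linorder add.assoc split[symmetric] by blast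
    have "risk S E \<phi> (Kst M) \<le> ennreal (Cs * Kst M powr (- 2 * s) + C1 * (Kst M / real M) +
        Cbar * (Kst M / real M powr (1 + 2 * \<alpha>) + Kst M powr (1 + 2 * q) / real M ^ 3))"
      using tradeoff(1) by (intro bound) linarith+
    also have "Cs * Kst M powr (- 2 * s) + C1 * (Kst M / real M) +
        Cbar * (Kst M / real M powr (1 + 2 * \<alpha>) + Kst M powr (1 + 2 * q) / real M ^ 3) =
      (Cs * Kst M powr (- 2 * s) + CM M / real M * Kst M) + Cbar * (Kst M powr (1 +
          2 * q) / real M ^ 3)"
      unfolding split by (simp add: algebra_simps)
    also have "\<dots> = (2 * s + 1) / (2 * s) * (2 * s * Cs * CM M powr (2 * s)) powr (1 / (2 * s + 1)) *
        real M powr (- (2 * s / (2 * s + 1))) + last_term M"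
      unfolding tradeoff(3,4) assms(14) by simp
    finally show "risk S E \<phi> (Kst M) \<le>
      ennreal ((2 * s + 1) / (2 * s) * (2 * s * Cs * CM M powr (2 * s)) powr (1 / (2 * s + 1)) *
        real M powr (- (2 * s / (2 * s + 1))) + last_term M)" .
  }
  assume C1_pos: "0 < C1"
  have "last_term = (\<lambda>M. Cbar * (2 * s * Cs / C_total C1 Cbar \<alpha> M) powr ((1 + 2 * q) / (2 * s +
      1)) *
      real M powr ((1 + 2 * q) / (2 * s + 1) - 3))"
    by (simp add: fun_eq_iff assms(12,14))
  then show "last_term \<in> o(\<lambda>M. real M powr (- (2 * s / (2 * s + 1)))) \<longleftrightarrow> q < 2 * s + 1"
    using remainder_smallo_iff[OF s C1_pos Cbar \<alpha>] by simp
  assume q: "q < 2 * s + 1"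
  obtain C where C: "0 < C"
    "\<And>(E :: ('w, 'u) trial) K. regular_trial S \<phi> \<alpha> L\<^sub>\<mu> E C0 \<kappa> m_max \<Longrightarrow>
      variance_bound S E \<phi> \<alpha> (var_const1 c1 S \<alpha> L\<^sub>\<mu>) (var_const2 c2 S \<alpha> L\<^sub>\<mu> \<phi>) \<Longrightarrow>
      K \<in> {Kst (sample_size E), of_int \<lceil>Kst (sample_size E)\<rceil>, of_int (round (Kst (sample_size
          E)))} \<Longrightarrow>
      risk S E \<phi> K \<le> ennreal (C * real (sample_size E) powr (- (2 * s / (2 * s + 1))))"
    using risk_rate[OF assms(5,6) q assms(10) C1_pos[unfolded assms(11)], where ?'w = 'w and ?C0.0
        = C0]
    unfolding assms(11)[symmetric] assms(12,13)[symmetric] by metis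
  show "\<exists>C>0. \<forall>E. sample E \<longrightarrow>
      (\<forall>K \<in> {Kst (sample_size E), of_int \<lceil>Kst (sample_size E)\<rceil>,
              of_int (round (Kst (sample_size E)))}.
         risk S E \<phi> K \<le>
           ennreal (C * real (sample_size E) powr (- (2 * s / (2 * s + 1)))))"
    using C trial sample by (intro exI[of _ C]) blast
qed

end
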